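(* Let $d\ge 1$ and $r>1$. Suppose that there exist constants $\alpha,\beta>0$ such that for all $t\ge0$, $$\mathbb{P}(\tau_e\ge t)\le\beta e^{-\alpha t^r}.$$ Then for all $\xi>0$ there exists $c=c(\xi,r,d)>0$ such that for all $n\in\mathbb{N}$ ($n\geq 1$) and all real $N\in[n,\infty)$, $$\mathbb{P}\big(\mathrm{T}_{[0,n]^d}(0,n\mathbf{e}_1)>(\mu(\mathbf{e}_1)+\xi)N\big)\le\exp\big(-c\,\mathrm{g}_{d,r}(n,N)\big),$$ where $$\mathrm{g}_{d,r}(n,N)=\begin{cases}N^r&\text{if }1<r<d,\\ N^d/(1+\log n)^{d-1}&\text{if }r=d,\\ N^r/n^{r-d}&\text{if }r>d.\end{cases}$$
   Context: First-passage percolation on $\mathbb{Z}^d$. Let $E(\mathbb{Z}^d)$ be the set of undirected nearest-neighbor edges $\{v,w\}$, $|v-w|_1=1$. To each edge $e$ is attached a non-negative random variable $\tau_e$; the family $(\tau_e)$ is independent and identically distributed, with a fixed law. A path is a finite sequence of vertices whose successive elements are nearest neighbors; it is also viewed as its set of edges, and its passage time is $\mathrm{T}(\gamma)=\sum_{e\in\gamma}\tau_e$. For $x,y\in\mathbb{R}^d$, $\mathrm{T}(x,y)$ is the infimum of $\mathrm{T}(\gamma)$ over all finite paths from $\lfloor x\rfloor$ to $\lfloor y\rfloor$ (coordinatewise floor). The time constant is the non-random a.s. limit $\mu(x)=\lim_{t\to\infty}t^{-1}\mathrm{T}(0,tx)$, which exists when $\mathbb{E}\tau_e<\infty$. For $D\subset\mathbb{R}^d$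 and $v,w\in\mathbb{Z}^d$, the restricted first passage time $\mathrm{T}_D(v,w)$ is the infimum of $\mathrm{T}(\gamma)$ over all paths $\gamma=(x_0,\dots,x_l)$ from $v$ to $w$ with $x_i\in D$ for all $1\le i\le l-1$ (and $+\infty$ if there is none). $\mathbf{e}_1$ is the first canonical basis vector. The constant $c$ may also depend on the fixed law of $\tau_e$ (in particular on $\alpha,\beta$), but not on $n,N$. *)

theory Defs
  imports "HOL-Probability.Probability"
begin

text \<open>
  The lattice of dimension \<open>d\<close> is the type \<open>int ^ 'd\<close> with \<open>d = CARD('d)\<close>, so \<open>d \<ge> 1\<close>
  holds automatically. An undirected edge is the two-element set of its endpoints, and
  a weight configuration is a function on edges.
\<close>

definition l1_norm :: "int ^ 'd \<Rightarrow> int" where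
  "l1_norm v = (\<Sum>i\<in>UNIV. \<bar>v $ i\<bar>)"

definition lattice_edges :: "(int ^ 'd) set set" where
  "lattice_edges = {{v, w} | v w. l1_norm (v - w) = 1}"

definition lattice_paths :: "int ^ 'd \<Rightarrow> int ^ 'd \<Rightarrow> (int ^ 'd) list set" where
  "lattice_paths v w = {xs. xs \<noteq> [] \<and> hd xs = v \<and> last xs = w \<and>
     (\<forall>i. Suc i < length xs \<longrightarrow> l1_norm (xs ! i - xs ! Suc i) = 1)}"

definition path_edges :: "(int ^ 'd) list \<Rightarrow> (int ^ 'd) set set" where
  "path_edges xs = {{xs ! i, xs ! Suc i} | i. Suc i < length xs}"

text \<open>The sum runs over the set of edges of the path: a repeated edge counts once.\<close>

definition passage_time :: "((int ^ 'd) set \<Rightarrow> real) \<Rightarrow> (int ^ 'd) list \<Rightarrow> real" where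
  "passage_time u xs = (\<Sum>e\<in>path_edges xs. u e)"

definition floor_vec :: "real ^ 'd \<Rightarrow> int ^ 'd" where
  "floor_vec x = (\<chi> i. \<lfloor>x $ i\<rfloor>)"

definition real_vec :: "int ^ 'd \<Rightarrow> real ^ 'd" where
  "real_vec v = (\<chi> i. real_of_int (v $ i))"

definition fp_time :: "((int ^ 'd) set \<Rightarrow> real) \<Rightarrow> real ^ 'd \<Rightarrow> real ^ 'd \<Rightarrow> ereal" where
  "fp_time u x y = (INF xs\<in>lattice_paths (floor_vec x) (floor_vec y). ereal (passage_time u xs))"

text \<open>
  Only the interior vertices of the path have to lie in \<open>D\<close>. In \<open>ereal\<close> the infimum over
  the empty set is \<open>\<infinity>\<close>.
\<close>

definition restricted_fp_time ::
    "(real ^ 'd) set \<Rightarrow> ((int ^ 'd) set \<Rightarrow> real) \<Rightarrow> int ^ 'd \<Rightarrow> int ^ 'd \<Rightarrow> ereal" where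
  "restricted_fp_time D u v w =
     (INF xs\<in>{xs \<in> lattice_paths v w. \<forall>i. 1 \<le> i \<and> Suc i < length xs \<longrightarrow> real_vec (xs ! i) \<in> D}.
        ereal (passage_time u xs))"

definition time_constant ::
    "'a measure \<Rightarrow> ((int ^ 'd) set \<Rightarrow> 'a \<Rightarrow> real) \<Rightarrow> real ^ 'd \<Rightarrow> real" where
  "time_constant M \<tau> x =
     (THE m. AE \<omega> in M. ((\<lambda>t. fp_time (\<lambda>e. \<tau> e \<omega>) 0 (t *\<^sub>R x) / ereal t) \<longlongrightarrow> ereal m) at_top)"

text \<open>Used for \<open>r > 1\<close> only.\<close>

definition rate_g :: "nat \<Rightarrow> real \<Rightarrow> nat \<Rightarrow> real \<Rightarrow> real" where
  "rate_g d r n N =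
     (if r < real d then N powr r
      else if r = real d then N ^ d / (1 + ln (real n)) ^ (d - 1)
      else N powr r / real n powr (r - real d))"

end

theory Submission
  imports Defs "HOL-Real_Asymp.Real_Asymp"
begin

text \<open>
  The passage time between two points is at most the average of the passage times over any family
  of paths joining them, so a unit flow \<open>\<theta>\<close> gives the bound \<open>\<Sum>\<^sub>e \<theta> e * \<tau> e\<close>. From each of the two
  endpoints the mass is spread inside the box by the flow of a Polya urn, which is uniform on every
  simplex \<open>\<Sum> x = k\<close> and hence loads the edges at distance \<open>k\<close> by about \<open>k\<close> to the power \<open>1 - d\<close>.
  Since \<open>log E exp (s * \<tau>) \<le> C * (s + s powr p)\<close> with \<open>p = r / (r - 1)\<close>, Chernoff's
  bound for such a flow is governed by \<open>\<Sum>\<^sub>e \<theta> e powr p\<close>, which is bounded, logarithmic or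
  polynomial in \<open>n\<close> according to whether \<open>r < d\<close>, \<open>r = d\<close> or \<open>r > d\<close>. For \<open>N\<close> much larger than
  \<open>n\<close> the two flows are joined by straight lines. For \<open>N\<close> comparable to \<open>n\<close> the flows only live near
  the corners, and they are joined by parallel chains of blocks in which the mean passage time is
  close to the time constant; the averages over the chains deviate with probability
  exponentially small in \<open>n\<close> to the power \<open>d\<close>.

  This bound also supplies the upper half of the almost sure convergence which makes the time
  constant well defined; the lower half is Steele's greedy argument for Kingman's theorem.
\<close>

subsection \<open>Lattice paths\<close>

text \<open>Where the rate comes from: only about k^(d-1) edges lie at distance k from a corner.
  Delaying layer k by t_k costs about k^(d-1) * t_k^r in the exponent; minimising this under the
  constraint that the t_k sum to N gives N^r / (sum over k <= n of k^(-(d-1)/(r-1)))^(r-1), which is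
  \<open>rate_g\<close> up to constants. The uniform flow is the dual object: the p-th powers of its
  weights lead to the same sum. A single path would only give N^r / n^(r-1), because its n edges can
  share the delay. When N is comparable to n, the corner regions have to be a small fraction of n,
  so that crossing them is cheap, and yet proportional to n, so that about n^(d-1) chains run
  between them. The claimed bound has no factor in front of the exponential. Factors are absorbed as
  soon as the rate is large; the finitely many n that remain need the separate fact that the
  probability stays below 1, which rests on \<open>\<tau>\<close> being at most
  \<open>mu k + \<xi>\<close> with positive probability.\<close>

lemma lattice_paths_iff:
  "xs \<in> lattice_paths v w \<longleftrightarrow>
     xs \<noteq> [] \<and> hd xs = v \<and> last xs = w \<and> successively (\<lambda>x y. l1_norm (x - y) = 1) xs"
  unfolding lattice_paths_def by (simp add: successively_conv_nth)

lemma path_edges_conv_zip: "path_edges xs = (\<lambda>(x, y). {x, y}) ` set (zip xs (tl xs))"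
  unfolding path_edges_def
proof (intro set_eqI iffI)
  fix e assume "e \<in> {{xs ! i, xs ! Suc i} |i. Suc i < length xs}"
  then obtain i where i: "Suc i < length xs" "e = {xs ! i, xs ! Suc i}" by auto
  hence "(xs ! i, xs ! Suc i) = zip xs (tl xs) ! i" "i < length (zip xs (tl xs))"
    by (auto simp: nth_tl)
  thus "e \<in> (\<lambda>(x, y). {x, y}) ` set (zip xs (tl xs))"
    using i(2) by (metis (mono_tags, lifting) case_prod_conv imageI nth_mem)
next
  fix e assume "e \<in> (\<lambda>(x, y). {x, y}) ` set (zip xs (tl xs))"
  thus "e \<in> {{xs ! i, xs ! Suc i} |i. Suc i < length xs}"
    by (force simp: set_zip nth_tl)
qed

lemma finite_path_edges [simp, intro]: "finite (path_edges xs)"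
  by (simp add: path_edges_conv_zip)

lemma path_edges_Nil [simp]: "path_edges [] = {}"
  and path_edges_single [simp]: "path_edges [x] = {}"
  and path_edges_Cons [simp]: "path_edges (x # y # zs) = insert {x, y} (path_edges (y # zs))"
  by (simp_all add: path_edges_conv_zip)

lemma path_edges_append:
  "xs \<noteq> [] \<Longrightarrow> path_edges (xs @ ys) = path_edges xs \<union> path_edges (last xs # ys)"
proof (induction xs rule: induct_list012)
  case (2 x) then show ?case by simp
qed auto

lemma path_edges_rev: "path_edges (rev xs) = path_edges xs"
proof (induction xs rule: induct_list012)
  case (3 x y zs)
  have "path_edges (rev (x # y # zs)) = path_edges (rev (y # zs) @ [x])" by simp
  also have "\<dots> = path_edges (rev (y # zs)) \<union> path_edges [y, x]"
    by (subst path_edges_append) auto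
  finally show ?case using 3 by (auto simp: insert_commute)
qed auto

lemma path_edges_map: "path_edges (map f xs) = (`) f ` path_edges xs"
  by (induction xs rule: induct_list012) auto

lemma card_path_edges_le: "card (path_edges xs) \<le> length xs - 1"
proof -
  have "card (path_edges xs) \<le> card (set (zip xs (tl xs)))"
    unfolding path_edges_conv_zip by (rule card_image_le) simp
  also have "\<dots> \<le> length (zip xs (tl xs))" by (rule card_length)
  finally show ?thesis by simp
qed

lemma path_edges_subset_Pow: "path_edges xs \<subseteq> Pow (set xs)"
  by (induction xs rule: induct_list012) auto

lemma l1_norm_minus_commute: "l1_norm (v - w) = l1_norm (w - v)"
  unfolding l1_norm_def by (simp add: abs_minus_commute)

lemma edge_in_lattice_edges: "l1_norm (v - w) = 1 \<Longrightarrow> {v, w} \<in> lattice_edges"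
  unfolding lattice_edges_def by blast

lemma path_edges_lattice:
  assumes "xs \<in> lattice_paths v w"
  shows "path_edges xs \<subseteq> lattice_edges"
  using assms unfolding lattice_paths_def path_edges_def lattice_edges_def by blast

lemma l1_norm_eq_1_iff:
  fixes v :: "int ^ 'd"
  shows "l1_norm v = 1 \<longleftrightarrow> (\<exists>i. v = axis i 1 \<or> v = axis i (-1))"
proof
  assume *: "l1_norm v = 1"
  then obtain i where i: "v $ i \<noteq> 0"
    unfolding l1_norm_def by (metis abs_zero sum.neutral zero_neq_one)
  have "\<bar>v $ i\<bar> + (\<Sum>j\<in>UNIV - {i}. \<bar>v $ j\<bar>) = 1"
    using * unfolding l1_norm_def by (simp add: sum.remove)
  moreover have "(\<Sum>j\<in>UNIV - {i}. \<bar>v $ j\<bar>) \<ge> 0" by (simp add: sum_nonneg)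
  ultimately have 1: "\<bar>v $ i\<bar> = 1" and 0: "(\<Sum>j\<in>UNIV - {i}. \<bar>v $ j\<bar>) = 0"
    using i by linarith+
  have "v $ j = 0" if "j \<noteq> i" for j
    using 0 that by (subst (asm) sum_nonneg_eq_0_iff) auto
  hence "v = axis i (v $ i)" by (simp add: vec_eq_iff axis_def)
  moreover have "v $ i = 1 \<or> v $ i = -1" using 1 by linarith
  ultimately show "\<exists>i. v = axis i 1 \<or> v = axis i (-1)" by metis
next
  have "l1_norm (axis i a) = \<bar>a\<bar>" for i :: 'd and a :: int
    unfolding l1_norm_def axis_def by (simp add: if_distrib[of abs] cong: if_cong)
  thus "\<exists>i. v = axis i 1 \<or> v = axis i (-1) \<Longrightarrow> l1_norm v = 1" by force
qed

lemma l1_norm_axis: "\<bar>a\<bar> = 1 \<Longrightarrow> l1_norm (axis i a) = 1"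
  by (subst l1_norm_eq_1_iff) (auto simp: abs_if split: if_splits)

lemma axis_zero [simp]: "axis i 0 = 0"
  by (simp add: axis_def vec_eq_iff)

lemma countable_lattice_edges [simp, intro]: "countable (lattice_edges :: (int ^ 'd) set set)"
proof -
  have "lattice_edges \<subseteq> (\<lambda>(v, w). {v, w}) ` (UNIV :: ((int ^ 'd) \<times> (int ^ 'd)) set)"
    unfolding lattice_edges_def by auto
  thus ?thesis by (rule countable_subset) auto
qed

subsection \<open>Passage times of paths inside a vertex set\<close>

text \<open>Here the endpoints must lie in \<open>V\<close> as well, unlike in
  \<open>restricted_fp_time\<close>; this makes the sets closed under concatenation and
  reversal.\<close>

definition paths_in :: "(int ^ 'd) set \<Rightarrow> int ^ 'd \<Rightarrow> int ^ 'd \<Rightarrow> (int ^ 'd) list set" where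
  "paths_in V v w = {xs \<in> lattice_paths v w. set xs \<subseteq> V}"

text \<open>Real valued, so that expectations can be taken directly. The infimum is meaningful only
  for a nonempty set of paths that is bounded below, hence the side conditions on
  \<open>paths_in\<close> and \<open>edge_nonneg\<close> below.\<close>

definition time_in :: "((int ^ 'd) set \<Rightarrow> real) \<Rightarrow> (int ^ 'd) set \<Rightarrow> int ^ 'd \<Rightarrow> int ^ 'd \<Rightarrow> real" where
  "time_in u V v w = (INF xs\<in>paths_in V v w. passage_time u xs)"

definition edge_nonneg :: "((int ^ 'd) set \<Rightarrow> real) \<Rightarrow> bool" where
  "edge_nonneg u \<longleftrightarrow> (\<forall>e\<in>lattice_edges. 0 \<le> u e)"

lemma passage_time_nonneg:
  assumes "edge_nonneg u" "xs \<in> lattice_paths v w"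
  shows "0 \<le> passage_time u xs"
  unfolding passage_time_def using assms path_edges_lattice[of xs v w]
  by (intro sum_nonneg) (auto simp: edge_nonneg_def)

lemma bdd_below_passage_times:
  assumes "edge_nonneg u"
  shows "bdd_below (passage_time u ` paths_in V v w)"
  using passage_time_nonneg[OF assms] by (intro bdd_belowI[of _ 0]) (auto simp: paths_in_def)

lemma time_in_le:
  assumes "edge_nonneg u" "xs \<in> paths_in V v w"
  shows "time_in u V v w \<le> passage_time u xs"
  unfolding time_in_def using assms by (intro cINF_lower bdd_below_passage_times)

lemma time_in_less_iff:
  assumes "edge_nonneg u" "paths_in V v w \<noteq> {}"
  shows "time_in u V v w < a \<longleftrightarrow> (\<exists>xs\<in>paths_in V v w. passage_time u xs < a)"
  unfolding time_in_def using assms by (intro cINF_less_iff bdd_below_passage_times)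

lemma time_in_nonneg:
  assumes "edge_nonneg u" "paths_in V v w \<noteq> {}"
  shows "0 \<le> time_in u V v w"
  unfolding time_in_def using assms passage_time_nonneg[OF assms(1)]
  by (intro cINF_greatest) (auto simp: paths_in_def)

lemma paths_in_mono: "V \<subseteq> V' \<Longrightarrow> paths_in V v w \<subseteq> paths_in V' v w"
  by (auto simp: paths_in_def)

lemma time_in_mono:
  assumes "edge_nonneg u" "paths_in V v w \<noteq> {}" "V \<subseteq> V'"
  shows "time_in u V' v w \<le> time_in u V v w"
  unfolding time_in_def using assms paths_in_mono[of V V' v w]
  by (intro cINF_superset_mono bdd_below_passage_times) auto

lemma paths_in_refl: "v \<in> V \<Longrightarrow> [v] \<in> paths_in V v v"
  by (auto simp: paths_in_def lattice_paths_iff)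

lemma paths_in_edge: "l1_norm (v - w) = 1 \<Longrightarrow> v \<in> V \<Longrightarrow> w \<in> V \<Longrightarrow> [v, w] \<in> paths_in V v w"
  by (auto simp: paths_in_def lattice_paths_iff)

lemma paths_in_rev: "xs \<in> paths_in V v w \<Longrightarrow> rev xs \<in> paths_in V w v"
  by (auto simp: paths_in_def lattice_paths_iff hd_rev last_rev l1_norm_minus_commute)

lemma paths_in_append:
  assumes "xs \<in> paths_in V v x" "ys \<in> paths_in V x w"
  shows "xs @ tl ys \<in> paths_in V v w"
    and "path_edges (xs @ tl ys) = path_edges xs \<union> path_edges ys"
proof -
  obtain zs where ys: "ys = x # zs"
    using assms(2) by (cases ys) (auto simp: paths_in_def lattice_paths_iff)
  have xs: "xs \<noteq> []" "last xs = x" using assms(1) by (auto simp: paths_in_def lattice_paths_iff)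
  show "xs @ tl ys \<in> paths_in V v w"
    using assms ys by (auto simp: paths_in_def lattice_paths_iff successively_append_iff successively_Cons)
  show "path_edges (xs @ tl ys) = path_edges xs \<union> path_edges ys"
    using path_edges_append[OF xs(1), of zs] ys xs by simp
qed

lemma paths_in_trans:
  "paths_in V v x \<noteq> {} \<Longrightarrow> paths_in V x w \<noteq> {} \<Longrightarrow> paths_in V v w \<noteq> {}"
  using paths_in_append(1) by blast

lemma time_in_refl:
  assumes "edge_nonneg u" "v \<in> V"
  shows "time_in u V v v = 0"
proof (rule antisym)
  show "time_in u V v v \<le> 0"
    using time_in_le[OF assms(1) paths_in_refl[OF assms(2)]] by (simp add: passage_time_def)
  show "0 \<le> time_in u V v v" using time_in_nonneg[OF assms(1)] paths_in_refl[OF assms(2)] by blast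
qed

lemma paths_in_commute: "paths_in V v w \<noteq> {} \<Longrightarrow> paths_in V w v \<noteq> {}"
  using paths_in_rev by blast

lemma time_in_commute: "time_in u V v w = time_in u V w v"
proof -
  have "paths_in V v w = rev ` paths_in V w v"
    using paths_in_rev by (force simp: image_iff)
  moreover have "passage_time u (rev xs) = passage_time u xs" for xs
    by (simp add: passage_time_def path_edges_rev)
  ultimately show ?thesis unfolding time_in_def by (simp add: image_image)
qed

text \<open>Near-optimal paths are concatenated. An edge that they share is counted once, so
  nonnegativity of the weights bounds the sum over the union by the two sums.\<close>

lemma time_in_triangle:
  assumes u: "edge_nonneg u" and ne: "paths_in V v x \<noteq> {}" "paths_in V x w \<noteq> {}"
  shows "time_in u V v w \<le> time_in u V v x + time_in u V x w"
proof (rule field_le_epsilon)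
  fix \<epsilon> :: real assume \<epsilon>: "0 < \<epsilon>"
  obtain xs where xs: "xs \<in> paths_in V v x" "passage_time u xs < time_in u V v x + \<epsilon> / 2"
    using time_in_less_iff[OF u ne(1), of "time_in u V v x + \<epsilon> / 2"] \<epsilon> by auto
  obtain ys where ys: "ys \<in> paths_in V x w" "passage_time u ys < time_in u V x w + \<epsilon> / 2"
    using time_in_less_iff[OF u ne(2), of "time_in u V x w + \<epsilon> / 2"] \<epsilon> by auto
  have "time_in u V v w \<le> passage_time u (xs @ tl ys)"
    by (rule time_in_le[OF u paths_in_append(1)[OF xs(1) ys(1)]])
  also have "\<dots> \<le> passage_time u xs + passage_time u ys"
  proof -
    have "0 \<le> u e" if "e \<in> path_edges xs \<inter> path_edges ys" for e
      using that u xs(1) path_edges_lattice[of xs v x] by (auto simp: edge_nonneg_def paths_in_def)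
    hence "0 \<le> (\<Sum>e\<in>path_edges xs \<inter> path_edges ys. u e)" by (intro sum_nonneg)
    thus ?thesis
      unfolding passage_time_def paths_in_append(2)[OF xs(1) ys(1)] by (subst sum_Un) auto
  qed
  finally show "time_in u V v w \<le> time_in u V v x + time_in u V x w + \<epsilon>" using xs ys by linarith
qed

lemma time_in_edge:
  assumes "edge_nonneg u" "l1_norm (v - w) = 1" "v \<in> V" "w \<in> V"
  shows "time_in u V v w \<le> u {v, w}"
  using time_in_le[OF assms(1) paths_in_edge[OF assms(2-4)]] by (simp add: passage_time_def)

lemma paths_in_line:
  assumes "\<And>j. j \<le> l \<Longrightarrow> v + axis i (int j) \<in> V"
  shows "paths_in V v (v + axis i (int l)) \<noteq> {}"
  using assms
proof (induction l)
  case 0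
  thus ?case using paths_in_refl[of v V] 0[of 0] by auto
next
  case (Suc l)
  have "axis i (int l) - axis i (int (Suc l)) = axis i (-1)"
    by (simp add: vec_eq_iff axis_def)
  hence "l1_norm (v + axis i (int l) - (v + axis i (int (Suc l)))) = 1"
    by (simp add: l1_norm_axis)
  moreover have "v + axis i (int l) \<in> V" "v + axis i (int (Suc l)) \<in> V"
    by (rule Suc.prems, simp)+
  ultimately have "paths_in V (v + axis i (int l)) (v + axis i (int (Suc l))) \<noteq> {}"
    using paths_in_edge by blast
  moreover have "paths_in V v (v + axis i (int l)) \<noteq> {}"
    by (rule Suc.IH, rule Suc.prems, simp)
  ultimately show ?case by (rule paths_in_trans[rotated])
qed

lemma line_edge: "{v + axis i (int j), v + axis i (int (Suc j))} \<in> lattice_edges"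
proof (rule edge_in_lattice_edges)
  have "v + axis i (int j) - (v + axis i (int (Suc j))) = axis i (-1)"
    by (simp add: vec_eq_iff axis_def)
  thus "l1_norm (v + axis i (int j) - (v + axis i (int (Suc j)))) = 1"
    by (simp add: l1_norm_axis)
qed

lemma time_in_line:
  assumes u: "edge_nonneg u" and "\<And>j. j \<le> l \<Longrightarrow> v + axis i (int j) \<in> V"
  shows "time_in u V v (v + axis i (int l)) \<le>
    (\<Sum>j<l. u {v + axis i (int j), v + axis i (int (Suc j))})"
  using assms(2)
proof (induction l)
  case 0
  thus ?case using time_in_refl[OF u, of v V] 0[of 0] by auto
next
  case (Suc l)
  have "axis i (int l) - axis i (int (Suc l)) = axis i (-1)"
    by (simp add: vec_eq_iff axis_def)
  hence *: "l1_norm (v + axis i (int l) - (v + axis i (int (Suc l)))) = 1"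
    by (simp add: l1_norm_axis)
  have V: "v + axis i (int l) \<in> V" "v + axis i (int (Suc l)) \<in> V"
    by (rule Suc.prems, simp)+
  have "time_in u V v (v + axis i (int (Suc l))) \<le> time_in u V v (v + axis i (int l)) +
      time_in u V (v + axis i (int l)) (v + axis i (int (Suc l)))"
  proof (rule time_in_triangle[OF u])
    show "paths_in V v (v + axis i (int l)) \<noteq> {}"
      by (rule paths_in_line, rule Suc.prems, simp)
    show "paths_in V (v + axis i (int l)) (v + axis i (int (Suc l))) \<noteq> {}"
      using paths_in_edge[OF * V] by blast
  qed
  also have "time_in u V (v + axis i (int l)) (v + axis i (int (Suc l))) \<le>
      u {v + axis i (int l), v + axis i (int (Suc l))}"
    by (rule time_in_edge[OF u * V])
  also have "time_in u V v (v + axis i (int l)) \<le>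
      (\<Sum>j<l. u {v + axis i (int j), v + axis i (int (Suc j))})"
    by (rule Suc.IH, rule Suc.prems, simp)
  finally show ?case by simp
qed

lemma paths_in_translate:
  "map ((+) z) ` paths_in V v w = paths_in ((+) z ` V) (z + v) (z + w)"
proof (intro set_eqI iffI)
  fix xs assume "xs \<in> map ((+) z) ` paths_in V v w"
  then obtain ys where "xs = map ((+) z) ys" "ys \<in> paths_in V v w" by blast
  thus "xs \<in> paths_in ((+) z ` V) (z + v) (z + w)"
    by (simp add: paths_in_def lattice_paths_iff successively_map hd_map last_map image_mono)
next
  fix xs assume xs: "xs \<in> paths_in ((+) z ` V) (z + v) (z + w)"
  have "map (\<lambda>x. x - z) xs \<in> paths_in V v w"
    using xs
    by (fastforce simp: paths_in_def lattice_paths_iff successively_map hd_map last_map)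
  moreover have "xs = map ((+) z) (map (\<lambda>x. x - z) xs)" by (simp add: comp_def)
  ultimately show "xs \<in> map ((+) z) ` paths_in V v w" by blast
qed

lemma time_in_translate:
  "time_in u ((+) z ` V) (z + v) (z + w) = time_in (\<lambda>e. u ((+) z ` e)) V v w"
proof -
  have "passage_time u (map ((+) z) xs) = passage_time (\<lambda>e. u ((+) z ` e)) xs" for xs
    unfolding passage_time_def path_edges_map
    by (subst sum.reindex) (auto intro!: inj_onI simp: inj_image_eq_iff)
  thus ?thesis unfolding time_in_def paths_in_translate[symmetric] by (simp add: image_image)
qed

lemma lattice_edges_translate:
  fixes z :: "int ^ 'd"
  shows "(+) z ` e \<in> lattice_edges \<longleftrightarrow> e \<in> lattice_edges"
proof -
  have *: "(+) z ` e \<in> lattice_edges" if "e \<in> lattice_edges" for z and e :: "(int ^ 'd) set"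
  proof -
    obtain v w where e: "e = {v, w}" "l1_norm (v - w) = 1"
      using \<open>e \<in> lattice_edges\<close> unfolding lattice_edges_def by auto
    have "{z + v, z + w} \<in> lattice_edges" using e by (intro edge_in_lattice_edges) simp
    thus ?thesis by (simp add: e)
  qed
  have "(+) (-z) ` (+) z ` e = e" by (simp add: image_image)
  thus ?thesis using *[of e z] *[of "(+) z ` e" "-z"] by auto
qed

text \<open>Locality: this is what turns disjointness of cubes into independence, and what allows
  configurations to be restricted to the lattice edges.\<close>

lemma time_in_cong:
  assumes "\<And>e. e \<in> lattice_edges \<Longrightarrow> e \<subseteq> V \<Longrightarrow> u e = u' e"
  shows "time_in u V v w = time_in u' V v w"
  unfolding time_in_def passage_time_def
proof (intro INF_cong sum.cong refl)
  fix xs e assume "xs \<in> paths_in V v w" "e \<in> path_edges xs"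
  thus "u e = u' e"
    using path_edges_lattice[of xs v w] path_edges_subset_Pow[of xs]
    by (intro assms) (auto simp: paths_in_def)
qed

text \<open>There are only countably many finite paths. The configuration \<open>f x\<close> is kept
  general so that the lemma serves both for the variables on \<open>M\<close> and for the
  coordinates of a product space.\<close>

lemma time_in_borel_measurable:
  assumes "\<And>e. e \<in> lattice_edges \<Longrightarrow> e \<subseteq> V \<Longrightarrow> (\<lambda>x. f x e) \<in> borel_measurable N"
  shows "(\<lambda>x. time_in (f x) V v w) \<in> borel_measurable N"
  unfolding time_in_def passage_time_def
proof (intro borel_measurable_cINF_real borel_measurable_sum)
  show "countable (paths_in V v w)" by simp
  fix xs e assume "xs \<in> paths_in V v w" "e \<in> path_edges xs"
  thus "(\<lambda>x. f x e) \<in> borel_measurable N"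
    using path_edges_lattice[of xs v w] path_edges_subset_Pow[of xs]
    by (intro assms) (auto simp: paths_in_def)
qed

text \<open>Along the path every level of the coordinate is crossed by a different edge.\<close>

lemma card_path_edges_ge:
  assumes "xs \<in> lattice_paths v w"
  shows "nat (w $ k - v $ k) \<le> card (path_edges xs)"
proof -
  \<comment> \<open>An edge is sent to the smaller of the \<open>k\<close>-coordinates of its
    endpoints; since a step changes the coordinate by at most 1, no level is skipped.\<close>
  have "{v $ k ..< w $ k} \<subseteq> (\<lambda>e. Min ((\<lambda>x. x $ k) ` e)) ` path_edges xs"
    using assms
  proof (induction xs arbitrary: v rule: induct_list012)
    case (3 x y zs)
    have IH: "{y $ k ..< w $ k} \<subseteq> (\<lambda>e. Min ((\<lambda>x. x $ k) ` e)) ` path_edges (y # zs)"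
      using "3.prems" by (intro "3.IH") (auto simp: lattice_paths_iff)
    obtain i where "x - y = axis i 1 \<or> x - y = axis i (-1)"
      using "3.prems" l1_norm_eq_1_iff[of "x - y"] by (auto simp: lattice_paths_iff)
    hence "(x - y) $ k = axis i 1 $ k \<or> (x - y) $ k = axis i (-1) $ k" by metis
    hence "\<bar>x $ k - y $ k\<bar> \<le> 1" by (auto simp: axis_def split: if_splits)
    hence "{x $ k ..< w $ k} \<subseteq> insert (min (x $ k) (y $ k)) {y $ k ..< w $ k}" by auto
    also have "\<dots> \<subseteq> (\<lambda>e. Min ((\<lambda>x. x $ k) ` e)) ` insert {x, y} (path_edges (y # zs))"
      using IH by (simp add: subset_insertI2)
    finally show ?case using "3.prems" by (simp add: lattice_paths_iff)
  qed (auto simp: lattice_paths_iff)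
  hence "card {v $ k ..< w $ k} \<le> card (path_edges xs)"
    by (meson surj_card_le finite_path_edges)
  thus ?thesis by simp
qed

subsection \<open>The urn flow\<close>

definition urn_level :: "nat \<Rightarrow> ('d::finite \<Rightarrow> nat) set" where
  "urn_level k = {x. sum x UNIV = k}"

text \<open>The stars-and-bars count of \<open>urn_level k\<close> in dimension \<open>d\<close>
  (see \<open>card_urn_level\<close>), real valued because it serves as a normalisation.\<close>

definition level_size :: "nat \<Rightarrow> nat \<Rightarrow> real" where
  "level_size d k = real ((k + d - 1) choose (d - 1))"

lemma coord_le_sum: "x i \<le> (sum x UNIV :: nat)" for x :: "'d::finite \<Rightarrow> nat"
  by (rule member_le_sum) auto

lemma sum_fun_upd_Suc: "sum (x(i := Suc (x i))) UNIV = Suc (sum x UNIV)"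
  for x :: "'d::finite \<Rightarrow> nat"
  by (simp add: sum.remove[of UNIV i])

lemma finite_sum_le: "finite {x :: 'd::finite \<Rightarrow> nat. sum x UNIV \<le> m}"
proof (rule finite_subset)
  show "{x :: 'd \<Rightarrow> nat. sum x UNIV \<le> m} \<subseteq> PiE UNIV (\<lambda>_. {..m})"
    using coord_le_sum by (auto simp: PiE_UNIV_domain intro: order_trans)
qed (auto intro: finite_PiE)

lemma finite_urn_level [simp, intro]: "finite (urn_level k)"
  using finite_sum_le[of k] by (rule finite_subset[rotated]) (auto simp: urn_level_def)

lemma finite_sum_less [simp, intro]: "finite {x :: 'd::finite \<Rightarrow> nat. sum x UNIV < m}"
  using finite_sum_le[of m] by (rule finite_subset[rotated]) auto

text \<open>Double counting of the edges between two consecutive levels, by their lower and by their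
  upper endpoint.\<close>

lemma sum_urn_level_Suc:
  fixes f :: "('d::finite \<Rightarrow> nat) \<Rightarrow> 'd \<Rightarrow> real"
  shows "(\<Sum>x\<in>urn_level k. \<Sum>i\<in>UNIV. f (x(i := Suc (x i))) i) =
         (\<Sum>y\<in>urn_level (Suc k). \<Sum>i | 0 < y i. f y i)"
proof -
  have "(\<Sum>x\<in>urn_level k. \<Sum>i\<in>UNIV. f (x(i := Suc (x i))) i) =
      (\<Sum>(x, i)\<in>urn_level k \<times> UNIV. f (x(i := Suc (x i))) i)"
    by (simp add: sum.cartesian_product)
  also have "\<dots> = (\<Sum>(y, i)\<in>Sigma (urn_level (Suc k)) (\<lambda>y. {i. 0 < y i}). f y i)"
  proof (rule sum.reindex_bij_witness[where
        i = "\<lambda>(y, i). (y(i := y i - 1), i)" and j = "\<lambda>(x, i). (x(i := Suc (x i)), i)"])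
    fix a :: "('d \<Rightarrow> nat) \<times> 'd" assume "a \<in> Sigma (urn_level (Suc k)) (\<lambda>y. {i. 0 < y i})"
    then obtain y i where a: "a = (y, i)" "sum y UNIV = Suc k" "0 < y i"
      by (auto simp: urn_level_def)
    moreover have "sum (y(i := y i - 1)) UNIV = k"
      using sum_fun_upd_Suc[of "y(i := y i - 1)" i] a by simp
    ultimately show "(case a of (y, i) \<Rightarrow> (y(i := y i - 1), i)) \<in> urn_level k \<times> UNIV"
      by (simp add: urn_level_def)
  qed (auto simp: urn_level_def sum_fun_upd_Suc fun_upd_same fun_upd_idem_iff simp del: fun_upd_apply)
  also have "\<dots> = (\<Sum>y\<in>urn_level (Suc k). \<Sum>i | 0 < y i. f y i)"
    by (simp add: sum.Sigma)
  finally show ?thesis .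
qed

text \<open>The balance equation of the urn: a point of level \<open>k + 1\<close> receives
  \<open>(k + 1) / (level_size d k * (k + d))\<close> in total, and this is
  \<open>1 / level_size d (k + 1)\<close>.\<close>

lemma level_size_Suc:
  assumes "0 < d"
  shows "level_size d (Suc k) * real (Suc k) = level_size d k * real (k + d)"
proof -
  have "(k + d - (d - 1)) * ((k + d) choose (d - 1)) = (k + d) * ((k + d - 1) choose (d - 1))"
    by (rule binomial_absorb_comp)
  moreover have "k + d - (d - 1) = Suc k" using assms by simp
  ultimately have "real (Suc k * ((k + d) choose (d - 1))) =
      real ((k + d) * ((k + d - 1) choose (d - 1)))" by simp
  moreover have "Suc k + d - 1 = k + d" by simp
  ultimately show ?thesis unfolding level_size_def of_nat_mult by (simp only: mult.commute)
qed

lemma level_size_0: "0 < d \<Longrightarrow> level_size d 0 = 1"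
  by (simp add: level_size_def)

text \<open>Give the edge that enters \<open>y\<close> in direction \<open>i\<close> the weight
  \<open>y i\<close>. Every upper endpoint collects \<open>k + 1\<close> and every lower endpoint
  emits \<open>k + d\<close>, so the cardinalities obey the recursion of
  \<open>level_size_Suc\<close>.\<close>

lemma card_urn_level: "real (card (urn_level k :: ('d::finite \<Rightarrow> nat) set)) = level_size CARD('d) k"
proof (induction k)
  case 0
  have "urn_level 0 = {\<lambda>_ :: 'd. 0}" by (auto simp: urn_level_def)
  thus ?case by (simp add: level_size_0)
next
  case (Suc k)
  have "real (Suc k) * card (urn_level (Suc k) :: ('d \<Rightarrow> nat) set) =
      (\<Sum>y\<in>(urn_level (Suc k) :: ('d \<Rightarrow> nat) set). real (sum y UNIV))"
    by (simp add: urn_level_def)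
  also have "\<dots> = (\<Sum>y\<in>(urn_level (Suc k) :: ('d \<Rightarrow> nat) set). \<Sum>i | 0 < y i. real (y i))"
    unfolding of_nat_sum by (intro sum.cong refl sum.mono_neutral_right) auto
  also have "\<dots> = (\<Sum>x\<in>(urn_level k :: ('d \<Rightarrow> nat) set). \<Sum>i\<in>UNIV. real ((x(i := Suc (x i))) i))"
    by (rule sum_urn_level_Suc[symmetric])
  also have "\<dots> = (\<Sum>x\<in>(urn_level k :: ('d \<Rightarrow> nat) set). real (sum x UNIV) + CARD('d))"
    by (simp add: sum.distrib)
  also have "\<dots> = real (k + CARD('d)) * card (urn_level k :: ('d \<Rightarrow> nat) set)"
    by (simp add: urn_level_def)
  also have "\<dots> = level_size CARD('d) (Suc k) * real (Suc k)"
    by (subst level_size_Suc) (simp_all add: Suc)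
  finally show ?case by simp
qed

lemma level_size_pos: "0 < d \<Longrightarrow> 0 < level_size d k"
  by (simp add: level_size_def)

text \<open>From the bound \<open>(n / j) ^ j\<close> for the binomial coefficient n over j. Writing
  \<open>Suc k\<close> keeps the base positive at level 0.\<close>

lemma level_size_ge:
  assumes "0 < d"
  shows "(real (Suc k) / real d) ^ (d - 1) \<le> level_size d k"
proof (cases "d = 1")
  case False
  have "real (Suc k) / real d \<le> real (k + d - 1) / real (d - 1)"
    using assms False by (intro frac_le) auto
  hence "(real (Suc k) / real d) ^ (d - 1) \<le> (real (k + d - 1) / real (d - 1)) ^ (d - 1)"
    by (intro power_mono) auto
  also have "\<dots> \<le> level_size d k"
    unfolding level_size_def by (intro binomial_ge_n_over_k_pow_k) simp
  finally show ?thesis .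
qed (simp add: level_size_def)

text \<open>
  Adding at \<open>x\<close> a unit in direction \<open>i\<close> with probability \<open>(x i + 1) / (k + d)\<close>, \<open>k = \<Sum> x\<close>,
  is the Polya urn scheme: it keeps the distribution uniform on every level. The weight is the
  resulting flow through the edge from \<open>x\<close> in direction \<open>i\<close>.
\<close>

definition urn_flow :: "('d::finite \<Rightarrow> nat) \<Rightarrow> 'd \<Rightarrow> real" where
  "urn_flow x i = real (Suc (x i)) / (level_size CARD('d) (sum x UNIV) * real (sum x UNIV + CARD('d)))"

text \<open>The signs \<open>s\<close> choose the orthant at \<open>b\<close> into which the flow
  spreads, so that one construction serves both endpoints.\<close>

definition orthant_point :: "int ^ 'd \<Rightarrow> ('d \<Rightarrow> int) \<Rightarrow> ('d \<Rightarrow> nat) \<Rightarrow> int ^ 'd" where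
  "orthant_point b s x = (\<chi> i. b $ i + s i * int (x i))"

definition urn_edge :: "int ^ 'd \<Rightarrow> ('d \<Rightarrow> int) \<Rightarrow> ('d \<Rightarrow> nat) \<times> 'd \<Rightarrow> (int ^ 'd) set" where
  "urn_edge b s = (\<lambda>(x, i). {orthant_point b s x, orthant_point b s (x(i := Suc (x i)))})"

lemma urn_flow_nonneg: "0 \<le> urn_flow x i"
  unfolding urn_flow_def
  by (intro divide_nonneg_nonneg mult_nonneg_nonneg less_imp_le[OF level_size_pos] of_nat_0_le_iff) auto

lemma sum_urn_flow_at:
  fixes x :: "'d::finite \<Rightarrow> nat"
  assumes "x \<in> urn_level k"
  shows "(\<Sum>i\<in>UNIV. urn_flow x i) = 1 / level_size CARD('d) k"
proof -
  have "(\<Sum>i\<in>UNIV. urn_flow x i) =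
      (\<Sum>i\<in>UNIV. real (Suc (x i))) / (level_size CARD('d) k * real (k + CARD('d)))"
    using assms unfolding urn_flow_def urn_level_def by (simp add: sum_divide_distrib)
  also have "(\<Sum>i\<in>UNIV. real (Suc (x i))) = real (k + CARD('d))"
    using assms by (simp add: urn_level_def sum.distrib flip: of_nat_sum)
  finally show ?thesis by (simp del: of_nat_add)
qed

lemma sum_urn_flow: "(\<Sum>x\<in>(urn_level k :: ('d::finite \<Rightarrow> nat) set). \<Sum>i\<in>UNIV. urn_flow x i) = 1"
proof -
  have "(\<Sum>x\<in>(urn_level k :: ('d \<Rightarrow> nat) set). \<Sum>i\<in>UNIV. urn_flow x i) =
      real (card (urn_level k :: ('d \<Rightarrow> nat) set)) / level_size CARD('d) k"
    by (simp add: sum_urn_flow_at)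
  thus ?thesis using level_size_pos[of "CARD('d)" k] by (simp add: card_urn_level)
qed

lemma urn_flow_le:
  fixes x :: "'d::finite \<Rightarrow> nat"
  shows "urn_flow x i \<le> 1 / level_size CARD('d) (sum x UNIV)"
proof -
  have *: "real (Suc (x i)) \<le> real (sum x UNIV + CARD('d))"
    using add_mono[OF coord_le_sum[of x i], of 1 "CARD('d)"] by (simp del: of_nat_add of_nat_Suc)
  show ?thesis
  proof -
    have Z: "0 < level_size CARD('d) (sum x UNIV)" and K: "0 < real (sum x UNIV + CARD('d))"
      by (simp_all add: level_size_pos del: of_nat_add)
    show ?thesis
      unfolding urn_flow_def using * Z K
      by (simp add: divide_simps mult_left_mono del: of_nat_add of_nat_Suc)
  qed
qed

lemma sum_less_Suc:
  fixes f :: "('d::finite \<Rightarrow> nat) \<Rightarrow> real"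
  shows "(\<Sum>x | sum x UNIV < Suc m. f x) = (\<Sum>x | sum x UNIV < m. f x) + (\<Sum>x\<in>urn_level m. f x)"
proof -
  have "{x :: 'd \<Rightarrow> nat. sum x UNIV < Suc m} = {x. sum x UNIV < m} \<union> urn_level m"
    by (auto simp: urn_level_def)
  moreover have "{x :: 'd \<Rightarrow> nat. sum x UNIV < m} \<inter> urn_level m = {}" by (auto simp: urn_level_def)
  ultimately show ?thesis by (simp add: sum.union_disjoint)
qed

lemma sum_urn_flow_less:
  "(\<Sum>x | sum x (UNIV :: 'd::finite set) < m. \<Sum>i\<in>UNIV. urn_flow x i) = real m"
  by (induction m) (simp_all add: sum_less_Suc sum_urn_flow)

text \<open>On level \<open>k\<close> the total flow is 1 and no edge carries more than
  \<open>1 / level_size CARD('d) k\<close>; so write \<open>urn_flow x i powr p\<close> as the flow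
  times its power \<open>p - 1\<close> and bound the latter by its maximum.\<close>

lemma sum_urn_flow_powr_le:
  assumes "p \<ge> 1"
  shows "(\<Sum>x | sum x (UNIV :: 'd::finite set) < m. \<Sum>i\<in>UNIV. urn_flow x i powr p) \<le>
    (\<Sum>k<m. level_size CARD('d) k powr (1 - p))"
proof (induction m)
  case (Suc m)
  have "urn_flow x i powr p \<le> urn_flow x i * level_size CARD('d) m powr (1 - p)"
    if "x \<in> urn_level m" for x :: "'d \<Rightarrow> nat" and i
  proof (cases "urn_flow x i = 0")
    case False
    hence pos: "urn_flow x i > 0" using urn_flow_nonneg[of x i] by linarith
    have Z: "level_size CARD('d) m > 0" by (simp add: level_size_pos)
    have "urn_flow x i powr p = urn_flow x i * urn_flow x i powr (p - 1)"
      using pos powr_add[of "urn_flow x i" 1 "p - 1"] by simp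
    also have "urn_flow x i powr (p - 1) \<le> (1 / level_size CARD('d) m) powr (p - 1)"
      using urn_flow_le[of x i] that assms pos by (intro powr_mono2) (auto simp: urn_level_def)
    also have "\<dots> = level_size CARD('d) m powr (1 - p)"
      using Z by (simp add: powr_divide powr_diff)
    finally show ?thesis using pos by simp
  qed (use assms in simp)
  hence "(\<Sum>x\<in>urn_level m. \<Sum>i\<in>UNIV. urn_flow (x :: 'd \<Rightarrow> nat) i powr p) \<le>
      (\<Sum>x\<in>urn_level m. \<Sum>i\<in>UNIV. urn_flow (x :: 'd \<Rightarrow> nat) i * level_size CARD('d) m powr (1 - p))"
    by (intro sum_mono) auto
  also have "\<dots> = level_size CARD('d) m powr (1 - p)"
    using sum_urn_flow[where ?'d = 'd, of m] by (simp flip: sum_distrib_right)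
  finally show ?case using Suc by (simp add: sum_less_Suc)
qed simp

lemma orthant_point_upd_diff:
  "orthant_point b s (x(i := Suc (x i))) = orthant_point b s x + axis i (s i)"
  by (simp add: orthant_point_def vec_eq_iff axis_def algebra_simps)

lemma urn_edge_lattice:
  assumes "\<And>i. \<bar>s i\<bar> = 1"
  shows "urn_edge b s (x, i) \<in> lattice_edges"
    and "l1_norm (orthant_point b s x - orthant_point b s (x(i := Suc (x i)))) = 1"
proof -
  show *: "l1_norm (orthant_point b s x - orthant_point b s (x(i := Suc (x i)))) = 1"
    using assms[of i] by (subst l1_norm_minus_commute) (simp add: orthant_point_upd_diff l1_norm_axis)
  thus "urn_edge b s (x, i) \<in> lattice_edges"
    unfolding urn_edge_def by (simp add: edge_in_lattice_edges)
qed

lemma inj_orthant_point: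
  assumes "\<And>i. \<bar>s i\<bar> = (1 :: int)"
  shows "inj (orthant_point b s)"
proof (rule injI)
  fix x y assume *: "orthant_point b s x = orthant_point b s y"
  have "x i = y i" for i
  proof -
    have "s i * int (x i) = s i * int (y i)"
      using * by (auto simp: orthant_point_def vec_eq_iff)
    moreover have "s i \<noteq> 0" using assms[of i] by auto
    ultimately show ?thesis by simp
  qed
  thus "x = y" by auto
qed

text \<open>Every edge of the flow raises the level by one, which singles out its lower endpoint.
  Injectivity makes the weights met by the flow independent.\<close>

lemma inj_urn_edge:
  assumes "\<And>i. \<bar>s i\<bar> = 1"
  shows "inj (urn_edge b s)"
proof (rule injI)
  fix a a' :: "('a \<Rightarrow> nat) \<times> 'a" assume *: "urn_edge b s a = urn_edge b s a'"
  obtain x i y j where a: "a = (x, i)" "a' = (y, j)" by (cases a, cases a')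
  let ?x = "x(i := Suc (x i))" and ?y = "y(j := Suc (y j))"
  from * consider "x = y" "?x = ?y" | "x = ?y" "?x = y"
    unfolding a urn_edge_def by (auto simp: doubleton_eq_iff inj_eq[OF inj_orthant_point[OF assms]])
  thus "a = a'"
  proof cases
    case 1
    have "?x i = ?y i" using 1 by simp
    hence "i = j" using 1 by (auto split: if_splits)
    thus ?thesis using 1 by (simp add: a)
  next
    case 2
    hence "sum x UNIV = Suc (sum y UNIV)" "Suc (sum x UNIV) = sum y UNIV"
      using sum_fun_upd_Suc[of y j] sum_fun_upd_Suc[of x i] by metis+
    thus ?thesis by simp
  qed
qed

lemma orthant_point_zero: "orthant_point b s (\<lambda>_. 0) = b"
  by (simp add: orthant_point_def vec_eq_iff)

lemma path_to_orthant_point: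
  assumes s: "\<And>i. \<bar>s i\<bar> = 1" and V: "\<And>y. sum y UNIV \<le> m \<Longrightarrow> orthant_point b s y \<in> V"
    and "sum x UNIV = m"
  shows "\<exists>xs\<in>paths_in V b (orthant_point b s x). card (path_edges xs) \<le> m"
  using assms(2,3)
proof (induction m arbitrary: x)
  case 0
  hence "x = (\<lambda>_. 0)" by auto
  hence "orthant_point b s x = b" by (simp add: orthant_point_zero)
  moreover from this have "b \<in> V" using 0(1)[of x] 0(2) by simp
  ultimately show ?case using paths_in_refl[of b V] by force
next
  case (Suc m)
  then obtain i where i: "x i > 0"
    by (metis Zero_not_Suc bot_nat_0.not_eq_extremum sum.neutral)
  let ?y = "x(i := x i - 1)"
  have x: "x = ?y(i := Suc (?y i))" using i by auto
  hence y: "sum ?y UNIV = m" using Suc.prems(2) sum_fun_upd_Suc[of ?y i] by simp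
  then obtain xs where xs: "xs \<in> paths_in V b (orthant_point b s ?y)" "card (path_edges xs) \<le> m"
    using Suc.IH[of ?y] Suc.prems(1) by (metis le_Suc_eq)
  have "l1_norm (orthant_point b s ?y - orthant_point b s x) = 1"
    by (subst x) (rule urn_edge_lattice(2)[OF s])
  moreover have "orthant_point b s ?y \<in> V" "orthant_point b s x \<in> V"
    using Suc.prems y by auto
  ultimately have e: "[orthant_point b s ?y, orthant_point b s x] \<in> paths_in V (orthant_point b s ?y) (orthant_point b s x)"
    by (rule paths_in_edge)
  have "card (path_edges xs \<union> {{orthant_point b s ?y, orthant_point b s x}}) \<le> Suc m"
    using xs by (intro order_trans[OF card_Un_le]) auto
  with paths_in_append[OF xs(1) e] show ?case
    by (intro bexI[of _ "xs @ tl [orthant_point b s ?y, orthant_point b s x]"]) auto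
qed

definition urn_sum :: "((int ^ 'd) set \<Rightarrow> real) \<Rightarrow> int ^ 'd \<Rightarrow> ('d \<Rightarrow> int) \<Rightarrow> nat \<Rightarrow> real" where
  "urn_sum u b s m = (\<Sum>x | sum x UNIV < m. \<Sum>i\<in>UNIV. urn_flow x i * u (urn_edge b s (x, i)))"

text \<open>This replaces a decomposition of the flow into paths. The flow carries the uniform law
  of level \<open>k\<close> to that of level \<open>k + 1\<close>, so along each of its edges the
  triangle inequality passes the average on to the next level at the price of the flow through the
  edges between them.\<close>

lemma avg_time_in_le_urn_sum:
  fixes b :: "int ^ 'd"
  assumes u: "edge_nonneg u" and s: "\<And>i. \<bar>s i\<bar> = 1"
    and V: "\<And>y. sum y UNIV \<le> m \<Longrightarrow> orthant_point b s y \<in> V"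
  shows "(\<Sum>x\<in>urn_level m. time_in u V b (orthant_point b s x)) / level_size CARD('d) m \<le> urn_sum u b s m"
  using V
proof (induction m)
  case 0
  have "urn_level 0 = {\<lambda>_ :: 'd. 0}" by (auto simp: urn_level_def)
  moreover have "b \<in> V" using 0[of "\<lambda>_. 0"] by (simp add: orthant_point_zero)
  ultimately show ?case
    by (simp add: level_size_0 orthant_point_zero time_in_refl[OF u] urn_sum_def)
next
  case (Suc k)
  let ?Z = "level_size CARD('d)" and ?K = "real (k + CARD('d))"
  let ?t = "\<lambda>x. time_in u V b (orthant_point b s x)"
  have Z: "?Z k > 0" "?Z (Suc k) > 0" by (simp_all add: level_size_pos)
  \<comment> \<open>The weight \<open>1 / ?Z (Suc k)\<close> of \<open>y\<close> is divided among
    its predecessors in proportion to \<open>y i\<close>; by \<open>level_size_Suc\<close> the share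
    is \<open>y i / (?Z k * ?K)\<close>, which is exactly the flow through that edge.\<close>
  have "(\<Sum>y\<in>urn_level (Suc k). ?t y) / ?Z (Suc k) =
      (\<Sum>y\<in>urn_level (Suc k). \<Sum>i | 0 < y i. real (y i) * (?t y / (?Z k * ?K)))"
  proof -
    have "(\<Sum>i | 0 < y i. real (y i) * (?t y / (?Z k * ?K))) = ?t y / ?Z (Suc k)"
      if "y \<in> urn_level (Suc k)" for y :: "'d \<Rightarrow> nat"
    proof -
      have "(\<Sum>i | 0 < y i. real (y i)) = (\<Sum>i\<in>UNIV. real (y i))"
        by (rule sum.mono_neutral_left) auto
      also have "\<dots> = real (Suc k)" using that by (simp add: urn_level_def flip: of_nat_sum)
      finally have "(\<Sum>i | 0 < y i. real (y i) * (?t y / (?Z k * ?K))) =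
          real (Suc k) * (?t y / (?Z k * ?K))" by (simp only: flip: sum_distrib_right)
      also have "\<dots> = ?t y / ?Z (Suc k)"
        using level_size_Suc[of "CARD('d)" k] Z
        by (simp add: field_simps del: of_nat_Suc of_nat_add)
      finally show ?thesis .
    qed
    thus ?thesis by (simp add: sum_divide_distrib)
  qed
  also have "\<dots> = (\<Sum>x\<in>urn_level k. \<Sum>i\<in>UNIV.
      real ((x(i := Suc (x i))) i) * (?t (x(i := Suc (x i))) / (?Z k * ?K)))"
    by (rule sum_urn_level_Suc[symmetric])
  also have "\<dots> = (\<Sum>x\<in>urn_level k. \<Sum>i\<in>UNIV. urn_flow x i * ?t (x(i := Suc (x i))))"
    by (intro sum.cong refl) (simp add: urn_flow_def urn_level_def)
  also have "\<dots> \<le> (\<Sum>x\<in>urn_level k. \<Sum>i\<in>UNIV. urn_flow x i * (?t x + u (urn_edge b s (x, i))))"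
  proof (intro sum_mono mult_left_mono urn_flow_nonneg)
    fix x :: "'d \<Rightarrow> nat" and i assume x: "x \<in> urn_level k"
    let ?y = "x(i := Suc (x i))"
    have V: "orthant_point b s x \<in> V" "orthant_point b s ?y \<in> V"
      using x by (auto intro!: Suc.prems simp only: sum_fun_upd_Suc) (auto simp: urn_level_def)
    have "\<exists>xs\<in>paths_in V b (orthant_point b s x). card (path_edges xs) \<le> k"
      using x Suc.prems by (intro path_to_orthant_point s) (auto simp: urn_level_def)
    hence "?t ?y \<le> ?t x + time_in u V (orthant_point b s x) (orthant_point b s ?y)"
      using paths_in_edge[OF urn_edge_lattice(2)[OF s] V] by (intro time_in_triangle u) auto
    also have "time_in u V (orthant_point b s x) (orthant_point b s ?y) \<le> u (urn_edge b s (x, i))"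
      unfolding urn_edge_def using time_in_edge[OF u urn_edge_lattice(2)[OF s] V] by simp
    finally show "?t ?y \<le> ?t x + u (urn_edge b s (x, i))" by simp
  qed
  also have "\<dots> = (\<Sum>x\<in>urn_level k. (\<Sum>i\<in>UNIV. urn_flow x i) * ?t x) +
      (\<Sum>x\<in>urn_level k. \<Sum>i\<in>UNIV. urn_flow x i * u (urn_edge b s (x, i)))"
    by (simp add: distrib_left sum.distrib sum_distrib_right)
  also have "(\<Sum>x\<in>urn_level k. (\<Sum>i\<in>UNIV. urn_flow x i) * ?t x) = (\<Sum>x\<in>urn_level k. ?t x) / ?Z k"
    by (simp add: sum_urn_flow_at sum_divide_distrib)
  also have "\<dots> \<le> urn_sum u b s k" using Suc by simp
  finally show ?case by (simp add: urn_sum_def sum_less_Suc)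
qed

subsection \<open>Exponential moments and large deviations of weighted sums\<close>

text \<open>The exponential parameter is meant to be contained in \<open>X\<close>. Working with
  nonnegative integrals lets the moment bounds stand in for integrability.\<close>

lemma (in prob_space) Chernoff_indep:
  fixes X :: "'i \<Rightarrow> 'a \<Rightarrow> real"
  assumes I: "finite I" and ind: "indep_vars (\<lambda>_. borel) X I"
    and b: "\<And>i. i \<in> I \<Longrightarrow> (\<integral>\<^sup>+\<omega>. ennreal (exp (X i \<omega>)) \<partial>M) \<le> ennreal (exp (b i))"
  shows "prob {\<omega>\<in>space M. x \<le> (\<Sum>i\<in>I. X i \<omega>)} \<le> exp ((\<Sum>i\<in>I. b i) - x)"
proof -
  have X [measurable]: "X i \<in> borel_measurable M" if "i \<in> I" for i
    using ind that by (simp add: indep_vars_def)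
  have "(\<integral>\<^sup>+\<omega>. ennreal (exp (\<Sum>i\<in>I. X i \<omega>)) \<partial>M) =
      (\<integral>\<^sup>+\<omega>. (\<Prod>i\<in>I. ennreal (exp (X i \<omega>))) \<partial>M)"
    by (intro nn_integral_cong) (simp add: exp_sum[OF I] prod_ennreal)
  also have "\<dots> = (\<Prod>i\<in>I. \<integral>\<^sup>+\<omega>. ennreal (exp (X i \<omega>)) \<partial>M)"
    by (intro indep_vars_nn_integral I indep_vars_compose2[OF ind]) auto
  also have "\<dots> \<le> (\<Prod>i\<in>I. ennreal (exp (b i)))"
    by (intro prod_mono_ennreal b)
  also have "\<dots> = ennreal (exp (\<Sum>i\<in>I. b i))" by (simp add: exp_sum[OF I] prod_ennreal)
  finally have *: "(\<integral>\<^sup>+\<omega>. ennreal (exp (\<Sum>i\<in>I. X i \<omega>)) \<partial>M) \<le> ennreal (exp (\<Sum>i\<in>I. b i))" .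
  have "emeasure M {\<omega>\<in>space M. x \<le> (\<Sum>i\<in>I. X i \<omega>)} =
      emeasure M {\<omega>\<in>space M. 1 \<le> ennreal (exp (-x)) * ennreal (exp (\<Sum>i\<in>I. X i \<omega>))}"
    by (intro arg_cong[of _ _ "emeasure M"] Collect_cong)
       (auto simp flip: ennreal_mult exp_add)
  also have "\<dots> \<le> ennreal (exp (-x)) *
      (\<integral>\<^sup>+\<omega>. ennreal (exp (\<Sum>i\<in>I. X i \<omega>)) * indicator (space M) \<omega> \<partial>M)"
    by (rule nn_integral_Markov_inequality) measurable
  also have "(\<integral>\<^sup>+\<omega>. ennreal (exp (\<Sum>i\<in>I. X i \<omega>)) * indicator (space M) \<omega> \<partial>M) =
      (\<integral>\<^sup>+\<omega>. ennreal (exp (\<Sum>i\<in>I. X i \<omega>)) \<partial>M)"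
    by (intro nn_integral_cong) auto
  also have "ennreal (exp (-x)) * \<dots> \<le> ennreal (exp (-x)) * ennreal (exp (\<Sum>i\<in>I. b i))"
    by (intro mult_left_mono *) auto
  also have "\<dots> = ennreal (exp ((\<Sum>i\<in>I. b i) - x))"
    by (simp add: ennreal_mult[symmetric] exp_add[symmetric])
  finally show ?thesis by (simp add: emeasure_eq_measure)
qed

text \<open>Slice by the integer part of \<open>Y\<close>: slice \<open>k\<close> contributes at
  most \<open>exp (k + 1)\<close> times its tail, and the rate 2 leaves a geometric series with
  ratio \<open>exp (-1)\<close>.\<close>

lemma (in prob_space) exp_moment_of_exp_tail:
  fixes Y :: "'a \<Rightarrow> real"
  assumes [measurable]: "Y \<in> borel_measurable M" and nn: "\<And>\<omega>. \<omega> \<in> space M \<Longrightarrow> 0 \<le> Y \<omega>"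
    and \<beta>: "\<beta> \<ge> 0"
    and tail: "\<And>k. prob {\<omega>\<in>space M. real k \<le> Y \<omega>} \<le> \<beta> * exp (-2 * real k)"
  shows "(\<integral>\<^sup>+\<omega>. ennreal (exp (Y \<omega>)) \<partial>M) \<le> ennreal (\<beta> * exp 1 / (1 - exp (-1)))"
proof -
  let ?A = "\<lambda>k. {\<omega>\<in>space M. real k \<le> Y \<omega>}"
  have "(\<integral>\<^sup>+\<omega>. ennreal (exp (Y \<omega>)) \<partial>M) \<le>
      (\<integral>\<^sup>+\<omega>. (\<Sum>k. ennreal (exp (real k + 1)) * indicator (?A k) \<omega>) \<partial>M)"
  proof (rule nn_integral_mono)
    fix \<omega> assume \<omega>: "\<omega> \<in> space M"
    define k where "k = nat \<lfloor>Y \<omega>\<rfloor>"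
    have k: "real k \<le> Y \<omega>" "Y \<omega> \<le> real k + 1"
      using nn[OF \<omega>] unfolding k_def by linarith+
    have "ennreal (exp (Y \<omega>)) \<le> ennreal (exp (real k + 1)) * indicator (?A k) \<omega>"
      using k \<omega> by (auto intro!: ennreal_leI)
    also have "\<dots> = (\<Sum>j\<in>{k}. ennreal (exp (real j + 1)) * indicator (?A j) \<omega>)"
      by (subst sum.insert) auto
    also have "\<dots> \<le> (\<Sum>k. ennreal (exp (real k + 1)) * indicator (?A k) \<omega>)"
      by (rule sum_le_suminf) auto
    finally show "ennreal (exp (Y \<omega>)) \<le> (\<Sum>k. ennreal (exp (real k + 1)) * indicator (?A k) \<omega>)" .
  qed
  also have "\<dots> = (\<Sum>k. ennreal (exp (real k + 1)) * emeasure M (?A k))"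
    by (subst nn_integral_suminf) (auto simp: nn_integral_cmult_indicator)
  also have "\<dots> \<le> (\<Sum>k. ennreal (\<beta> * exp 1 * exp (-1) ^ k))"
  proof (rule suminf_le)
    fix k
    have "ennreal (exp (real k + 1)) * emeasure M (?A k) =
        ennreal (exp (real k + 1) * prob (?A k))"
      by (simp add: emeasure_eq_measure ennreal_mult)
    also have "\<dots> \<le> ennreal (exp (real k + 1) * (\<beta> * exp (-2 * real k)))"
      by (intro ennreal_leI mult_left_mono tail) auto
    also have "exp (real k + 1) * (\<beta> * exp (-2 * real k)) = \<beta> * exp 1 * exp (-1) ^ k"
    proof -
      have "exp (real k + 1) * exp (-2 * real k) = exp (1 + real k * (-1) :: real)"
        by (subst exp_add[symmetric]) (simp add: algebra_simps)
      also have "\<dots> = exp 1 * exp (-1) ^ k" by (simp only: exp_add exp_of_nat_mult)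
      finally show ?thesis by (simp add: algebra_simps)
    qed
    finally show "ennreal (exp (real k + 1)) * emeasure M (?A k) \<le>
      ennreal (\<beta> * exp 1 * exp (-1) ^ k)" .
  qed auto
  also have "\<dots> = ennreal (\<Sum>k. \<beta> * exp 1 * exp (-1) ^ k)"
    using \<beta> by (intro suminf_ennreal2 summable_mult summable_geometric) auto
  also have "(\<Sum>k. \<beta> * exp 1 * exp (-1) ^ k) = \<beta> * exp 1 / (1 - exp (-1))"
    by (subst suminf_mult) (auto simp: suminf_geometric)
  finally show ?thesis .
qed

text \<open>Young's inequality with the coefficient of \<open>X powr r\<close> prescribed. The two
  sides of \<open>?y\<close>, where \<open>s\<close> equals
  \<open>\<alpha> / 2 * X powr (r - 1)\<close>, are each covered by one of the two terms.\<close>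

lemma linear_le_powr_plus_powr:
  fixes s X \<alpha> r :: real
  assumes "r > 1" "\<alpha> > 0" "s \<ge> 0" "X \<ge> 0"
  shows "s * X \<le> \<alpha> / 2 * X powr r + (2 / \<alpha>) powr (1 / (r - 1)) * s powr (r / (r - 1))"
proof (cases "s = 0 \<or> X = 0")
  case False
  hence pos: "s > 0" "X > 0" using assms by auto
  let ?y = "(2 * s / \<alpha>) powr (1 / (r - 1))"
  show ?thesis
  proof (cases "X \<le> ?y")
    case True
    hence "s * X \<le> s * ?y" using pos by simp
    also have "\<dots> = (2 / \<alpha>) powr (1 / (r - 1)) * (s powr 1 * s powr (1 / (r - 1)))"
      using pos assms powr_mult[of "2 / \<alpha>" s "1 / (r - 1)"] by simp
    also have "s powr 1 * s powr (1 / (r - 1)) = s powr (r / (r - 1))"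
    proof -
      have "1 + 1 / (r - 1) = r / (r - 1)" using assms by (simp add: field_simps)
      thus ?thesis by (simp only: powr_add[symmetric])
    qed
    finally show ?thesis using assms by (smt (verit) mult_nonneg_nonneg powr_ge_zero divide_nonneg_nonneg)
  next
    case False
    have "2 * s / \<alpha> = ?y powr (r - 1)" using pos assms by (simp add: powr_powr)
    also have "\<dots> \<le> X powr (r - 1)" using False assms by (intro powr_mono2) auto
    finally have "s \<le> \<alpha> / 2 * X powr (r - 1)" using assms by (simp add: field_simps)
    hence "s * X \<le> \<alpha> / 2 * X powr (r - 1) * X powr 1" using pos by (simp add: mult_right_mono)
    also have "\<dots> = \<alpha> / 2 * X powr r"
      using powr_add[of X "r - 1" 1] by (simp add: algebra_simps)
    finally show ?thesis using assms by (smt (verit) mult_nonneg_nonneg powr_ge_zero divide_nonneg_nonneg)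
  qed
qed (use assms in auto)

text \<open>The linear term is exact, so that after integration the mean enters without loss; this
  is needed where the bound has to be sharp to first order. The inequality
  \<open>exp y <= 1 + y * exp y\<close> is inserted into itself to reach second order.\<close>

lemma exp_le_quadratic:
  fixes l x :: real
  assumes "0 \<le> l" "l \<le> 1" "0 \<le> x"
  shows "exp (l * x) \<le> 1 + l * x + 2 * l\<^sup>2 * exp (2 * x)"
proof -
  have step: "exp y \<le> 1 + y * exp y" for y :: real
  proof -
    have "(1 - y) * exp y \<le> exp (-y) * exp y"
      using exp_ge_add_one_self[of "-y"] by (intro mult_right_mono) auto
    thus ?thesis by (simp add: algebra_simps flip: exp_add)
  qed
  define y where "y = l * x"
  have y: "0 \<le> y" "y \<le> x" unfolding y_def using assms by (auto intro: mult_left_le_one_le)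
  have "exp y \<le> 1 + y * (1 + y * exp y)"
    using step[of y] mult_left_mono[OF step[of y] y(1)] by linarith
  also have "\<dots> = 1 + y + l\<^sup>2 * (x\<^sup>2 * exp y)"
    by (simp add: y_def power2_eq_square algebra_simps)
  also have "x\<^sup>2 * exp y \<le> (2 * exp x) * exp x"
    using exp_lower_Taylor_quadratic[of x] assms y by (intro mult_mono) auto
  also have "\<dots> = 2 * exp (2 * x)" by (simp flip: exp_add)
  finally show ?thesis by (simp add: y_def mult_left_mono mult.assoc mult.left_commute)
qed

section \<open>Weighted sums of the passage times of distinct edges\<close>

locale fpp = prob_space M for M :: "'a measure" +
  fixes \<tau> :: "(int ^ 'd::finite) set \<Rightarrow> 'a \<Rightarrow> real" and r \<alpha> \<beta> :: real
  assumes indep: "indep_vars (\<lambda>_. borel) \<tau> lattice_edges"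
    and ident: "\<And>e e'. e \<in> lattice_edges \<Longrightarrow> e' \<in> lattice_edges \<Longrightarrow>
           distr M borel (\<tau> e) = distr M borel (\<tau> e')"
    and nonneg: "\<And>e \<omega>. e \<in> lattice_edges \<Longrightarrow> \<omega> \<in> space M \<Longrightarrow> 0 \<le> \<tau> e \<omega>"
    and r_gt_1: "r > 1" and \<alpha>_pos: "\<alpha> > 0" and \<beta>_pos: "\<beta> > 0"
    and tail: "\<And>e t. e \<in> lattice_edges \<Longrightarrow> 0 \<le> t \<Longrightarrow>
           measure M {\<omega> \<in> space M. \<tau> e \<omega> \<ge> t} \<le> \<beta> * exp (- \<alpha> * t powr r)"
begin

abbreviation \<tau>' :: "'a \<Rightarrow> (int ^ 'd) set \<Rightarrow> real" where
  "\<tau>' \<omega> \<equiv> (\<lambda>e. \<tau> e \<omega>)"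

lemma \<tau>_measurable [measurable]: "e \<in> lattice_edges \<Longrightarrow> \<tau> e \<in> borel_measurable M"
  using indep by (simp add: indep_vars_def)

lemma edge_nonneg_\<tau>: "\<omega> \<in> space M \<Longrightarrow> edge_nonneg (\<tau>' \<omega>)"
  by (simp add: edge_nonneg_def nonneg)

lemma indep_reindex:
  assumes "inj_on e I" "e ` I \<subseteq> lattice_edges"
  shows "indep_vars (\<lambda>_. borel) (\<lambda>i. \<tau> (e i)) I"
proof -
  have "indep_vars (\<lambda>i. PiM {e i} (\<lambda>_. borel)) (\<lambda>i \<omega>. restrict (\<tau>' \<omega>) {e i}) I"
    using assms by (intro indep_vars_restrict[OF indep]) (auto simp: disjoint_family_on_def inj_on_def)
  from indep_vars_compose2[OF this, of "\<lambda>i f. f (e i)" "\<lambda>_. borel"] show ?thesis by simp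
qed

text \<open>Half of the decay rate is spent: with \<open>\<alpha> / 2\<close> in the exponent the
  tail at \<open>k\<close> is still \<open>\<beta> * exp (-2 * k)\<close>, as
  \<open>exp_moment_of_exp_tail\<close> requires.\<close>

lemma exp_moment_powr:
  assumes e: "e \<in> lattice_edges"
  shows "(\<integral>\<^sup>+\<omega>. ennreal (exp (\<alpha> / 2 * \<tau> e \<omega> powr r)) \<partial>M) \<le> ennreal (\<beta> * exp 1 / (1 - exp (-1)))"
proof (rule exp_moment_of_exp_tail)
  fix k :: nat
  let ?t = "(2 * real k / \<alpha>) powr (1 / r)"
  have t: "?t powr r = 2 * real k / \<alpha>" using r_gt_1 \<alpha>_pos by (simp add: powr_powr)
  have "{\<omega>\<in>space M. real k \<le> \<alpha> / 2 * \<tau> e \<omega> powr r} \<subseteq> {\<omega> \<in> space M. \<tau> e \<omega> \<ge> ?t}"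
  proof safe
    fix \<omega> assume \<omega>: "\<omega> \<in> space M" and "real k \<le> \<alpha> / 2 * \<tau> e \<omega> powr r"
    hence "2 * real k / \<alpha> \<le> \<tau> e \<omega> powr r" using \<alpha>_pos by (simp add: field_simps)
    hence "?t \<le> (\<tau> e \<omega> powr r) powr (1 / r)" using r_gt_1 \<alpha>_pos by (intro powr_mono2) auto
    also have "\<dots> = \<tau> e \<omega>" using r_gt_1 nonneg[OF e \<omega>] by (simp add: powr_powr)
    finally show "?t \<le> \<tau> e \<omega>" .
  qed
  hence "prob {\<omega>\<in>space M. real k \<le> \<alpha> / 2 * \<tau> e \<omega> powr r} \<le> prob {\<omega> \<in> space M. \<tau> e \<omega> \<ge> ?t}"
    using e by (intro finite_measure_mono) measurable
  also have "\<dots> \<le> \<beta> * exp (- \<alpha> * ?t powr r)" by (rule tail[OF e]) simp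
  also have "- \<alpha> * ?t powr r = - 2 * real k" unfolding t using \<alpha>_pos by simp
  finally show "prob {\<omega>\<in>space M. real k \<le> \<alpha> / 2 * \<tau> e \<omega> powr r} \<le> \<beta> * exp (-2 * real k)" .
qed (use e \<alpha>_pos \<beta>_pos in \<open>auto intro: less_imp_le\<close>)

text \<open>For large \<open>s\<close> this is Young's inequality; the constant in front of the
  exponential is absorbed because \<open>s powr (r / (r - 1))\<close> is at least 1. For
  \<open>s < 1\<close> such a constant would be fatal, since it would be paid once for each of many
  edges of tiny weight. There convexity in \<open>s\<close> between 0 and 1 gives a bound that tends
  to 1 as \<open>s\<close> tends to 0.\<close>

lemma exp_moment_ex:
  "\<exists>C>0. \<forall>e\<in>lattice_edges. \<forall>s\<ge>0.
    (\<integral>\<^sup>+\<omega>. ennreal (exp (s * \<tau> e \<omega>)) \<partial>M) \<le> ennreal (exp (C * (s + s powr (r / (r - 1)))))"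
proof -
  let ?p = "r / (r - 1)"
  define B where "B = max 1 (\<beta> * exp 1 / (1 - exp (-1)))"
  define C1 where "C1 = (2 / \<alpha>) powr (1 / (r - 1))"
  have B: "B \<ge> 1" "\<beta> * exp 1 / (1 - exp (-1)) \<le> B" unfolding B_def by auto
  have C1: "C1 > 0" unfolding C1_def using \<alpha>_pos by simp
  have p: "?p > 0" using r_gt_1 by simp
  have bound: "(\<integral>\<^sup>+\<omega>. ennreal (exp (s * \<tau> e \<omega>)) \<partial>M) \<le> ennreal (B * exp (C1 * s powr ?p))"
    if e: "e \<in> lattice_edges" and s: "s \<ge> 0" for e s
  proof -
    have "(\<integral>\<^sup>+\<omega>. ennreal (exp (s * \<tau> e \<omega>)) \<partial>M) \<le>
        (\<integral>\<^sup>+\<omega>. ennreal (exp (C1 * s powr ?p)) * ennreal (exp (\<alpha> / 2 * \<tau> e \<omega> powr r)) \<partial>M)"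
    proof (rule nn_integral_mono)
      fix \<omega> assume "\<omega> \<in> space M"
      hence "s * \<tau> e \<omega> \<le> \<alpha> / 2 * \<tau> e \<omega> powr r + C1 * s powr ?p"
        unfolding C1_def using r_gt_1 \<alpha>_pos s nonneg[OF e] by (intro linear_le_powr_plus_powr)
      hence "exp (s * \<tau> e \<omega>) \<le> exp (C1 * s powr ?p) * exp (\<alpha> / 2 * \<tau> e \<omega> powr r)"
        by (simp flip: exp_add add: add.commute)
      thus "ennreal (exp (s * \<tau> e \<omega>)) \<le>
          ennreal (exp (C1 * s powr ?p)) * ennreal (exp (\<alpha> / 2 * \<tau> e \<omega> powr r))"
        by (simp flip: ennreal_mult add: ennreal_leI)
    qed
    also have "\<dots> = ennreal (exp (C1 * s powr ?p)) * (\<integral>\<^sup>+\<omega>. ennreal (exp (\<alpha> / 2 * \<tau> e \<omega> powr r)) \<partial>M)"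
      using e by (intro nn_integral_cmult) measurable
    also have "\<dots> \<le> ennreal (exp (C1 * s powr ?p)) * ennreal B"
      by (intro mult_left_mono order_trans[OF exp_moment_powr[OF e]] ennreal_leI B) auto
    finally show ?thesis using B by (simp add: ennreal_mult[symmetric] mult.commute)
  qed
  \<comment> \<open>The first two summands serve \<open>s >= 1\<close>, the last one
    \<open>s < 1\<close>.\<close>
  define C where "C = ln B + C1 + B * exp C1"
  have lnB: "ln B \<ge> 0" using B by simp
  have BC: "B * exp C1 > 0" using B by simp
  have C: "C > 0" unfolding C_def using lnB C1 BC by linarith
  have "(\<integral>\<^sup>+\<omega>. ennreal (exp (s * \<tau> e \<omega>)) \<partial>M) \<le> ennreal (exp (C * (s + s powr ?p)))"
    if e: "e \<in> lattice_edges" and s: "s \<ge> 0" for e s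
  proof (cases "s \<ge> 1")
    case True
    have "B * exp (C1 * s powr ?p) = exp (ln B + C1 * s powr ?p)"
      using B by (simp add: exp_add)
    also have "\<dots> \<le> exp (ln B * s powr ?p + C1 * s powr ?p)"
    proof -
      have "1 \<le> s powr ?p" using True p by (intro ge_one_powr_ge_zero) auto
      thus ?thesis using lnB mult_left_mono[of 1 "s powr ?p" "ln B"] by simp
    qed
    also have "\<dots> \<le> exp (C * (s + s powr ?p))"
    proof -
      have "ln B * s powr ?p + C1 * s powr ?p \<le> C * s powr ?p"
        unfolding C_def using BC by (simp add: distrib_right)
      also have "\<dots> \<le> C * (s + s powr ?p)" using C s by simp
      finally show ?thesis by simp
    qed
    finally show ?thesis using bound[OF e s] by (meson ennreal_leI order_trans)
  next
    case False
    have "(\<integral>\<^sup>+\<omega>. ennreal (exp (s * \<tau> e \<omega>)) \<partial>M) \<le>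
        (\<integral>\<^sup>+\<omega>. 1 + ennreal s * ennreal (exp (1 * \<tau> e \<omega>)) \<partial>M)"
    proof (rule nn_integral_mono)
      fix \<omega> assume "\<omega> \<in> space M"
      have "exp (s * \<tau> e \<omega>) = exp (\<tau> e \<omega>) powr s * 1 powr (1 - s)"
        by (simp add: powr_def mult.commute)
      also have "\<dots> \<le> s * exp (\<tau> e \<omega>) + (1 - s) * 1"
        using False s by (intro Youngs_inequality_0) auto
      also have "\<dots> \<le> 1 + s * exp (\<tau> e \<omega>)" using s by simp
      finally have "ennreal (exp (s * \<tau> e \<omega>)) \<le> ennreal (1 + s * exp (\<tau> e \<omega>))" by (rule ennreal_leI)
      also have "\<dots> = 1 + ennreal s * ennreal (exp (1 * \<tau> e \<omega>))"
        using s by (simp add: ennreal_plus ennreal_mult)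
      finally show "ennreal (exp (s * \<tau> e \<omega>)) \<le> 1 + ennreal s * ennreal (exp (1 * \<tau> e \<omega>))" .
    qed
    also have "\<dots> = 1 + ennreal s * (\<integral>\<^sup>+\<omega>. ennreal (exp (1 * \<tau> e \<omega>)) \<partial>M)"
      using e by (simp add: nn_integral_add nn_integral_cmult emeasure_space_1)
    also have "\<dots> \<le> 1 + ennreal s * ennreal (B * exp (C1 * 1 powr ?p))"
      by (intro add_left_mono mult_left_mono bound e) auto
    also have "\<dots> = ennreal (1 + s * (B * exp C1))"
      using s B by (simp add: ennreal_plus ennreal_mult)
    also have "\<dots> \<le> ennreal (exp (C * (s + s powr ?p)))"
    proof (rule ennreal_leI)
      have "1 + s * (B * exp C1) \<le> exp (s * (B * exp C1))"
        by (rule exp_ge_add_one_self)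
      also have "s * (B * exp C1) \<le> s * C"
        unfolding C_def using s lnB C1 by (intro mult_left_mono) auto
      also have "s * C \<le> C * (s + s powr ?p)" using C by (simp add: algebra_simps)
      finally show "1 + s * (B * exp C1) \<le> exp (C * (s + s powr ?p))" by simp
    qed
    finally show ?thesis .
  qed
  with C show ?thesis by blast
qed

definition mgfC :: real where
  "mgfC = (SOME C. C > 0 \<and> (\<forall>e\<in>lattice_edges. \<forall>s\<ge>0.
    (\<integral>\<^sup>+\<omega>. ennreal (exp (s * \<tau> e \<omega>)) \<partial>M) \<le> ennreal (exp (C * (s + s powr (r / (r - 1)))))))"

lemma mgfC_pos: "mgfC > 0"
  and exp_moment: "e \<in> lattice_edges \<Longrightarrow> s \<ge> 0 \<Longrightarrow>
    (\<integral>\<^sup>+\<omega>. ennreal (exp (s * \<tau> e \<omega>)) \<partial>M) \<le> ennreal (exp (mgfC * (s + s powr (r / (r - 1)))))"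
  using someI_ex[OF exp_moment_ex[unfolded Bex_def]] unfolding mgfC_def by auto

text \<open>What remains of \<open>l * x / 4\<close> for the parameter \<open>l\<close> of
  \<open>edge_sum_tail\<close> when \<open>x powr r / H powr (r - 1)\<close> is taken out.\<close>

definition devC :: real where
  "devC = 1 / (4 * (4 * mgfC) powr (r - 1))"

lemma devC_pos: "devC > 0"
  unfolding devC_def using mgfC_pos by simp

text \<open>The common source of all tail bounds for flows, lines and short paths. Chernoff's
  exponent has a part linear in the parameter \<open>l\<close>, which
  \<open>2 * mgfC * A <= x\<close> bounds by half of \<open>l * x\<close>, and a part governed by
  \<open>H\<close>, which the choice of \<open>l\<close> bounds by a quarter; a quarter is left
  over.\<close>

lemma edge_sum_tail:
  assumes I: "finite I" "inj_on e I" "e ` I \<subseteq> lattice_edges"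
    and w: "\<And>i. i \<in> I \<Longrightarrow> 0 \<le> w i" and A: "(\<Sum>i\<in>I. w i) \<le> A"
    and H: "(\<Sum>i\<in>I. w i powr (r / (r - 1))) \<le> H" "0 < H"
    and x: "2 * mgfC * A \<le> x"
  shows "prob {\<omega>\<in>space M. x \<le> (\<Sum>i\<in>I. w i * \<tau> (e i) \<omega>)} \<le> exp (- devC * x powr r / H powr (r - 1))"
proof (cases "x > 0")
  case False
  have "0 \<le> A" using sum_nonneg[of I w] w A by simp
  hence "0 \<le> x" using x mgfC_pos by (smt (verit) mult_nonneg_nonneg)
  thus ?thesis using False by simp
next
  case True
  let ?p = "r / (r - 1)" and ?C = mgfC
  \<comment> \<open>Solves \<open>?C * H * l powr ?p = l * x / 4\<close>, using
    \<open>?p - 1 = 1 / (r - 1)\<close>.\<close>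
  define l where "l = (x / (4 * ?C * H)) powr (r - 1)"
  have l: "l > 0" unfolding l_def using True H mgfC_pos by simp
  have "indep_vars (\<lambda>_. borel) (\<lambda>i. \<tau> (e i)) I" by (rule indep_reindex[OF I(2,3)])
  hence ind: "indep_vars (\<lambda>_. borel) (\<lambda>i \<omega>. l * w i * \<tau> (e i) \<omega>) I"
    by (rule indep_vars_compose2) measurable
  have "{\<omega>\<in>space M. x \<le> (\<Sum>i\<in>I. w i * \<tau> (e i) \<omega>)} =
      {\<omega>\<in>space M. l * x \<le> (\<Sum>i\<in>I. l * w i * \<tau> (e i) \<omega>)}"
    using l by (simp add: sum_distrib_left[symmetric] mult.assoc)
  also have "prob \<dots> \<le> exp ((\<Sum>i\<in>I. ?C * (l * w i + (l * w i) powr ?p)) - l * x)"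
    using I l w by (intro Chernoff_indep ind exp_moment) auto
  also have "(\<Sum>i\<in>I. ?C * (l * w i + (l * w i) powr ?p)) =
      ?C * (l * (\<Sum>i\<in>I. w i) + l powr ?p * (\<Sum>i\<in>I. w i powr ?p))"
    using l w by (simp add: sum_distrib_left sum.distrib distrib_left powr_mult algebra_simps)
  also have "exp (\<dots> - l * x) \<le> exp (- devC * x powr r / H powr (r - 1))"
  proof -
    have lp: "l powr ?p = l * (x / (4 * ?C * H))"
    proof -
      have "?p = 1 + 1 / (r - 1)" using r_gt_1 by (simp add: field_simps)
      hence "l powr ?p = l powr 1 * l powr (1 / (r - 1))" by (simp only: powr_add)
      also have "l powr (1 / (r - 1)) = x / (4 * ?C * H)"
        unfolding l_def using r_gt_1 True H mgfC_pos by (simp add: powr_powr)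
      finally show ?thesis using l by simp
    qed
    have "?C * (l * (\<Sum>i\<in>I. w i) + l powr ?p * (\<Sum>i\<in>I. w i powr ?p)) \<le> ?C * (l * A + l powr ?p * H)"
      using mgfC_pos A H l by (intro mult_left_mono add_mono) auto
    also have "\<dots> = l * (?C * A) + ?C * H * (l * (x / (4 * ?C * H)))"
      unfolding lp by (simp add: algebra_simps)
    also have "\<dots> \<le> l * (x / 2) + l * (x / 4)"
      using l x mgfC_pos H by (intro add_mono mult_left_mono) auto
    finally have "?C * (l * (\<Sum>i\<in>I. w i) + l powr ?p * (\<Sum>i\<in>I. w i powr ?p)) - l * x \<le> - (l * x / 4)"
      by simp
    also have "l * x / 4 = devC * x powr r / H powr (r - 1)"
    proof -
      have "x powr r = x powr (r - 1) * x" using powr_add[of x "r - 1" 1] True by simp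
      thus ?thesis
        unfolding l_def devC_def using True H mgfC_pos by (simp add: powr_divide powr_mult)
    qed
    finally show ?thesis by simp
  qed
  finally show ?thesis .
qed

end

subsection \<open>Rates\<close>

text \<open>The common denominator of the three regimes: the rate becomes
  \<open>N powr r / slowdown d r n\<close> in each of them, and the case distinction is confined to
  this section.\<close>

definition slowdown :: "nat \<Rightarrow> real \<Rightarrow> nat \<Rightarrow> real" where
  "slowdown d r n = (if r < real d then 1 else if r = real d then (1 + ln (real n)) ^ (d - 1)
     else real n powr (r - real d))"

lemma rate_g_eq:
  assumes "N > 0"
  shows "rate_g d r n N = N powr r / slowdown d r n"
  unfolding rate_g_def slowdown_def using assms by (auto simp: powr_realpow)

lemma slowdown_ge_1: "n \<ge> 1 \<Longrightarrow> slowdown d r n \<ge> 1"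
  unfolding slowdown_def by (auto intro!: one_le_power ge_one_powr_ge_zero)

text \<open>Says that away from the corners the deviations are no likelier than at the corners:
  \<open>n powr r / slowdown d r n\<close> is at most \<open>n powr d\<close>, the speed available
  in the bulk.\<close>

lemma powr_le_slowdown:
  assumes "n \<ge> 1"
  shows "real n powr (r - real d) \<le> slowdown d r n"
proof -
  have "real n powr (r - real d) \<le> 1" if "r \<le> real d"
    using powr_mono[of "r - real d" 0 "real n"] that assms by simp
  thus ?thesis using slowdown_ge_1[OF assms, of d r] unfolding slowdown_def
    by (auto split: if_splits)
qed

lemma slowdown_le:
  assumes "n \<ge> 1" "d \<ge> 1" "r > 1"
  shows "slowdown d r n \<le> real n powr (r - 1)"
proof -
  have "1 + ln (real n) \<le> real n" using ln_add_one_self_le_self[of "real n - 1"] assms by simp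
  hence "(1 + ln (real n)) ^ (d - 1) \<le> real n ^ (d - 1)"
    using assms by (intro power_mono) auto
  also have "\<dots> = real n powr (real d - 1)"
    using assms by (subst powr_realpow[symmetric]) (auto simp: of_nat_diff)
  finally show ?thesis
    unfolding slowdown_def using assms by (auto intro!: ge_one_powr_ge_zero powr_mono)
qed

text \<open>Used twice: it makes the tails summable in \<open>n\<close>, and it shows that a bounded
  rate leaves only finitely many \<open>n\<close>.\<close>

lemma rate_g_ge_n:
  assumes "n \<ge> 1" "d \<ge> 1" "r > 1" "N \<ge> real n"
  shows "real n \<le> rate_g d r n N"
proof -
  have "real n * slowdown d r n \<le> real n powr 1 * real n powr (r - 1)"
    using slowdown_le[OF assms(1-3)] assms by simp
  also have "\<dots> = real n powr r" by (subst powr_add[symmetric]) simp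
  also have "\<dots> \<le> N powr r" using assms by (intro powr_mono2) auto
  finally show ?thesis
    using slowdown_ge_1[OF assms(1), of d r] assms by (simp add: rate_g_eq field_simps)
qed

text \<open>The induction step needs that \<open>t powr q\<close> with \<open>q = 1 - p\<close>
  grows by at least \<open>q * t powr (-p)\<close> from \<open>n\<close> to
  \<open>t = n + 1\<close>. This is concavity, obtained from the weighted mean inequality applied to
  \<open>n / t\<close> and 1.\<close>

lemma sum_powr_le_powr:
  fixes p :: real
  assumes "0 \<le> p" "p < 1" "n \<ge> 1"
  shows "(\<Sum>k<n. real (Suc k) powr (-p)) \<le> real n powr (1 - p) / (1 - p)"
  using assms(3)
proof (induction n rule: nat_induct_at_least)
  case base
  show ?case using assms by (simp add: field_simps)
next
  case (Suc n)
  define q where "q = 1 - p"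
  define t where "t = real (Suc n)"
  have q: "0 < q" "q \<le> 1" unfolding q_def using assms by auto
  have t: "t > 0" "real n = t * (real n / t)" "real n / t = 1 - 1 / t"
    unfolding t_def by (auto simp: field_simps)
  have "(real n / t) powr q * 1 powr (1 - q) \<le> q * (real n / t) + (1 - q) * 1"
    using q Suc.hyps t(1) by (intro Youngs_inequality_0) auto
  hence "(real n / t) powr q \<le> 1 - q / t" unfolding t(3) by (simp add: algebra_simps)
  hence "t powr q * (real n / t) powr q \<le> t powr q * (1 - q / t)" by (intro mult_left_mono) auto
  also have "t powr q * (real n / t) powr q = real n powr q"
    using t by (subst powr_mult[symmetric]) auto
  finally have "real n powr q + q * (t powr q / t) \<le> t powr q" by (simp add: algebra_simps)
  moreover have "t powr q / t = t powr (-p)"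
    using t(1) powr_diff[of t q 1] by (simp add: q_def)
  ultimately have "(real n powr q + q * t powr (-p)) / q \<le> t powr q / q"
    using q by (intro divide_right_mono) auto
  hence "real n powr q / q + t powr (-p) \<le> t powr q / q"
    using q by (simp add: add_divide_distrib)
  thus ?case using Suc.IH by (simp add: q_def t_def)
qed

lemma sum_inverse_le_ln:
  assumes "n \<ge> 1"
  shows "(\<Sum>k<n. real (Suc k) powr (-1)) \<le> 1 + ln (real n)"
  using assms
proof (induction n rule: nat_induct_at_least)
  case (Suc n)
  have "ln (real n / real (Suc n)) \<le> real n / real (Suc n) - 1"
    using Suc.hyps by (intro ln_le_minus_one) auto
  hence "ln (real n) + 1 / real (Suc n) \<le> ln (real (Suc n))"
    using Suc.hyps by (simp add: ln_div field_simps)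
  thus ?case using Suc.IH by (simp add: powr_minus_divide)
qed simp

text \<open>The exponent \<open>1 - r / (r - 1)\<close> is \<open>-1 / (r - 1)\<close>, so the
  summands decay like \<open>k powr (-p)\<close> with \<open>p = (d - 1) / (r - 1)\<close>. The
  series converges for \<open>r < d\<close>, is harmonic for \<open>r = d\<close> and grows like
  \<open>n powr ((r - d) / (r - 1))\<close> for \<open>r > d\<close>; the outer power
  \<open>r - 1\<close> then gives \<open>slowdown\<close>.\<close>

lemma sum_level_size_powr_le:
  assumes d: "d \<ge> 1" and r: "r > 1"
  shows "\<exists>K>0. \<forall>n\<ge>1. (\<Sum>k<n. level_size d k powr (1 - r / (r - 1))) powr (r - 1) \<le> K * slowdown d r n"
proof -
  define p where "p = (real d - 1) / (r - 1)"
  define D where "D = real d powr p"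
  have p0: "0 \<le> p" unfolding p_def using d r by simp
  have D: "D > 0" unfolding D_def using d by simp
  have summand: "level_size d k powr (1 - r / (r - 1)) \<le> D * real (Suc k) powr (-p)" for k
  proof -
    have e: "1 - r / (r - 1) = - (1 / (r - 1))" using r by (simp add: field_simps)
    have "level_size d k powr (- (1 / (r - 1))) \<le> ((real (Suc k) / real d) ^ (d - 1)) powr (- (1 / (r - 1)))"
      using level_size_ge[of d k] d r by (intro powr_mono2') auto
    also have "\<dots> = (real (Suc k) / real d) powr (-p)"
      using d by (subst powr_realpow[symmetric]) (auto simp: powr_powr p_def of_nat_diff)
    also have "\<dots> = D * real (Suc k) powr (-p)"
      unfolding D_def using d by (simp add: powr_divide powr_minus field_simps)
    finally show ?thesis unfolding e .
  qed
  have sum_le: "(\<Sum>k<n. level_size d k powr (1 - r / (r - 1))) \<le> D * (\<Sum>k<n. real (Suc k) powr (-p))" for n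
    unfolding sum_distrib_left by (intro sum_mono summand)
  have main: "(\<Sum>k<n. level_size d k powr (1 - r / (r - 1))) powr (r - 1) \<le> (D * S) powr (r - 1)"
    if "(\<Sum>k<n. real (Suc k) powr (-p)) \<le> S" for S n
    using r D that by (intro powr_mono2 order_trans[OF sum_le] mult_left_mono sum_nonneg) auto
  consider "r < real d" | "r = real d" | "r > real d" by linarith
  thus ?thesis
  proof cases
    case 1
    have p: "p > 1" unfolding p_def using 1 r by (simp add: field_simps)
    hence "summable (\<lambda>k. real k powr (-p))" by (subst summable_real_powr_iff) auto
    hence sm: "summable (\<lambda>k. real (Suc k) powr (-p))" by (subst summable_Suc_iff)
    define S where "S = (\<Sum>k. real (Suc k) powr (-p)) + 1"
    have S: "S > 0" unfolding S_def using suminf_nonneg[OF sm] by (simp add: add_nonneg_pos)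
    have "(\<Sum>k<n. real (Suc k) powr (-p)) \<le> S" for n
      unfolding S_def using sum_le_suminf[OF sm, of "{..<n}"] by simp
    thus ?thesis using main 1 S D by (intro exI[of _ "(D * S) powr (r - 1)"]) (auto simp: slowdown_def)
  next
    case 2
    have p: "p = 1" unfolding p_def using 2 r by simp
    have "(D * (1 + ln (real n))) powr (r - 1) = D powr (r - 1) * (1 + ln (real n)) ^ (d - 1)"
      if "n \<ge> 1" for n :: nat
    proof -
      have "1 + ln (real n) > 0" using that by (simp add: add_pos_nonneg)
      thus ?thesis using D 2 d by (simp add: powr_mult powr_realpow[symmetric] of_nat_diff)
    qed
    thus ?thesis using main sum_inverse_le_ln 2 D unfolding p
      by (intro exI[of _ "D powr (r - 1)"]) (fastforce simp: slowdown_def)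
  next
    case 3
    have p: "p < 1" unfolding p_def using 3 r by (simp add: field_simps)
    have e: "(1 - p) * (r - 1) = r - real d" unfolding p_def using r by (simp add: field_simps)
    have "(D * (real n powr (1 - p) / (1 - p))) powr (r - 1) =
        (D / (1 - p)) powr (r - 1) * real n powr (r - real d)" for n :: nat
    proof -
      have "(D * (real n powr (1 - p) / (1 - p))) powr (r - 1) =
          ((D / (1 - p)) * real n powr (1 - p)) powr (r - 1)" by simp
      also have "\<dots> = (D / (1 - p)) powr (r - 1) * real n powr (r - real d)"
        by (simp only: powr_mult powr_powr e)
      finally show ?thesis .
    qed
    thus ?thesis using main sum_powr_le_powr[OF p0 p] 3 D p
      by (intro exI[of _ "(D / (1 - p)) powr (r - 1)"]) (fastforce simp: slowdown_def)
  qed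
qed

section \<open>Tails of urn flows, of bundles of parallel lines and of short paths\<close>

definition line_sum :: "((int ^ 'd) set \<Rightarrow> real) \<Rightarrow> 'd \<Rightarrow> (('d::finite \<Rightarrow> nat) \<Rightarrow> int ^ 'd) \<Rightarrow>
    (('d \<Rightarrow> nat) \<Rightarrow> nat) \<Rightarrow> nat \<Rightarrow> real" where
  "line_sum u k v l m = (\<Sum>x\<in>urn_level m. \<Sum>j<l x.
     u {v x + axis k (int j), v x + axis k (int (Suc j))}) / level_size CARD('d) m"

text \<open>Lines whose starting points differ in a coordinate other than \<open>k\<close> are
  disjoint, and on one line the coordinate \<open>k\<close> tells the edges apart; two edges cannot
  agree with reversed orientation, as both increase the coordinate \<open>k\<close>.\<close>

lemma inj_on_line_edges:
  fixes v :: "'x \<Rightarrow> int ^ 'd"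
  assumes "\<And>x y. x \<in> X \<Longrightarrow> y \<in> X \<Longrightarrow> x \<noteq> y \<Longrightarrow> \<exists>i. i \<noteq> k \<and> v x $ i \<noteq> v y $ i"
  shows "inj_on (\<lambda>(x, j). {v x + axis k (int j), v x + axis k (int (Suc j))}) (Sigma X J)"
proof (rule inj_onI, clarify)
  fix x j y j' assume X: "x \<in> X" "y \<in> X"
    and "{v x + axis k (int j), v x + axis k (int (Suc j))} =
      {v y + axis k (int j'), v y + axis k (int (Suc j'))}"
  then consider "v x + axis k (int j) = v y + axis k (int j')" "v x + axis k (int (Suc j)) = v y + axis k (int (Suc j'))"
    | "v x + axis k (int j) = v y + axis k (int (Suc j'))" "v x + axis k (int (Suc j)) = v y + axis k (int j')"
    by (auto simp: doubleton_eq_iff)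
  thus "x = y \<and> j = j'"
  proof cases
    case 1
    have "v x $ i = v y $ i" if "i \<noteq> k" for i
      using arg_cong[OF 1(1), of "\<lambda>z. z $ i"] that by (simp add: axis_def)
    hence "x = y" using assms X by metis
    moreover have "j = j'"
      using arg_cong[OF 1(1), of "\<lambda>z. z $ k"] calculation by (simp add: axis_def)
    ultimately show ?thesis by simp
  next
    case 2
    show ?thesis
      using arg_cong[OF 2(1), of "\<lambda>z. z $ k"] arg_cong[OF 2(2), of "\<lambda>z. z $ k"]
      by (simp add: axis_def)
  qed
qed

context fpp
begin

text \<open>The flow has total weight \<open>m\<close>. The sum of its powers is estimated over all
  \<open>n\<close> levels, so that the rate depends on the size of the box and not on the depth
  \<open>m\<close> of the flow.\<close>

lemma urn_sum_tail:
  "\<exists>c>0. \<forall>b s m n x. (\<forall>i. \<bar>s i\<bar> = 1) \<longrightarrow> m \<le> n \<longrightarrow> 1 \<le> n \<longrightarrow> 2 * mgfC * real m \<le> x \<longrightarrow>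
     prob {\<omega>\<in>space M. x \<le> urn_sum (\<tau>' \<omega>) b s m} \<le> exp (- c * (x powr r / slowdown CARD('d) r n))"
proof -
  let ?S = "\<lambda>n. \<Sum>k<n. level_size CARD('d) k powr (1 - r / (r - 1))"
  obtain K where K: "K > 0" "\<And>n. n \<ge> 1 \<Longrightarrow> ?S n powr (r - 1) \<le> K * slowdown CARD('d) r n"
    using sum_level_size_powr_le[of "CARD('d)" r] r_gt_1 by (auto simp: Suc_le_eq)
  have "prob {\<omega>\<in>space M. x \<le> urn_sum (\<tau>' \<omega>) b s m} \<le> exp (- (devC / K) * (x powr r / slowdown CARD('d) r n))"
    if s: "\<forall>i. \<bar>s i\<bar> = 1" and m: "m \<le> n" "1 \<le> n" and x: "2 * mgfC * real m \<le> x" for b s m n x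
  proof -
    let ?I = "{x :: 'd \<Rightarrow> nat. sum x UNIV < m} \<times> (UNIV :: 'd set)"
    have p: "r / (r - 1) \<ge> 1" using r_gt_1 by simp
    have S: "?S n > 0" using m level_size_pos[of "CARD('d)"] by (intro sum_pos) (auto simp: less_le)
    have eq: "urn_sum u b s m = (\<Sum>i\<in>?I. case i of (x, i) \<Rightarrow> urn_flow x i * u (urn_edge b s (x, i)))" for u
      unfolding urn_sum_def by (simp add: sum.cartesian_product)
    have "prob {\<omega>\<in>space M. x \<le> urn_sum (\<tau>' \<omega>) b s m} =
        prob {\<omega>\<in>space M. x \<le> (\<Sum>i\<in>?I. (case i of (x, i) \<Rightarrow> urn_flow x i) * \<tau> (urn_edge b s i) \<omega>)}"
      unfolding eq by (simp add: case_prod_unfold)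
    also have "\<dots> \<le> exp (- devC * x powr r / ?S n powr (r - 1))"
    proof (rule edge_sum_tail)
      show "inj_on (urn_edge b s) ?I" using inj_urn_edge s by (metis inj_on_subset subset_UNIV)
      show "urn_edge b s ` ?I \<subseteq> lattice_edges" using urn_edge_lattice(1)[of s b] s by auto
      show "(\<Sum>i\<in>?I. case i of (x, i) \<Rightarrow> urn_flow x i) \<le> real m"
        using sum_urn_flow_less[of m, where ?'d = 'd] by (simp add: sum.cartesian_product)
      have "(\<Sum>i\<in>?I. (case i of (x, i) \<Rightarrow> urn_flow x i) powr (r / (r - 1))) =
          (\<Sum>x | sum x (UNIV :: 'd set) < m. \<Sum>i\<in>UNIV. urn_flow x i powr (r / (r - 1)))"
        by (simp add: sum.cartesian_product case_prod_unfold)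
      also have "\<dots> \<le> ?S m" by (rule sum_urn_flow_powr_le[OF p])
      also have "\<dots> \<le> ?S n" using m by (intro sum_mono2) auto
      finally show "(\<Sum>i\<in>?I. (case i of (x, i) \<Rightarrow> urn_flow x i) powr (r / (r - 1))) \<le> ?S n" .
    qed (use x S urn_flow_nonneg in auto)
    also have "\<dots> \<le> exp (- (devC / K) * (x powr r / slowdown CARD('d) r n))"
    proof -
      have "?S n powr (r - 1) > 0" using S by simp
      hence "devC * x powr r / (K * slowdown CARD('d) r n) \<le> devC * x powr r / ?S n powr (r - 1)"
        using K devC_pos m slowdown_ge_1[OF m(2), of "CARD('d)" r]
        by (intro divide_left_mono) auto
      thus ?thesis by simp
    qed
    finally show ?thesis .
  qed
  thus ?thesis using K devC_pos by (intro exI[of _ "devC / K"]) auto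
qed

text \<open>All weights equal \<open>1 / ?Z\<close>, so the sum of their powers, raised to
  \<open>r - 1\<close>, is at most \<open>n powr (r - 1) / ?Z\<close>. As \<open>m\<close> is
  proportional to \<open>n\<close>, \<open>?Z\<close> is at least of order
  \<open>n ^ (d - 1)\<close>, and the exponent has order \<open>x powr r / n powr (r - d)\<close> or
  more.\<close>

lemma line_sum_tail:
  assumes \<delta>: "\<delta> > 0"
  shows "\<exists>c>0. \<forall>k v l L m n x.
     (\<forall>x\<in>urn_level m. \<forall>y\<in>urn_level m. x \<noteq> y \<longrightarrow> (\<exists>i. i \<noteq> k \<and> v x $ i \<noteq> v y $ i)) \<longrightarrow>
     (\<forall>x\<in>urn_level m. l x \<le> L) \<longrightarrow> L \<le> n \<longrightarrow> 1 \<le> n \<longrightarrow> \<delta> * real n \<le> real (Suc m) \<longrightarrow>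
     2 * mgfC * real L \<le> x \<longrightarrow>
     prob {\<omega>\<in>space M. x \<le> line_sum (\<tau>' \<omega>) k v l m} \<le> exp (- c * (x powr r / slowdown CARD('d) r n))"
proof -
  define \<kappa> where "\<kappa> = (\<delta> / real CARD('d)) ^ (CARD('d) - 1)"
  have \<kappa>: "\<kappa> > 0" unfolding \<kappa>_def using \<delta> by simp
  have "prob {\<omega>\<in>space M. x \<le> line_sum (\<tau>' \<omega>) k v l m} \<le> exp (- (devC * \<kappa>) * (x powr r / slowdown CARD('d) r n))"
    if inj: "\<forall>x\<in>urn_level m. \<forall>y\<in>urn_level m. x \<noteq> y \<longrightarrow> (\<exists>i. i \<noteq> k \<and> v x $ i \<noteq> v y $ i)"
      and l: "\<forall>x\<in>urn_level m. l x \<le> L" and n: "L \<le> n" "1 \<le> n" and m: "\<delta> * real n \<le> real (Suc m)"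
      and x: "2 * mgfC * real L \<le> x" for k v l L m n x
  proof -
    let ?I = "Sigma (urn_level m) (\<lambda>x. {..<l x})" and ?Z = "level_size CARD('d) m"
    let ?e = "\<lambda>(x, j). {v x + axis k (int j), v x + axis k (int (Suc j))}"
    let ?p = "r / (r - 1)"
    let ?H = "real n * ?Z powr (1 - ?p)"
    have Z: "?Z > 0" by (simp add: level_size_pos)
    have card: "(\<Sum>i\<in>?I. a) \<le> real L * ?Z * a" if "a \<ge> 0" for a :: real
    proof -
      have "(\<Sum>i\<in>?I. a) = (\<Sum>x\<in>urn_level m. real (l x)) * a"
        by (simp add: card_SigmaI sum_distrib_right)
      also have "\<dots> \<le> (\<Sum>x\<in>(urn_level m :: ('d \<Rightarrow> nat) set). real L) * a"
        using l that by (intro mult_right_mono sum_mono) auto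
      also have "\<dots> = real L * ?Z * a" by (simp add: card_urn_level)
      finally show ?thesis .
    qed
    have "prob {\<omega>\<in>space M. x \<le> line_sum (\<tau>' \<omega>) k v l m} =
        prob {\<omega>\<in>space M. x \<le> (\<Sum>i\<in>?I. 1 / ?Z * \<tau> (?e i) \<omega>)}"
      unfolding line_sum_def
      by (simp add: sum.Sigma case_prod_unfold sum_divide_distrib)
    also have "\<dots> \<le> exp (- devC * x powr r / ?H powr (r - 1))"
    proof (rule edge_sum_tail)
      show "inj_on ?e ?I" using inj by (intro inj_on_line_edges) auto
      show "?e ` ?I \<subseteq> lattice_edges" using line_edge by fastforce
      show "(\<Sum>i\<in>?I. 1 / ?Z) \<le> real L" using card[of "1 / ?Z"] Z by simp
      have "(\<Sum>i\<in>?I. (1 / ?Z) powr ?p) \<le> real L * ?Z * (1 / ?Z) powr ?p" by (rule card) simp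
      also have "\<dots> \<le> real n * ?Z * (1 / ?Z) powr ?p"
        using n Z by (intro mult_right_mono) auto
      also have "\<dots> = ?H" using Z by (simp add: powr_divide powr_diff)
      finally show "(\<Sum>i\<in>?I. (1 / ?Z) powr ?p) \<le> ?H" .
    qed (use x n Z in auto)
    also have "\<dots> \<le> exp (- (devC * \<kappa>) * (x powr r / slowdown CARD('d) r n))"
    proof -
      have e: "(1 - ?p) * (r - 1) = -1" using r_gt_1 by (simp add: field_simps)
      have H: "?H powr (r - 1) = real n powr (r - 1) / ?Z"
        using Z e by (simp add: powr_mult powr_powr powr_minus_divide)
      have "(\<delta> * real n / real CARD('d)) ^ (CARD('d) - 1) \<le> (real (Suc m) / real CARD('d)) ^ (CARD('d) - 1)"
        using m \<delta> by (intro power_mono divide_right_mono) auto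
      also have "\<dots> \<le> ?Z" by (rule level_size_ge) simp
      finally have "\<kappa> * real n ^ (CARD('d) - 1) \<le> ?Z"
        unfolding \<kappa>_def by (simp add: power_mult_distrib[symmetric])
      hence Zge: "\<kappa> * real n powr (real CARD('d) - 1) \<le> ?Z"
        using n by (simp add: powr_realpow[symmetric] of_nat_diff Suc_le_eq)
      have "\<kappa> / slowdown CARD('d) r n \<le> \<kappa> / real n powr (r - real CARD('d))"
        using powr_le_slowdown[OF n(2), of r "CARD('d)"] slowdown_ge_1[OF n(2), of "CARD('d)" r] \<kappa> n
        by (intro divide_left_mono) auto
      also have "\<dots> = \<kappa> * real n powr (real CARD('d) - 1) / real n powr (r - 1)"
      proof -
        have "r - 1 = (real CARD('d) - 1) + (r - real CARD('d))" by simp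
        hence "real n powr (r - 1) = real n powr (real CARD('d) - 1) * real n powr (r - real CARD('d))"
          by (metis powr_add)
        thus ?thesis using n by simp
      qed
      also have "\<dots> \<le> ?Z / real n powr (r - 1)" using Zge by (intro divide_right_mono) auto
      finally have "devC * x powr r * (\<kappa> / slowdown CARD('d) r n) \<le> devC * x powr r * (?Z / real n powr (r - 1))"
        using devC_pos by (intro mult_left_mono) auto
      thus ?thesis unfolding H by (simp add: mult_ac)
    qed
    finally show ?thesis .
  qed
  thus ?thesis using \<kappa> devC_pos by (intro exI[of _ "devC * \<kappa>"]) auto
qed

lemma path_sum_tail:
  "\<exists>c>0. \<forall>F n x. F \<subseteq> lattice_edges \<longrightarrow> finite F \<longrightarrow> card F \<le> D \<longrightarrow> 1 \<le> n \<longrightarrow> 2 * mgfC * real D \<le> x \<longrightarrow>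
     prob {\<omega>\<in>space M. x \<le> (\<Sum>e\<in>F. \<tau> e \<omega>)} \<le> exp (- c * (x powr r / slowdown CARD('d) r n))"
proof -
  \<comment> \<open>The added 1 keeps the bound \<open>H\<close> of \<open>edge_sum_tail\<close>
    positive when \<open>D = 0\<close>.\<close>
  define K where "K = (real D + 1) powr (r - 1)"
  have K: "K > 0" unfolding K_def by simp
  have "prob {\<omega>\<in>space M. x \<le> (\<Sum>e\<in>F. \<tau> e \<omega>)} \<le> exp (- (devC / K) * (x powr r / slowdown CARD('d) r n))"
    if F: "F \<subseteq> lattice_edges" "finite F" "card F \<le> D" and n: "1 \<le> n" and x: "2 * mgfC * real D \<le> x" for F n x
  proof -
    have "prob {\<omega>\<in>space M. x \<le> (\<Sum>e\<in>F. 1 * \<tau> (id e) \<omega>)} \<le> exp (- devC * x powr r / (real D + 1) powr (r - 1))"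
      using F x by (intro edge_sum_tail) auto
    also have "\<dots> \<le> exp (- (devC / K) * (x powr r / slowdown CARD('d) r n))"
    proof -
      have "devC * x powr r / (K * slowdown CARD('d) r n) \<le> devC * x powr r / K"
        using slowdown_ge_1[OF n, of "CARD('d)" r] devC_pos K by (intro divide_left_mono) auto
      thus ?thesis by (simp add: K_def)
    qed
    finally show ?thesis by simp
  qed
  thus ?thesis using K devC_pos by (intro exI[of _ "devC / K"]) auto
qed

end

subsection \<open>Chaining paths between the two corners\<close>

definition lattice_cube :: "nat \<Rightarrow> int ^ 'd \<Rightarrow> (int ^ 'd) set" where
  "lattice_cube R y = {z. \<forall>i. \<bar>z $ i - y $ i\<bar> \<le> int R}"

definition lattice_box :: "nat \<Rightarrow> (int ^ 'd) set" where
  "lattice_box n = {v. \<forall>i. 0 \<le> v $ i \<and> v $ i \<le> int n}"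

text \<open>The mirror image of a corner flow under the reflection exchanging the two endpoints.\<close>

definition flip_sign :: "'d \<Rightarrow> 'd \<Rightarrow> int" where
  "flip_sign k i = (if i = k then -1 else 1)"

text \<open>The corner moved inwards by \<open>R\<close> in every coordinate; the margin keeps the
  cubes of radius \<open>R\<close> around the blocks inside the box.\<close>

definition base_point :: "nat \<Rightarrow> int ^ 'd" where
  "base_point R = (\<chi> i. int R)"

definition mirror_point :: "'d \<Rightarrow> nat \<Rightarrow> nat \<Rightarrow> int ^ 'd" where
  "mirror_point k n R = (\<chi> i. if i = k then int n - int R else int R)"

text \<open>Start of block \<open>j\<close> in the chain that leaves from the point \<open>x\<close>
  of the simplex; with \<open>j = J\<close> it is the end of a chain of \<open>J\<close>
  blocks.\<close>

definition block_start :: "'d \<Rightarrow> nat \<Rightarrow> nat \<Rightarrow> ('d \<Rightarrow> nat) \<times> nat \<Rightarrow> int ^ 'd" where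
  "block_start k R L = (\<lambda>(x, j). orthant_point (base_point R) (\<lambda>_. 1) x + axis k (int (j * L)))"

text \<open>Each crossing is confined to a cube so that distant blocks depend on disjoint sets of
  edges.\<close>

definition block_sum :: "((int ^ 'd) set \<Rightarrow> real) \<Rightarrow> 'd::finite \<Rightarrow> nat \<Rightarrow> nat \<Rightarrow> nat \<Rightarrow> nat \<Rightarrow> real" where
  "block_sum u k R L J m = (\<Sum>(x, j)\<in>urn_level m \<times> {..<J}.
     time_in u (lattice_cube R (block_start k R L (x, j))) (block_start k R L (x, j)) (block_start k R L (x, j) + axis k (int L)))"

text \<open>Distance in direction \<open>k\<close> from the end of the chain to the mirror image of
  its start: the start has coordinate \<open>R + x k\<close>, its image \<open>n - R - x k\<close>.
  The truncated subtraction is exact under the hypotheses of \<open>chain_le\<close>.\<close>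

definition rest_length :: "'d \<Rightarrow> nat \<Rightarrow> nat \<Rightarrow> nat \<Rightarrow> nat \<Rightarrow> ('d \<Rightarrow> nat) \<Rightarrow> nat" where
  "rest_length k n R L J x = n - 2 * R - 2 * x k - J * L"

lemma axis_plus: "axis k a + axis k b = (axis k (a + b) :: int ^ 'd)"
  by (simp add: vec_eq_iff axis_def)

lemma paths_in_lattice_cube:
  assumes "L \<le> R"
  shows "paths_in (lattice_cube R y) y (y + axis k (int L)) \<noteq> {}"
  using assms by (intro paths_in_line) (auto simp: lattice_cube_def axis_def)

lemma paths_in_lattice_box: "paths_in (lattice_box n) 0 (axis k (int n)) \<noteq> {}"
  using paths_in_line[of n 0 k "lattice_box n"] by (auto simp: lattice_box_def axis_def)

lemma time_in_blocks_le:
  assumes u: "edge_nonneg u"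
    and V: "\<And>j. j < J \<Longrightarrow> lattice_cube R (y + axis k (int (j * L))) \<subseteq> V" and y: "y \<in> V" and L: "L \<le> R"
  shows "paths_in V y (y + axis k (int (J * L))) \<noteq> {} \<and> time_in u V y (y + axis k (int (J * L))) \<le>
    (\<Sum>j<J. time_in u (lattice_cube R (y + axis k (int (j * L)))) (y + axis k (int (j * L)))
       (y + axis k (int (j * L)) + axis k (int L)))"
  using V
proof (induction J)
  case 0
  show ?case using paths_in_refl[OF y] by (auto simp: time_in_refl[OF u y])
next
  case (Suc J)
  let ?z = "y + axis k (int (J * L))"
  have z: "y + axis k (int (Suc J * L)) = ?z + axis k (int L)"
    by (simp add: axis_plus add.assoc algebra_simps)
  have c: "lattice_cube R ?z \<subseteq> V" using Suc.prems by blast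
  have ne: "paths_in V ?z (?z + axis k (int L)) \<noteq> {}"
    using paths_in_lattice_cube[OF L, of ?z k] paths_in_mono[OF c] by blast
  have IH: "paths_in V y ?z \<noteq> {}"
    "time_in u V y ?z \<le> (\<Sum>j<J. time_in u (lattice_cube R (y + axis k (int (j * L)))) (y + axis k (int (j * L)))
       (y + axis k (int (j * L)) + axis k (int L)))"
    using Suc.IH Suc.prems by auto
  have "time_in u V y (?z + axis k (int L)) \<le> time_in u V y ?z + time_in u V ?z (?z + axis k (int L))"
    by (rule time_in_triangle[OF u IH(1) ne])
  also have "time_in u V ?z (?z + axis k (int L)) \<le> time_in u (lattice_cube R ?z) ?z (?z + axis k (int L))"
    by (rule time_in_mono[OF u paths_in_lattice_cube[OF L] c])
  finally show ?case unfolding z using IH(2) paths_in_trans[OF IH(1) ne] by simp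
qed

lemma restricted_fp_time_le:
  "restricted_fp_time {y. \<forall>i. 0 \<le> y $ i \<and> y $ i \<le> real n} u v w > ereal a \<Longrightarrow>
    edge_nonneg u \<Longrightarrow> paths_in (lattice_box n) v w \<noteq> {} \<Longrightarrow> a \<le> time_in u (lattice_box n) v w"
proof -
  assume *: "restricted_fp_time {y. \<forall>i. 0 \<le> y $ i \<and> y $ i \<le> real n} u v w > ereal a"
    and u: "edge_nonneg u" and ne: "paths_in (lattice_box n) v w \<noteq> {}"
  have "a \<le> passage_time u xs" if xs: "xs \<in> paths_in (lattice_box n) v w" for xs
  proof -
    have "real_vec (xs ! i) \<in> {y. \<forall>i. 0 \<le> y $ i \<and> y $ i \<le> real n}" if "Suc i < length xs" for i
    proof -
      have "xs ! i \<in> lattice_box n" using xs that by (auto simp: paths_in_def)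
      thus ?thesis by (simp add: real_vec_def lattice_box_def) (metis of_int_le_iff of_int_of_nat_eq)
    qed
    hence "restricted_fp_time {y. \<forall>i. 0 \<le> y $ i \<and> y $ i \<le> real n} u v w \<le> ereal (passage_time u xs)"
      unfolding restricted_fp_time_def using xs by (intro INF_lower) (auto simp: paths_in_def)
    with * have "ereal a < ereal (passage_time u xs)" by (rule less_le_trans)
    thus ?thesis by simp
  qed
  thus "a \<le> time_in u (lattice_box n) v w" unfolding time_in_def using ne by (intro cINF_greatest)
qed

text \<open>One route for each \<open>x\<close> of the simplex: corner, base point, flow to
  \<open>x\<close>, blocks, straight line, mirror image of \<open>x\<close>, flow to the mirrored
  base point, opposite endpoint. The reflection changes the coordinate \<open>k\<close> only, so
  \<open>x\<close> and its image lie on one line in that direction. Averaging over \<open>x\<close>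
  turns the flow parts into urn sums. The sets \<open>F\<close> and \<open>F'\<close> do not depend
  on \<open>u\<close>, hence their weights are sums over a fixed set of edges.\<close>

lemma chain_le:
  fixes k :: "'d::finite"
  assumes n: "2 * R + 2 * m + J * L \<le> n" "CARD('d) * R \<le> n" and L: "L \<le> R \<or> J = 0"
  shows "\<exists>F F'. F \<subseteq> lattice_edges \<and> finite F \<and> card F \<le> CARD('d) * R \<and>
    F' \<subseteq> lattice_edges \<and> finite F' \<and> card F' \<le> CARD('d) * R \<and>
    (\<forall>u. edge_nonneg u \<longrightarrow> time_in u (lattice_box n) 0 (axis k (int n)) \<le> sum u F + sum u F' +
       urn_sum u (base_point R) (\<lambda>_. 1) m + urn_sum u (mirror_point k n R) (flip_sign k) m +
       block_sum u k R L J m / level_size CARD('d) m +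
       line_sum u k (\<lambda>x. block_start k R L (x, J)) (rest_length k n R L J) m)"
proof -
  let ?V = "lattice_box n :: (int ^ 'd) set" and ?t = "axis k (int n) :: int ^ 'd"
  let ?b = "base_point R :: int ^ 'd" and ?b' = "mirror_point k n R"
  let ?s = "\<lambda>_ :: 'd. 1 :: int" and ?s' = "flip_sign k"
  have s: "\<And>i. \<bar>?s i\<bar> = 1" "\<And>i. \<bar>?s' i\<bar> = 1" by (auto simp: flip_sign_def)
  have crd: "x i \<le> m" if "sum x UNIV \<le> m" for x :: "'d \<Rightarrow> nat" and i m
    using coord_le_sum[of x i] that by linarith
  have V0: "orthant_point 0 ?s y \<in> ?V" "orthant_point ?t ?s' y \<in> ?V" if "sum y UNIV \<le> CARD('d) * R" for y
    using crd[OF that] n by (auto simp: orthant_point_def lattice_box_def flip_sign_def axis_def of_nat_diff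
        intro: order_trans)
  have V1: "orthant_point ?b ?s y \<in> ?V" "orthant_point ?b' ?s' y \<in> ?V" if "sum y UNIV \<le> m" for y
  proof -
    have y: "int (y i) \<le> int m" for i using crd[OF that] by simp
    have "2 * int R + 2 * int m \<le> int n" using n(1) by linarith
    hence "0 \<le> orthant_point ?b ?s y $ i \<and> orthant_point ?b ?s y $ i \<le> int n"
      "0 \<le> orthant_point ?b' ?s' y $ i \<and> orthant_point ?b' ?s' y $ i \<le> int n" for i
      using y[of i]
      by (cases "i = k", simp_all add: orthant_point_def flip_sign_def base_point_def mirror_point_def)+
    thus "orthant_point ?b ?s y \<in> ?V" "orthant_point ?b' ?s' y \<in> ?V" by (simp_all add: lattice_box_def)
  qed
  have b: "orthant_point 0 ?s (\<lambda>_. R) = ?b" "orthant_point ?t ?s' (\<lambda>_. R) = ?b'"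
    by (auto simp: orthant_point_def base_point_def mirror_point_def vec_eq_iff axis_def flip_sign_def)
  have "\<exists>xs\<in>paths_in ?V 0 (orthant_point 0 ?s (\<lambda>_. R)). card (path_edges xs) \<le> CARD('d) * R"
    by (rule path_to_orthant_point[OF s(1) V0(1)]) simp_all
  then obtain xs where xs: "xs \<in> paths_in ?V 0 ?b" "card (path_edges xs) \<le> CARD('d) * R"
    unfolding b by blast
  have "\<exists>xs\<in>paths_in ?V ?t (orthant_point ?t ?s' (\<lambda>_. R)). card (path_edges xs) \<le> CARD('d) * R"
    by (rule path_to_orthant_point[OF s(2) V0(2)]) simp_all
  then obtain xs' where xs': "xs' \<in> paths_in ?V ?t ?b'" "card (path_edges xs') \<le> CARD('d) * R"
    unfolding b by blast
  have ne1: "paths_in ?V ?b (orthant_point ?b ?s x) \<noteq> {}" "paths_in ?V ?b' (orthant_point ?b' ?s' x) \<noteq> {}"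
    if "x \<in> urn_level m" for x
  proof -
    have x: "sum x UNIV = m" using that by (simp add: urn_level_def)
    show "paths_in ?V ?b (orthant_point ?b ?s x) \<noteq> {}"
      using path_to_orthant_point[OF s(1) V1(1) x] by blast
    show "paths_in ?V ?b' (orthant_point ?b' ?s' x) \<noteq> {}"
      using path_to_orthant_point[OF s(2) V1(2) x] by blast
  qed
  define f where "f = orthant_point ?b ?s"
  define f' where "f' = orthant_point ?b' ?s'"
  let ?S = "\<lambda>x j. block_start k R L (x, j)"
  have S: "?S x j = f x + axis k (int (j * L))" for x j by (simp add: block_start_def f_def)
  have coords: "0 \<le> f x $ i - int R" "f x $ i \<le> int R + int m" if "x \<in> urn_level m" for x i
    using crd[of x m i] that by (auto simp: f_def orthant_point_def base_point_def urn_level_def)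
  have cubes: "lattice_cube R (f x + axis k (int (j * L))) \<subseteq> ?V" if "x \<in> urn_level m" "j < J" for x j
  proof -
    define q Q where "q = int (j * L)" and "Q = int (J * L)"
    have "j * L + L \<le> J * L" using mult_le_mono1[of "Suc j" J L] that by simp
    hence "q + int L \<le> Q" unfolding q_def Q_def by linarith
    moreover have "2 * int R + 2 * int m + Q \<le> int n" using n(1) unfolding Q_def by linarith
    moreover have "0 \<le> q" "L \<le> R" using L that unfolding q_def by auto
    moreover have "(f x + axis k q) $ i = f x $ i + (if i = k then q else 0)" for i
      by (simp add: axis_def)
    ultimately have "int R \<le> (f x + axis k q) $ i \<and> (f x + axis k q) $ i \<le> int n - int R" for i
      using coords[OF that(1), of i] by auto
    hence bounds: "int R \<le> (f x + axis k (int (j * L))) $ i \<and>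
        (f x + axis k (int (j * L))) $ i \<le> int n - int R" for i
      unfolding q_def .
    show ?thesis
    proof
      fix z assume z: "z \<in> lattice_cube R (f x + axis k (int (j * L)))"
      have "0 \<le> z $ i \<and> z $ i \<le> int n" for i
      proof -
        have "\<bar>z $ i - (f x + axis k (int (j * L))) $ i\<bar> \<le> int R" using z by (simp only: lattice_cube_def mem_Collect_eq)
        thus ?thesis using bounds[of i] by linarith
      qed
      thus "z \<in> ?V" by (simp add: lattice_box_def)
    qed
  qed
  have fV: "f x \<in> ?V" if "x \<in> urn_level m" for x
    using V1(1)[of x] that by (simp add: f_def urn_level_def)
  have blocks: "paths_in ?V (f x) (?S x J) \<noteq> {}"
    "edge_nonneg u \<Longrightarrow> time_in u ?V (f x) (?S x J) \<le> (\<Sum>j<J. time_in u (lattice_cube R (?S x j)) (?S x j) (?S x j + axis k (int L)))"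
    if "x \<in> urn_level m" for x u
  proof -
    have *: "paths_in ?V (f x) (?S x J) \<noteq> {} \<and>
       time_in u ?V (f x) (?S x J) \<le> (\<Sum>j<J. time_in u (lattice_cube R (?S x j)) (?S x j) (?S x j + axis k (int L)))"
      if u: "edge_nonneg u" for u
    proof (cases "J = 0")
      case True
      thus ?thesis
        unfolding S using paths_in_refl[OF fV[OF \<open>x \<in> urn_level m\<close>]] time_in_refl[OF u fV[OF \<open>x \<in> urn_level m\<close>]]
        by auto
    next
      case False
      thus ?thesis
        unfolding S using L \<open>x \<in> urn_level m\<close> by (intro time_in_blocks_le cubes fV u) auto
    qed
    \<comment> \<open>Existence of a path does not involve the weights; any nonnegative
      configuration extracts it from the joint statement.\<close>
    have "edge_nonneg (\<lambda>_. 0 :: real)" by (simp add: edge_nonneg_def)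
    thus "paths_in ?V (f x) (?S x J) \<noteq> {}" using * by blast
    show "edge_nonneg u \<Longrightarrow> time_in u ?V (f x) (?S x J) \<le>
        (\<Sum>j<J. time_in u (lattice_cube R (?S x j)) (?S x j) (?S x j + axis k (int L)))"
      using * by blast
  qed
  let ?l = "rest_length k n R L J"
  have end_eq: "?S x J + axis k (int (?l x)) = f' x" if "x \<in> urn_level m" for x
  proof -
    have "x k \<le> m" using crd[of x m k] that by (simp add: urn_level_def)
    hence "int (?l x) = int n - 2 * int R - 2 * int (x k) - int (J * L)"
      using n(1) unfolding rest_length_def by linarith
    thus ?thesis
      by (simp add: S f_def f'_def orthant_point_def base_point_def mirror_point_def vec_eq_iff axis_def flip_sign_def)
  qed
  have lineV: "?S x J + axis k (int j) \<in> ?V" if "x \<in> urn_level m" "j \<le> ?l x" for x j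
  proof -
    have "x k \<le> m" using crd[of x m k] that by (simp add: urn_level_def)
    define Q where "Q = int (J * L)"
    have "int j + Q \<le> int n - 2 * int R - 2 * int (x k)"
      using \<open>x k \<le> m\<close> n(1) that(2) unfolding rest_length_def Q_def by linarith
    moreover have "f x $ k = int R + int (x k)" by (simp add: f_def orthant_point_def base_point_def)
    moreover have "2 * int R + 2 * int m + Q \<le> int n" using n(1) unfolding Q_def by linarith
    moreover have "0 \<le> Q" by (simp add: Q_def)
    moreover have "(?S x J + axis k (int j)) $ i = f x $ i + (if i = k then Q + int j else 0)" for i
      by (simp add: S axis_def Q_def)
    ultimately have "0 \<le> (?S x J + axis k (int j)) $ i \<and> (?S x J + axis k (int j)) $ i \<le> int n" for i
      using coords[OF that(1), of i] by auto
    thus ?thesis by (simp add: lattice_box_def)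
  qed
  have ne_line: "paths_in ?V (?S x J) (f' x) \<noteq> {}" if "x \<in> urn_level m" for x
    using paths_in_line[of "?l x" "?S x J" k ?V] lineV[OF that] end_eq[OF that] by simp
  have ne: "paths_in ?V 0 ?b \<noteq> {}" "paths_in ?V ?b' ?t \<noteq> {}"
    using xs(1) paths_in_rev[OF xs'(1)] by auto
  have ne_all: "paths_in ?V ?b (f x) \<noteq> {}" "paths_in ?V (f' x) ?b' \<noteq> {}"
    "paths_in ?V 0 (f x) \<noteq> {}" "paths_in ?V (?S x J) ?b' \<noteq> {}" "paths_in ?V (?S x J) ?t \<noteq> {}"
    "paths_in ?V (f x) ?t \<noteq> {}"
    if "x \<in> urn_level m" for x
  proof -
    show 1: "paths_in ?V ?b (f x) \<noteq> {}" using ne1[OF that] by (simp add: f_def)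
    show 2: "paths_in ?V (f' x) ?b' \<noteq> {}"
      using ne1[OF that] paths_in_commute by (simp add: f'_def)
    show "paths_in ?V 0 (f x) \<noteq> {}" using paths_in_trans[OF ne(1) 1] .
    show 4: "paths_in ?V (?S x J) ?b' \<noteq> {}" using paths_in_trans[OF ne_line[OF that] 2] .
    show 5: "paths_in ?V (?S x J) ?t \<noteq> {}" using paths_in_trans[OF 4 ne(2)] .
    show "paths_in ?V (f x) ?t \<noteq> {}" using paths_in_trans[OF blocks(1)[OF that] 5] .
  qed
  have Z: "level_size CARD('d) m > 0" by (simp add: level_size_pos)
  have bound: "time_in u ?V 0 ?t \<le> sum u (path_edges xs) + sum u (path_edges xs') +
       urn_sum u ?b ?s m + urn_sum u ?b' ?s' m + block_sum u k R L J m / level_size CARD('d) m +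
       line_sum u k (\<lambda>x. ?S x J) ?l m" if u: "edge_nonneg u" for u
  proof -
    let ?T = "time_in u ?V 0 ?t" and ?F = "sum u (path_edges xs)" and ?F' = "sum u (path_edges xs')"
    let ?Z = "level_size CARD('d) m"
    let ?bl = "\<lambda>x. \<Sum>j<J. time_in u (lattice_cube R (?S x j)) (?S x j) (?S x j + axis k (int L))"
    let ?li = "\<lambda>x. \<Sum>j<?l x. u {?S x J + axis k (int j), ?S x J + axis k (int (Suc j))}"
    have F: "time_in u ?V 0 ?b \<le> ?F" "time_in u ?V ?b' ?t \<le> ?F'"
      using time_in_le[OF u xs(1)] time_in_le[OF u xs'(1)] time_in_commute[of u ?V ?b' ?t]
      by (simp_all add: passage_time_def)
    have each: "?T \<le> ?F + ?F' + time_in u ?V ?b (f x) + time_in u ?V ?b' (f' x) + ?bl x + ?li x"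
      if x: "x \<in> urn_level m" for x
    proof -
      have "?T \<le> time_in u ?V 0 (f x) + time_in u ?V (f x) ?t" by (intro time_in_triangle u ne_all x)
      also have "time_in u ?V 0 (f x) \<le> time_in u ?V 0 ?b + time_in u ?V ?b (f x)"
        by (intro time_in_triangle u ne ne_all x)
      also have "time_in u ?V (f x) ?t \<le> time_in u ?V (f x) (?S x J) + time_in u ?V (?S x J) ?t"
        by (intro time_in_triangle u ne_all blocks x)
      also have "time_in u ?V (?S x J) ?t \<le> time_in u ?V (?S x J) ?b' + time_in u ?V ?b' ?t"
        by (intro time_in_triangle u ne_all ne x)
      also have "time_in u ?V (?S x J) ?b' \<le> time_in u ?V (?S x J) (f' x) + time_in u ?V (f' x) ?b'"
        by (intro time_in_triangle u ne_all ne_line x)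
      finally have "?T \<le> time_in u ?V 0 ?b + time_in u ?V ?b (f x) + (time_in u ?V (f x) (?S x J) +
        (time_in u ?V (?S x J) (f' x) + time_in u ?V (f' x) ?b' + time_in u ?V ?b' ?t))" by simp
      moreover have "time_in u ?V (?S x J) (f' x) \<le> ?li x"
        using time_in_line[OF u, of "?l x" "?S x J" k ?V] lineV[OF x] end_eq[OF x] by simp
      moreover have "time_in u ?V (f' x) ?b' = time_in u ?V ?b' (f' x)" by (rule time_in_commute)
      ultimately show ?thesis using F blocks(2)[OF x u] by linarith
    qed
    have "?T * ?Z = (\<Sum>x\<in>(urn_level m :: ('d \<Rightarrow> nat) set). ?T)"
      by (simp add: card_urn_level mult.commute)
    also have "\<dots> \<le> (\<Sum>x\<in>urn_level m. ?F + ?F' + time_in u ?V ?b (f x) + time_in u ?V ?b' (f' x) + ?bl x + ?li x)"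
      by (intro sum_mono each)
    also have "\<dots> = (?F + ?F') * ?Z + (\<Sum>x\<in>urn_level m. time_in u ?V ?b (f x)) + (\<Sum>x\<in>urn_level m. time_in u ?V ?b' (f' x)) +
      (\<Sum>x\<in>urn_level m. ?bl x) + (\<Sum>x\<in>urn_level m. ?li x)"
      by (simp add: sum.distrib card_urn_level algebra_simps)
    also have "(\<Sum>x\<in>urn_level m. ?bl x) = block_sum u k R L J m"
      unfolding block_sum_def by (simp add: sum.cartesian_product)
    finally have "?T * ?Z / ?Z \<le> ((?F + ?F') * ?Z + (\<Sum>x\<in>urn_level m. time_in u ?V ?b (f x)) +
      (\<Sum>x\<in>urn_level m. time_in u ?V ?b' (f' x)) + block_sum u k R L J m + (\<Sum>x\<in>urn_level m. ?li x)) / ?Z"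
      using Z by (intro divide_right_mono) auto
    also have "\<dots> = ?F + ?F' + (\<Sum>x\<in>urn_level m. time_in u ?V ?b (f x)) / ?Z + (\<Sum>x\<in>urn_level m. time_in u ?V ?b' (f' x)) / ?Z +
       block_sum u k R L J m / ?Z + line_sum u k (\<lambda>x. ?S x J) ?l m"
      using Z by (simp add: add_divide_distrib line_sum_def)
    finally show ?thesis
      using avg_time_in_le_urn_sum[OF u s(1) V1(1), of m] avg_time_in_le_urn_sum[OF u s(2) V1(2), of m] Z
      by (simp add: f_def f'_def)
  qed
  have "path_edges xs \<subseteq> lattice_edges" "path_edges xs' \<subseteq> lattice_edges"
    using xs(1) xs'(1) path_edges_lattice unfolding paths_in_def by blast+
  thus ?thesis
    using xs(2) xs'(2) bound by (intro exI conjI allI impI) (assumption | simp)+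
qed

text \<open>On a simplex the coordinate \<open>k\<close> is determined by the others, so different
  points stay different after moving along \<open>k\<close>. This is why chains in one direction can
  start from a whole level without meeting.\<close>

lemma block_start_differ:
  assumes "x \<in> urn_level m" "y \<in> urn_level m" "x \<noteq> y"
  shows "\<exists>i. i \<noteq> k \<and> block_start k R L (x, j) $ i \<noteq> block_start k R L (y, j') $ i"
proof (rule ccontr)
  assume "\<not> ?thesis"
  hence *: "x i = y i" if "i \<noteq> k" for i
    using that by (auto simp: block_start_def orthant_point_def axis_def)
  have "sum x UNIV = sum y UNIV" using assms by (simp add: urn_level_def)
  hence "x k + sum x (UNIV - {k}) = y k + sum y (UNIV - {k})"
    by (simp add: sum.remove)
  moreover have "sum x (UNIV - {k}) = sum y (UNIV - {k})" using * by (intro sum.cong) auto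
  ultimately have "x i = y i" for i using * by (cases "i = k") auto
  thus False using assms(3) by auto
qed

subsection \<open>Translation invariance\<close>

context fpp
begin

lemma lattice_edges_nonempty: "(lattice_edges :: (int ^ 'd) set set) \<noteq> {}"
  using line_edge by blast

abbreviation field_space :: "((int ^ 'd) set \<Rightarrow> real) measure" where
  "field_space \<equiv> PiM lattice_edges (\<lambda>_. borel)"

lemma field_measurable [measurable]:
  "(\<lambda>\<omega>. restrict (\<lambda>e. \<tau> ((+) z ` e) \<omega>) lattice_edges) \<in> measurable M field_space"
  by (intro measurable_restrict \<tau>_measurable) (simp add: lattice_edges_translate)

text \<open>By independence both laws are products of their marginals, and the marginals
  coincide.\<close>

lemma translate_field_law:
  "distr M field_space (\<lambda>\<omega>. restrict (\<lambda>e. \<tau> ((+) z ` e) \<omega>) lattice_edges) =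
   distr M field_space (\<lambda>\<omega>. restrict (\<tau>' \<omega>) lattice_edges)"
proof -
  have "distr M field_space (\<lambda>\<omega>. restrict (\<lambda>e. \<tau> ((+) z ` e) \<omega>) lattice_edges) =
      PiM lattice_edges (\<lambda>e. distr M borel (\<tau> e))" for z :: "int ^ 'd"
  proof -
    have "indep_vars (\<lambda>_. borel) (\<lambda>e. \<tau> ((+) z ` e)) lattice_edges"
    proof (rule indep_reindex)
      show "inj_on ((`) ((+) z)) lattice_edges"
        by (intro inj_onI) (simp add: inj_image_eq_iff)
    qed (auto simp: lattice_edges_translate)
    hence "distr M field_space (\<lambda>\<omega>. restrict (\<lambda>e. \<tau> ((+) z ` e) \<omega>) lattice_edges) =
        PiM lattice_edges (\<lambda>e. distr M borel (\<tau> ((+) z ` e)))"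
      by (subst (asm) indep_vars_iff_distr_eq_PiM'[OF lattice_edges_nonempty])
         (auto simp: lattice_edges_translate)
    also have "\<dots> = PiM lattice_edges (\<lambda>e. distr M borel (\<tau> e))"
      by (intro PiM_cong refl ident) (auto simp: lattice_edges_translate)
    finally show ?thesis .
  qed
  from this[of z] this[of 0] show ?thesis by simp
qed

text \<open>Points of \<open>field_space\<close> carry no information off the lattice edges, while
  configurations are arbitrary functions; \<open>f_restrict\<close> bridges the two.\<close>

lemma translate_law:
  assumes f: "f \<in> measurable field_space N" and f_restrict: "\<And>u. f (restrict u lattice_edges) = f u"
  shows "(\<lambda>\<omega>. f (\<lambda>e. \<tau> ((+) z ` e) \<omega>)) \<in> measurable M N"
    and "distr M N (\<lambda>\<omega>. f (\<lambda>e. \<tau> ((+) z ` e) \<omega>)) = distr M N (\<lambda>\<omega>. f (\<tau>' \<omega>))"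
proof -
  have *: "(\<lambda>\<omega>. f (\<lambda>e. \<tau> ((+) z ` e) \<omega>)) = f \<circ> (\<lambda>\<omega>. restrict (\<lambda>e. \<tau> ((+) z ` e) \<omega>) lattice_edges)" for z
    by (simp add: comp_def f_restrict)
  show "(\<lambda>\<omega>. f (\<lambda>e. \<tau> ((+) z ` e) \<omega>)) \<in> measurable M N"
    unfolding * by (rule measurable_comp[OF field_measurable f])
  have "distr M N (\<lambda>\<omega>. f (\<lambda>e. \<tau> ((+) z ` e) \<omega>)) = distr M N (\<lambda>\<omega>. f (\<lambda>e. \<tau> ((+) 0 ` e) \<omega>))"
    unfolding * distr_distr[OF f field_measurable, symmetric] by (simp only: translate_field_law)
  thus "distr M N (\<lambda>\<omega>. f (\<lambda>e. \<tau> ((+) z ` e) \<omega>)) = distr M N (\<lambda>\<omega>. f (\<tau>' \<omega>))"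
    by simp
qed

lemma time_in_measurable_field_space: "(\<lambda>u. time_in u V v w) \<in> borel_measurable field_space"
  by (rule time_in_borel_measurable) (rule measurable_component_singleton)

lemma time_in_measurable [measurable]: "(\<lambda>\<omega>. time_in (\<tau>' \<omega>) V v w) \<in> borel_measurable M"
  by (rule time_in_borel_measurable) (rule \<tau>_measurable)

lemma time_in_restrict: "time_in (restrict u lattice_edges) V v w = time_in u V v w"
  by (rule time_in_cong) simp

lemma expectation_time_in_translate:
  "expectation (\<lambda>\<omega>. time_in (\<tau>' \<omega>) ((+) z ` V) (z + v) (z + w)) = expectation (\<lambda>\<omega>. time_in (\<tau>' \<omega>) V v w)"
proof -
  let ?f = "\<lambda>u. time_in u V v w"
  have "expectation (\<lambda>\<omega>. ?f (\<lambda>e. \<tau> ((+) z ` e) \<omega>)) =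
      integral\<^sup>L (distr M borel (\<lambda>\<omega>. ?f (\<lambda>e. \<tau> ((+) z ` e) \<omega>))) (\<lambda>x. x)"
    by (intro integral_distr[symmetric] translate_law time_in_measurable_field_space time_in_restrict) simp
  also have "distr M borel (\<lambda>\<omega>. ?f (\<lambda>e. \<tau> ((+) z ` e) \<omega>)) = distr M borel (\<lambda>\<omega>. ?f (\<tau>' \<omega>))"
    by (intro translate_law time_in_measurable_field_space time_in_restrict)
  also have "integral\<^sup>L \<dots> (\<lambda>x. x) = expectation (\<lambda>\<omega>. ?f (\<tau>' \<omega>))"
    by (intro integral_distr) auto
  finally show ?thesis by (simp add: time_in_translate)
qed

subsection \<open>Moments of straight lines\<close>

definition line_time :: "'a \<Rightarrow> int ^ 'd \<Rightarrow> 'd \<Rightarrow> nat \<Rightarrow> real" where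
  "line_time \<omega> v k L = (\<Sum>j<L. \<tau> {v + axis k (int j), v + axis k (int (Suc j))} \<omega>)"

lemma line_time_measurable [measurable]: "(\<lambda>\<omega>. line_time \<omega> v k L) \<in> borel_measurable M"
  unfolding line_time_def by (intro borel_measurable_sum \<tau>_measurable line_edge)

lemma line_time_nonneg: "\<omega> \<in> space M \<Longrightarrow> 0 \<le> line_time \<omega> v k L"
  unfolding line_time_def by (intro sum_nonneg nonneg line_edge)

lemma indep_line:
  "indep_vars (\<lambda>_. borel) (\<lambda>j. \<tau> {v + axis k (int j), v + axis k (int (Suc j))}) {..<L}"
    (is "indep_vars _ (\<lambda>j. \<tau> (?e j)) _")
proof (rule indep_reindex)
  show "inj_on ?e {..<L}"
  proof (rule inj_onI)
    fix i j assume "?e i = ?e j"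
    moreover have "inj_on (\<lambda>(x, j). {v + axis k (int j), v + axis k (int (Suc j))}) (Sigma {()} (\<lambda>_. UNIV))"
      by (rule inj_on_line_edges) auto
    ultimately show "i = j" by (auto dest: inj_onD[of _ _ "((), i)" "((), j)"])
  qed
qed (use line_edge in blast)

lemma nn_integral_exp_line_time:
  assumes s: "s \<ge> 0"
  shows "(\<integral>\<^sup>+\<omega>. ennreal (exp (s * line_time \<omega> v k L)) \<partial>M) \<le>
    ennreal (exp (real L * (mgfC * (s + s powr (r / (r - 1))))))"
proof -
  let ?e = "\<lambda>j. {v + axis k (int j), v + axis k (int (Suc j))}"
  note ind = indep_line[of v k L]
  have "(\<integral>\<^sup>+\<omega>. ennreal (exp (s * line_time \<omega> v k L)) \<partial>M) =
      (\<integral>\<^sup>+\<omega>. (\<Prod>j<L. ennreal (exp (s * \<tau> (?e j) \<omega>))) \<partial>M)"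
    by (simp add: line_time_def sum_distrib_left exp_sum prod_ennreal)
  also have "\<dots> = (\<Prod>j<L. \<integral>\<^sup>+\<omega>. ennreal (exp (s * \<tau> (?e j) \<omega>)) \<partial>M)"
    by (intro indep_vars_nn_integral indep_vars_compose2[OF ind]) auto
  also have "\<dots> \<le> (\<Prod>j<L. ennreal (exp (mgfC * (s + s powr (r / (r - 1))))))"
    by (intro prod_mono_ennreal exp_moment line_edge s)
  also have "\<dots> = ennreal (exp (real L * (mgfC * (s + s powr (r / (r - 1))))))"
    by (simp only: prod_constant card_lessThan exp_of_nat_mult ennreal_power[OF exp_ge_zero])
  finally show ?thesis .
qed

lemma integrable_exp_line_time:
  assumes "s \<ge> 0"
  shows "integrable M (\<lambda>\<omega>. exp (s * line_time \<omega> v k L))"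
  using nn_integral_exp_line_time[OF assms, of v k L]
  by (intro integrableI_bounded) (auto simp: less_top[symmetric] top_unique)

lemma integrable_line_time: "integrable M (\<lambda>\<omega>. line_time \<omega> v k L)"
proof (rule Bochner_Integration.integrable_bound[OF integrable_exp_line_time[of 1 v k L]])
  show "AE \<omega> in M. norm (line_time \<omega> v k L) \<le> norm (exp (1 * line_time \<omega> v k L))"
  proof (rule AE_I2)
    fix \<omega> assume "\<omega> \<in> space M"
    hence "0 \<le> line_time \<omega> v k L" by (rule line_time_nonneg)
    moreover have "line_time \<omega> v k L \<le> exp (line_time \<omega> v k L)"
      using exp_ge_add_one_self[of "line_time \<omega> v k L"] by linarith
    ultimately show "norm (line_time \<omega> v k L) \<le> norm (exp (1 * line_time \<omega> v k L))" by simp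
  qed
qed auto

lemma time_in_le_line_time:
  assumes "\<omega> \<in> space M" "\<And>j. j \<le> L \<Longrightarrow> v + axis k (int j) \<in> V"
  shows "0 \<le> time_in (\<tau>' \<omega>) V v (v + axis k (int L))"
    and "time_in (\<tau>' \<omega>) V v (v + axis k (int L)) \<le> line_time \<omega> v k L"
  unfolding line_time_def
  by (intro time_in_nonneg edge_nonneg_\<tau> paths_in_line assms, assumption,
      intro time_in_line edge_nonneg_\<tau> assms, assumption)

lemma integrable_time_in:
  assumes "\<And>j. j \<le> L \<Longrightarrow> v + axis k (int j) \<in> V"
  shows "integrable M (\<lambda>\<omega>. time_in (\<tau>' \<omega>) V v (v + axis k (int L)))"
  using time_in_le_line_time[OF _ assms] line_time_nonneg
  by (intro Bochner_Integration.integrable_bound[OF integrable_line_time[of v k L]] AE_I2) auto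

text \<open>Bounds the expectation of the factor \<open>2 * exp (2 * x)\<close> in
  \<open>exp_le_quadratic\<close> when \<open>x\<close> is at most the passage time of a straight
  line of \<open>L\<close> edges.\<close>

definition blockC :: "nat \<Rightarrow> real" where
  "blockC L = 2 * exp (real L * (mgfC * (2 + 2 powr (r / (r - 1)))))"

text \<open>The straight line dominates the crossing time, so the second-order term is bounded
  independently of the region \<open>V\<close>, whereas the first-order term keeps the true
  mean.\<close>

lemma block_exp_moment:
  assumes V: "\<And>j. j \<le> L \<Longrightarrow> v + axis k (int j) \<in> V"
    and a: "expectation (\<lambda>\<omega>. time_in (\<tau>' \<omega>) V v (v + axis k (int L))) \<le> a" and l: "0 \<le> l" "l \<le> 1"
  shows "(\<integral>\<^sup>+\<omega>. ennreal (exp (l * time_in (\<tau>' \<omega>) V v (v + axis k (int L)))) \<partial>M) \<le>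
    ennreal (exp (l * a + l\<^sup>2 * blockC L))"
proof -
  let ?X = "\<lambda>\<omega>. time_in (\<tau>' \<omega>) V v (v + axis k (int L))"
  let ?E = "\<lambda>\<omega>. exp (2 * line_time \<omega> v k L)"
  have X: "0 \<le> ?X \<omega>" "?X \<omega> \<le> line_time \<omega> v k L" if "\<omega> \<in> space M" for \<omega>
    using time_in_le_line_time[OF that V] by auto
  have int: "integrable M ?X" "integrable M ?E"
    using integrable_time_in[OF V] integrable_exp_line_time[of 2 v k L] by auto
  have "ennreal (expectation ?E) = (\<integral>\<^sup>+\<omega>. ennreal (?E \<omega>) \<partial>M)"
    by (intro nn_integral_eq_integral[symmetric] int) auto
  also have "\<dots> \<le> ennreal (blockC L / 2)"
    using nn_integral_exp_line_time[of 2 v k L] by (simp add: blockC_def)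
  finally have E: "2 * expectation ?E \<le> blockC L"
    by (subst (asm) ennreal_le_iff) (auto simp: blockC_def)
  have "(\<integral>\<^sup>+\<omega>. ennreal (exp (l * ?X \<omega>)) \<partial>M) \<le> (\<integral>\<^sup>+\<omega>. ennreal (1 + l * ?X \<omega> + 2 * l\<^sup>2 * ?E \<omega>) \<partial>M)"
  proof (intro nn_integral_mono ennreal_leI)
    fix \<omega> assume \<omega>: "\<omega> \<in> space M"
    have "exp (l * ?X \<omega>) \<le> 1 + l * ?X \<omega> + 2 * l\<^sup>2 * exp (2 * ?X \<omega>)"
      using X[OF \<omega>] l by (intro exp_le_quadratic) auto
    also have "\<dots> \<le> 1 + l * ?X \<omega> + 2 * l\<^sup>2 * ?E \<omega>"
      using X[OF \<omega>] by (intro add_left_mono mult_left_mono) auto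
    finally show "exp (l * ?X \<omega>) \<le> 1 + l * ?X \<omega> + 2 * l\<^sup>2 * ?E \<omega>" .
  qed
  also have "\<dots> = ennreal (expectation (\<lambda>\<omega>. 1 + l * ?X \<omega> + 2 * l\<^sup>2 * ?E \<omega>))"
    using X l int by (intro nn_integral_eq_integral) (auto intro!: AE_I2 add_nonneg_nonneg)
  also have "expectation (\<lambda>\<omega>. 1 + l * ?X \<omega> + 2 * l\<^sup>2 * ?E \<omega>) = 1 + (l * expectation ?X + l\<^sup>2 * (2 * expectation ?E))"
    using int by (simp add: prob_space)
  also have "\<dots> \<le> exp (l * expectation ?X + l\<^sup>2 * (2 * expectation ?E))"
    by (rule exp_ge_add_one_self)
  also have "\<dots> \<le> exp (l * a + l\<^sup>2 * blockC L)"
    using a E l by (simp add: add_mono mult_left_mono)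
  finally show ?thesis by (simp add: ennreal_leI)
qed

subsection \<open>Large deviations of the sum of the blocks\<close>

lemma inj_on_block_start:
  assumes "0 < L"
  shows "inj_on (block_start k R L) (urn_level m \<times> {..<J})"
proof (rule inj_onI, clarify)
  fix x j y j' assume l: "x \<in> urn_level m" "y \<in> urn_level m"
    and eq: "block_start k R L (x, j) = block_start k R L (y, j')"
  have "x = y"
    using block_start_differ[OF l, of k R L j j'] eq by auto
  moreover have "j = j'"
    using arg_cong[OF eq, of "\<lambda>z. z $ k"] \<open>x = y\<close> assms by (simp add: block_start_def axis_def)
  ultimately show "x = y \<and> j = j'" by simp
qed

text \<open>
  Blocks whose starting points agree modulo the diameter of their cubes are independent, so the
  sum over each residue class obeys a Chernoff bound.
\<close>

lemma block_sum_tail: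
  fixes k :: 'd
  assumes L: "0 < L" "L \<le> R" and t: "t > 0"
    and a: "expectation (\<lambda>\<omega>. time_in (\<tau>' \<omega>) (lattice_cube R 0) 0 (0 + axis k (int L))) \<le> a"
  shows "\<exists>c>0. \<exists>K>0. \<forall>n m J. J * L \<le> n \<longrightarrow> 1 \<le> n \<longrightarrow>
    prob {\<omega>\<in>space M. (a * real J + t * real n) * level_size CARD('d) m \<le> block_sum (\<tau>' \<omega>) k R L J m}
      \<le> K * exp (- c * (level_size CARD('d) m * real n))"
proof -
  \<comment> \<open>Two cubes of radius \<open>R\<close> are disjoint once their centres differ by
    at least this much in some coordinate.\<close>
  define q where "q = 2 * int R + 1"
  define residue where "residue y = (\<chi> i. y $ i mod q)" for y :: "int ^ 'd"
  define G where "G = {v :: int ^ 'd. \<forall>i. v $ i \<in> {0..<q}}"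
  have q: "q > 0" by (simp add: q_def)
  have "G \<subseteq> vec_lambda ` (PiE UNIV (\<lambda>_. {0..<q}))"
  proof
    fix v assume "v \<in> G"
    hence "vec_nth v \<in> PiE UNIV (\<lambda>_. {0..<q})" by (auto simp: G_def)
    thus "v \<in> vec_lambda ` (PiE UNIV (\<lambda>_. {0..<q}))" by (metis image_eqI vec_nth_inverse)
  qed
  moreover have "finite (vec_lambda ` (PiE (UNIV :: 'd set) (\<lambda>_. {0..<q})))"
    by (intro finite_imageI finite_PiE) auto
  ultimately have G: "finite G" by (rule finite_subset)
  have res: "residue y \<in> G" for y using q by (simp add: residue_def G_def)
  define K where "K = real (card G)"
  have "card G > 0" using G res by (metis card_gt_0_iff empty_iff)
  hence K: "K \<ge> 1" unfolding K_def by (simp add: Suc_le_eq)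
  have B: "blockC L > 0" by (simp add: blockC_def)
  \<comment> \<open>The bound 1 is demanded by \<open>exp_le_quadratic\<close>. The other entry
    makes the second-order term use up at most half of the excess \<open>t * n * ?Z / K\<close>
    granted to a residue class; the other half yields the rate \<open>c\<close>.\<close>
  define l where "l = min 1 (t / (2 * K * blockC L))"
  have l: "0 < l" "l \<le> 1" "l * blockC L \<le> t / (2 * K)"
    unfolding l_def using t K B by (auto simp: min_def field_simps)
  define c where "c = l * t / (2 * K)"
  have c: "c > 0" unfolding c_def using l t K by simp
  let ?X = "\<lambda>y u. time_in u (lattice_cube R y) y (y + axis k (int L))"
  have line: "v + axis k (int j) \<in> lattice_cube R v" if "j \<le> L" for v and j
    using that L by (auto simp: lattice_cube_def axis_def)
  have EX: "expectation (\<lambda>\<omega>. ?X y (\<tau>' \<omega>)) \<le> a" for y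
  proof -
    have "lattice_cube R y = (+) y ` lattice_cube R 0"
    proof (intro set_eqI iffI)
      fix z assume "z \<in> lattice_cube R y"
      thus "z \<in> (+) y ` lattice_cube R 0" by (intro image_eqI[of _ _ "z - y"]) (auto simp: lattice_cube_def)
    qed (auto simp: lattice_cube_def)
    thus ?thesis using a expectation_time_in_translate[of y "lattice_cube R 0" 0 "axis k (int L)"] by simp
  qed
  have "prob {\<omega>\<in>space M. (a * real J + t * real n) * level_size CARD('d) m \<le> block_sum (\<tau>' \<omega>) k R L J m}
      \<le> K * exp (- c * (level_size CARD('d) m * real n))"
    if n: "J * L \<le> n" "1 \<le> n" for n m J
  proof -
    let ?Z = "level_size CARD('d) m" and ?I = "(urn_level m :: ('d \<Rightarrow> nat) set) \<times> {..<J}"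
    let ?bs = "block_start k R L"
    let ?g = "\<lambda>i. residue (?bs i)"
    let ?Ic = "\<lambda>v. {i \<in> ?I. ?g i = v}"
    let ?S = "\<lambda>v \<omega>. \<Sum>i\<in>?Ic v. ?X (?bs i) (\<tau>' \<omega>)"
    \<comment> \<open>The bound for the mean of the class plus an equal share of the excess. The
      shares add up to the full threshold, so if the total exceeds it, some class exceeds its
      own.\<close>
    let ?th = "\<lambda>v. a * real (card (?Ic v)) + t * real n * ?Z / K"
    have Z: "?Z > 0" by (simp add: level_size_pos)
    have JL: "J \<le> n"
      using n(1) L(1) by (metis One_nat_def Suc_leI le_trans mult.right_neutral mult_le_mono2)
    have cardI: "real (card ?I) = ?Z * real J" by (simp add: card_urn_level card_cartesian_product)
    have bs_eq: "block_sum u k R L J m = (\<Sum>v\<in>G. \<Sum>i\<in>?Ic v. ?X (?bs i) u)" for u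
    proof -
      have "block_sum u k R L J m = (\<Sum>i\<in>?I. ?X (?bs i) u)"
        unfolding block_sum_def by (simp add: case_prod_unfold)
      also have "\<dots> = (\<Sum>v\<in>G. \<Sum>i\<in>?Ic v. ?X (?bs i) u)"
        using G res by (intro sum.group[symmetric]) auto
      finally show ?thesis .
    qed
    have th_sum: "(\<Sum>v\<in>G. ?th v) = (a * real J + t * real n) * ?Z"
    proof -
      have "(\<Sum>v\<in>G. real (card (?Ic v))) = real (card ?I)"
        using sum.group[of ?I G ?g "\<lambda>_. 1 :: real"] G res by auto
      thus ?thesis using cardI K
        by (simp add: sum.distrib K_def algebra_simps flip: sum_distrib_left)
    qed
    have class_tail: "prob {\<omega>\<in>space M. ?th v \<le> ?S v \<omega>} \<le> exp (- c * (?Z * real n))" for v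
    proof -
      let ?K = "\<lambda>y. {e \<in> lattice_edges. e \<subseteq> lattice_cube R y}"
      have disj: "disjoint_family_on (\<lambda>i. ?K (?bs i)) (?Ic v)"
      proof (unfold disjoint_family_on_def, intro ballI impI)
        fix i i' assume i: "i \<in> ?Ic v" "i' \<in> ?Ic v" and "i \<noteq> i'"
        hence "?bs i \<noteq> ?bs i'"
          using inj_on_block_start[OF L(1), of k R m J] by (auto dest: inj_onD)
        then obtain p where p: "?bs i $ p \<noteq> ?bs i' $ p" by (auto simp: vec_eq_iff)
        have "residue (?bs i) $ p = residue (?bs i') $ p" using i by simp
        hence "?bs i $ p mod q = ?bs i' $ p mod q" by (simp add: residue_def)
        hence "q dvd (?bs i $ p - ?bs i' $ p)" by (simp add: mod_eq_dvd_iff)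
        hence far: "q \<le> \<bar>?bs i $ p - ?bs i' $ p\<bar>"
          using p zdvd_imp_le[of q "\<bar>?bs i $ p - ?bs i' $ p\<bar>"] by auto
        show "?K (?bs i) \<inter> ?K (?bs i') = {}"
        proof (rule ccontr)
          assume "?K (?bs i) \<inter> ?K (?bs i') \<noteq> {}"
          then obtain e where e: "e \<in> lattice_edges" "e \<subseteq> lattice_cube R (?bs i)" "e \<subseteq> lattice_cube R (?bs i')"
            by blast
          from e(1) obtain z where "z \<in> e" unfolding lattice_edges_def by blast
          with e have "z \<in> lattice_cube R (?bs i)" "z \<in> lattice_cube R (?bs i')" by blast+
          hence "\<bar>z $ p - ?bs i $ p\<bar> \<le> int R" "\<bar>z $ p - ?bs i' $ p\<bar> \<le> int R"
            by (auto simp: lattice_cube_def)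
          thus False using far unfolding q_def by linarith
        qed
      qed
      have "indep_vars (\<lambda>i. PiM (?K (?bs i)) (\<lambda>_. borel)) (\<lambda>i \<omega>. restrict (\<tau>' \<omega>) (?K (?bs i))) (?Ic v)"
        by (rule indep_vars_restrict[OF indep _ disj]) auto
      moreover have "(\<lambda>u. l * ?X y u) \<in> borel_measurable (PiM (?K y) (\<lambda>_. borel))" for y
        by (intro borel_measurable_times borel_measurable_const time_in_borel_measurable
            measurable_component_singleton) auto
      ultimately have "indep_vars (\<lambda>_. borel)
          (\<lambda>i \<omega>. (\<lambda>u. l * ?X (?bs i) u) (restrict (\<tau>' \<omega>) (?K (?bs i)))) (?Ic v)"
        by (rule indep_vars_compose2[where Y = "\<lambda>i u. l * ?X (?bs i) u"])
      moreover have "?X y (restrict u (?K y)) = ?X y u" for y u by (rule time_in_cong) auto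
      ultimately have ind: "indep_vars (\<lambda>_. borel) (\<lambda>i \<omega>. l * ?X (?bs i) (\<tau>' \<omega>)) (?Ic v)" by simp
      have "prob {\<omega>\<in>space M. ?th v \<le> ?S v \<omega>} =
          prob {\<omega>\<in>space M. l * ?th v \<le> (\<Sum>i\<in>?Ic v. l * ?X (?bs i) (\<tau>' \<omega>))}"
        using l by (simp flip: sum_distrib_left)
      also have "\<dots> \<le> exp ((\<Sum>i\<in>?Ic v. l * a + l\<^sup>2 * blockC L) - l * ?th v)"
      proof (rule Chernoff_indep[OF _ ind])
        show "finite (?Ic v)" by simp
        show "(\<integral>\<^sup>+\<omega>. ennreal (exp (l * ?X (?bs i) (\<tau>' \<omega>))) \<partial>M) \<le>
            ennreal (exp (l * a + l\<^sup>2 * blockC L))" for i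
          using l by (intro block_exp_moment line EX) auto
      qed
      also have "\<dots> \<le> exp (- c * (?Z * real n))"
      proof -
        have "card (?Ic v) \<le> card ?I" by (intro card_mono) auto
        also have "real (card ?I) \<le> ?Z * real n" unfolding cardI using JL Z by simp
        finally have "real (card (?Ic v)) \<le> ?Z * real n" by simp
        hence "l * (l * blockC L) * real (card (?Ic v)) \<le> l * (t / (2 * K)) * (?Z * real n)"
          using l B t K by (intro mult_mono) auto
        moreover have "(\<Sum>i\<in>?Ic v. l * a + l\<^sup>2 * blockC L) - l * ?th v =
          l * (l * blockC L) * real (card (?Ic v)) - 2 * (l * (t / (2 * K)) * (?Z * real n))"
          using K by (simp add: power2_eq_square field_simps)
        ultimately show ?thesis by (simp add: c_def)
      qed
      finally show ?thesis .
    qed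
    have "{\<omega>\<in>space M. (a * real J + t * real n) * ?Z \<le> block_sum (\<tau>' \<omega>) k R L J m} \<subseteq>
        (\<Union>v\<in>G. {\<omega>\<in>space M. ?th v \<le> ?S v \<omega>})"
    proof
      fix \<omega> assume "\<omega> \<in> {\<omega>\<in>space M. (a * real J + t * real n) * ?Z \<le> block_sum (\<tau>' \<omega>) k R L J m}"
      hence \<omega>: "\<omega> \<in> space M" "(\<Sum>v\<in>G. ?th v) \<le> (\<Sum>v\<in>G. ?S v \<omega>)"
        unfolding th_sum bs_eq by auto
      have "\<exists>v\<in>G. ?th v \<le> ?S v \<omega>"
      proof (rule ccontr)
        assume "\<not> ?thesis"
        hence "(\<Sum>v\<in>G. ?S v \<omega>) < (\<Sum>v\<in>G. ?th v)"
          using G res by (intro sum_strict_mono) (auto simp: not_le)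
        thus False using \<omega> by simp
      qed
      thus "\<omega> \<in> (\<Union>v\<in>G. {\<omega>\<in>space M. ?th v \<le> ?S v \<omega>})" using \<omega> by auto
    qed
    hence "prob {\<omega>\<in>space M. (a * real J + t * real n) * ?Z \<le> block_sum (\<tau>' \<omega>) k R L J m} \<le>
        prob (\<Union>v\<in>G. {\<omega>\<in>space M. ?th v \<le> ?S v \<omega>})"
      using G by (intro finite_measure_mono) (auto intro!: sets.finite_UN)
    also have "\<dots> \<le> (\<Sum>v\<in>G. prob {\<omega>\<in>space M. ?th v \<le> ?S v \<omega>})"
      using G by (intro finite_measure_subadditive_finite) auto
    also have "\<dots> \<le> (\<Sum>v\<in>G. exp (- c * (?Z * real n)))" by (intro sum_mono class_tail)
    also have "\<dots> = K * exp (- c * (?Z * real n))" by (simp add: K_def)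
    finally show ?thesis .
  qed
  thus ?thesis using c K by (intro exI[of _ c] conjI exI[of _ K]) auto
qed

end

subsection \<open>Upper tail estimates\<close>

lemma (in prob_space) prob_Un_le:
  assumes "A \<in> events" "B \<in> events" "prob A \<le> a" "prob B \<le> b"
  shows "prob (A \<union> B) \<le> a + b"
  using assms measure_Un_le[of A M B] by auto

lemma exp_rate_mono:
  fixes c c' g :: real
  assumes "c \<le> c'" "0 \<le> g" "g \<le> h" "0 \<le> c'"
  shows "exp (- c' * h) \<le> exp (- c * g)"
proof -
  have "c * g \<le> c' * h" using assms by (intro order_trans[OF mult_right_mono mult_left_mono]) auto
  thus ?thesis by simp
qed

context fpp
begin

section \<open>The infimum of the normalised mean passage times\<close>

definition mean_time :: "'d \<Rightarrow> nat \<Rightarrow> real" where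
  "mean_time k n = expectation (\<lambda>\<omega>. time_in (\<tau>' \<omega>) UNIV 0 (axis k (int n)))"

text \<open>Taken as an infimum, which gives at once a length \<open>L\<close> whose mean is almost
  optimal and the lower bound \<open>mu_le\<close> for all means. That it is the time constant is
  shown in \<open>time_constant_eq\<close>.\<close>

definition mu :: "'d \<Rightarrow> real" where
  "mu k = (INF n\<in>{1..}. mean_time k n / real n)"

lemma time_in_UNIV_nonneg: "\<omega> \<in> space M \<Longrightarrow> 0 \<le> time_in (\<tau>' \<omega>) UNIV v (v + axis k (int n))"
  by (rule time_in_le_line_time) auto

lemma integrable_time_in_UNIV: "integrable M (\<lambda>\<omega>. time_in (\<tau>' \<omega>) UNIV 0 (axis k (int n)))"
  using integrable_time_in[of n 0 k UNIV] by simp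

lemma mean_time_nonneg: "0 \<le> mean_time k n"
  unfolding mean_time_def using time_in_UNIV_nonneg[of _ 0 k n] by (intro integral_nonneg_AE AE_I2) simp

lemma mu_bdd_below: "bdd_below ((\<lambda>n. mean_time k n / real n) ` {1..})"
  by (intro bdd_belowI[of _ 0]) (auto simp: mean_time_nonneg)

lemma mu_le: "mu k * real n \<le> mean_time k n"
proof (cases "n = 0")
  case False
  have "mu k \<le> mean_time k n / real n"
    unfolding mu_def using False by (intro cINF_lower mu_bdd_below) auto
  thus ?thesis using False by (simp add: field_simps)
qed (simp add: mean_time_nonneg)

lemma mu_nonneg: "0 \<le> mu k"
  unfolding mu_def by (intro cINF_greatest) (auto simp: mean_time_nonneg)

lemma mu_approx:
  assumes "\<epsilon> > 0"
  shows "\<exists>L\<ge>1. mean_time k L < (mu k + \<epsilon>) * real L"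
proof -
  have "\<exists>n\<in>{1..}. mean_time k n / real n < mu k + \<epsilon>"
    using assms unfolding mu_def by (subst cINF_less_iff[symmetric, OF _ mu_bdd_below]) auto
  thus ?thesis by (auto simp: field_simps)
qed

text \<open>A near-optimal path is finite and hence lies in all large cubes.\<close>

lemma tendsto_time_in_lattice_cube:
  assumes u: "edge_nonneg u"
  shows "(\<lambda>R. time_in u (lattice_cube (L + R) 0) 0 (0 + axis k (int L))) \<longlonglongrightarrow> time_in u UNIV 0 (0 + axis k (int L))"
proof (rule LIMSEQ_I)
  fix \<epsilon> :: real assume \<epsilon>: "\<epsilon> > 0"
  let ?t = "0 + axis k (int L)" and ?T = "time_in u UNIV 0 (0 + axis k (int L))"
  have ne: "paths_in UNIV 0 ?t \<noteq> {}" by (rule paths_in_line) simp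
  obtain xs where xs: "xs \<in> paths_in UNIV 0 ?t" "passage_time u xs < ?T + \<epsilon>"
    using time_in_less_iff[OF u ne, of "?T + \<epsilon>"] \<epsilon> by auto
  define R0 where "R0 = (\<Sum>z\<in>set xs. nat (l1_norm z))"
  have "norm (time_in u (lattice_cube (L + R) 0) 0 ?t - ?T) < \<epsilon>" if R: "R \<ge> R0" for R
  proof -
    have "set xs \<subseteq> lattice_cube (L + R) 0"
    proof
      fix z assume "z \<in> set xs"
      hence "nat (l1_norm z) \<le> R0" unfolding R0_def by (intro member_le_sum) auto
      moreover have "\<bar>z $ i\<bar> \<le> l1_norm z" for i
        unfolding l1_norm_def by (rule member_le_sum) auto
      moreover have "l1_norm z \<le> int R" using calculation(1) R by linarith
      ultimately have "\<bar>z $ i\<bar> \<le> int (L + R)" for i by (meson order_trans le_add2 of_nat_le_iff)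
      thus "z \<in> lattice_cube (L + R) 0" by (simp add: lattice_cube_def)
    qed
    hence "xs \<in> paths_in (lattice_cube (L + R) 0) 0 ?t" using xs by (simp add: paths_in_def)
    from time_in_le[OF u this] have "time_in u (lattice_cube (L + R) 0) 0 ?t < ?T + \<epsilon>" using xs(2) by linarith
    moreover have "?T \<le> time_in u (lattice_cube (L + R) 0) 0 ?t"
      by (intro time_in_mono u paths_in_lattice_cube) auto
    ultimately show ?thesis by simp
  qed
  thus "\<exists>no. \<forall>n\<ge>no. norm (time_in u (lattice_cube (L + n) 0) 0 ?t - ?T) < \<epsilon>" by blast
qed

lemma lattice_cube_approx:
  assumes \<epsilon>: "\<epsilon> > 0"
  shows "\<exists>R\<ge>L. expectation (\<lambda>\<omega>. time_in (\<tau>' \<omega>) (lattice_cube R 0) 0 (0 + axis k (int L))) < mean_time k L + \<epsilon>"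
proof -
  have line: "0 + axis k (int j) \<in> lattice_cube (L + R) 0" if "j \<le> L" for j R
    using that by (auto simp: lattice_cube_def axis_def)
  have "(\<lambda>R. expectation (\<lambda>\<omega>. time_in (\<tau>' \<omega>) (lattice_cube (L + R) 0) 0 (0 + axis k (int L)))) \<longlonglongrightarrow>
      expectation (\<lambda>\<omega>. time_in (\<tau>' \<omega>) UNIV 0 (0 + axis k (int L)))"
  proof (rule integral_dominated_convergence[where w = "\<lambda>\<omega>. line_time \<omega> 0 k L"])
    show "AE \<omega> in M. norm (time_in (\<tau>' \<omega>) (lattice_cube (L + R) 0) 0 (0 + axis k (int L))) \<le> line_time \<omega> 0 k L" for R
      using time_in_le_line_time[OF _ line] by (intro AE_I2) simp
    show "AE \<omega> in M. (\<lambda>R. time_in (\<tau>' \<omega>) (lattice_cube (L + R) 0) 0 (0 + axis k (int L)))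
        \<longlonglongrightarrow> time_in (\<tau>' \<omega>) UNIV 0 (0 + axis k (int L))"
      by (intro AE_I2 tendsto_time_in_lattice_cube edge_nonneg_\<tau>)
  qed (auto intro: integrable_line_time)
  hence "(\<lambda>R. expectation (\<lambda>\<omega>. time_in (\<tau>' \<omega>) (lattice_cube (L + R) 0) 0 (0 + axis k (int L)))) \<longlonglongrightarrow> mean_time k L"
    by (simp add: mean_time_def)
  from order_tendstoD(2)[OF this, of "mean_time k L + \<epsilon>"] \<epsilon>
  obtain R where "expectation (\<lambda>\<omega>. time_in (\<tau>' \<omega>) (lattice_cube (L + R) 0) 0 (0 + axis k (int L))) < mean_time k L + \<epsilon>"
    by (auto simp: eventually_sequentially)
  thus ?thesis by (intro exI[of _ "L + R"]) auto
qed

lemma urn_sum_measurable: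
  assumes "\<And>i. \<bar>s i\<bar> = 1"
  shows "(\<lambda>\<omega>. urn_sum (\<tau>' \<omega>) b s m) \<in> borel_measurable M"
  unfolding urn_sum_def
  by (intro borel_measurable_sum borel_measurable_times borel_measurable_const \<tau>_measurable
      urn_edge_lattice assms)

lemma line_sum_measurable: "(\<lambda>\<omega>. line_sum (\<tau>' \<omega>) k v l m) \<in> borel_measurable M"
  unfolding line_sum_def
  by (intro borel_measurable_divide borel_measurable_sum borel_measurable_const \<tau>_measurable line_edge)

lemma block_sum_measurable: "(\<lambda>\<omega>. block_sum (\<tau>' \<omega>) k R L J m) \<in> borel_measurable M"
  unfolding block_sum_def case_prod_unfold
  by (intro borel_measurable_sum time_in_measurable)

lemma abs_flip_sign: "\<bar>flip_sign k i\<bar> = 1"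
  by (simp add: flip_sign_def)

text \<open>No blocks are used and the sharp constant is irrelevant: each of the two flows and the
  bundle of lines has total weight at most \<open>n\<close>, so for \<open>N >= K * n\<close> a
  third of \<open>\<xi> * N\<close> meets the threshold \<open>2 * mgfC * n\<close> of the tail
  bounds.\<close>

lemma upper_tail_far:
  fixes k :: 'd
  assumes \<xi>: "\<xi> > 0"
  shows "\<exists>K\<ge>1. \<exists>c>0. \<forall>n\<ge>1. \<forall>N\<ge>K * real n.
    prob {\<omega>\<in>space M. \<xi> * N \<le> time_in (\<tau>' \<omega>) (lattice_box n) 0 (axis k (int n))} \<le> 3 * exp (- c * rate_g CARD('d) r n N)"
proof -
  obtain c1 where c1_pos: "c1 > 0" and c1: "\<forall>b s m n x. (\<forall>i. \<bar>s i\<bar> = 1) \<longrightarrow> m \<le> n \<longrightarrow> 1 \<le> n \<longrightarrow> 2 * mgfC * real m \<le> x \<longrightarrow>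
     prob {\<omega>\<in>space M. x \<le> urn_sum (\<tau>' \<omega>) b s m} \<le> exp (- c1 * (x powr r / slowdown CARD('d) r n))"
    using urn_sum_tail by (elim exE conjE) (rule that)
  obtain c2 where c2_pos: "c2 > 0" and c2: "\<forall>k v l L m n x.
     (\<forall>x\<in>urn_level m. \<forall>y\<in>urn_level m. x \<noteq> y \<longrightarrow> (\<exists>i. i \<noteq> k \<and> v x $ i \<noteq> v y $ i)) \<longrightarrow>
     (\<forall>x\<in>urn_level m. l x \<le> L) \<longrightarrow> L \<le> n \<longrightarrow> 1 \<le> n \<longrightarrow> 1 / 2 * real n \<le> real (Suc m) \<longrightarrow>
     2 * mgfC * real L \<le> x \<longrightarrow>
     prob {\<omega>\<in>space M. x \<le> line_sum (\<tau>' \<omega>) k v l m} \<le> exp (- c2 * (x powr r / slowdown CARD('d) r n))"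
    using line_sum_tail[OF half_gt_zero[OF zero_less_one]] by (elim exE conjE) (rule that)
  define K where "K = max 1 (6 * mgfC / \<xi>)"
  define c where "c = min c1 c2 * (\<xi> / 3) powr r"
  have c: "c > 0" unfolding c_def using c1_pos c2_pos \<xi> by simp
  have "prob {\<omega>\<in>space M. \<xi> * N \<le> time_in (\<tau>' \<omega>) (lattice_box n) 0 (axis k (int n))} \<le> 3 * exp (- c * rate_g CARD('d) r n N)"
    if n: "n \<ge> 1" and N: "N \<ge> K * real n" for n N
  proof -
    \<comment> \<open>The deepest level for which the flows from both endpoints fit into the
      box.\<close>
    define m where "m = n div 2"
    define x where "x = \<xi> * N / 3"
    let ?v = "\<lambda>x. block_start k 0 0 (x, 0)" and ?l = "rest_length k n 0 0 0"
    let ?U = "\<lambda>u. urn_sum u (base_point 0) (\<lambda>_. 1) m" and ?U' = "\<lambda>u. urn_sum u (mirror_point k n 0) (flip_sign k) m"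
    let ?L = "\<lambda>u. line_sum u k ?v ?l m"
    have "6 * mgfC / \<xi> * real n \<le> K * real n" unfolding K_def by (intro mult_right_mono) auto
    also have "\<dots> \<le> N" by (rule N)
    finally have x: "2 * mgfC * real n \<le> x" unfolding x_def using \<xi> by (simp add: field_simps)
    have "0 < K * real n" using n unfolding K_def by simp
    hence Npos: "N > 0" using N by linarith
    have xm: "2 * mgfC * real m \<le> x"
      using x mgfC_pos by (intro order_trans[OF _ x] mult_left_mono) (auto simp: m_def)
    have tail_le: "exp (- c' * (x powr r / slowdown CARD('d) r n)) \<le> exp (- c * rate_g CARD('d) r n N)"
      if "c' \<ge> min c1 c2" for c'
    proof -
      have g: "rate_g CARD('d) r n N \<ge> 0" "rate_g CARD('d) r n N = N powr r / slowdown CARD('d) r n"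
        using slowdown_ge_1[OF n, of "CARD('d)" r] Npos by (auto simp: rate_g_eq)
      have "x powr r / slowdown CARD('d) r n = (\<xi> / 3) powr r * rate_g CARD('d) r n N"
        unfolding g(2) x_def using \<xi> Npos powr_mult[of "\<xi> / 3" N r] by simp
      hence "c' * (x powr r / slowdown CARD('d) r n) = (c' * (\<xi> / 3) powr r) * rate_g CARD('d) r n N" by simp
      also have "\<dots> \<ge> c * rate_g CARD('d) r n N"
        unfolding c_def using that g by (intro mult_right_mono) auto
      finally show ?thesis by simp
    qed
    obtain F F' where F: "finite F" "card F \<le> CARD('d) * 0" "finite F'" "card F' \<le> CARD('d) * 0"
      and T: "\<And>u. edge_nonneg u \<Longrightarrow> time_in u (lattice_box n) 0 (axis k (int n)) \<le> sum u F + sum u F' + ?U u + ?U' u +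
        block_sum u k 0 0 0 m / level_size CARD('d) m + ?L u"
    proof -
      have "2 * 0 + 2 * m + 0 * 0 \<le> n" "CARD('d) * 0 \<le> n" "(0 :: nat) \<le> 0 \<or> (0 :: nat) = 0"
        by (auto simp: m_def)
      from chain_le[OF this, of k] show ?thesis using that by blast
    qed
    have T': "time_in u (lattice_box n) 0 (axis k (int n)) \<le> ?U u + ?U' u + ?L u" if "edge_nonneg u" for u
      using T[OF that] F by (simp add: block_sum_def)
    let ?A = "\<lambda>f. {\<omega>\<in>space M. x \<le> f (\<tau>' \<omega>)}"
    note meas = urn_sum_measurable[OF abs_flip_sign] urn_sum_measurable[of "\<lambda>_. 1", simplified] line_sum_measurable
    have ev: "?A ?U \<in> events" "?A ?U' \<in> events" "?A ?L \<in> events"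
      using meas by (auto intro!: borel_measurable_le)
    have "prob (?A ?U) \<le> exp (- c * rate_g CARD('d) r n N)"
      using n xm by (intro order_trans[OF c1[rule_format (no_asm)] tail_le]) (auto simp: m_def)
    moreover have "prob (?A ?U') \<le> exp (- c * rate_g CARD('d) r n N)"
      using n xm by (intro order_trans[OF c1[rule_format (no_asm)] tail_le]) (auto simp: m_def abs_flip_sign)
    moreover have "prob (?A ?L) \<le> exp (- c * rate_g CARD('d) r n N)"
    proof (rule order_trans[OF c2[rule_format (no_asm)] tail_le])
      show "\<forall>x\<in>urn_level m. \<forall>y\<in>urn_level m. x \<noteq> y \<longrightarrow> (\<exists>i. i \<noteq> k \<and> ?v x $ i \<noteq> ?v y $ i)"
        using block_start_differ by blast
      show "\<forall>x\<in>urn_level m. ?l x \<le> n" by (simp add: rest_length_def)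
      show "1 / 2 * real n \<le> real (Suc m)" unfolding m_def by linarith
    qed (use n x in auto)
    ultimately have "prob (?A ?U \<union> (?A ?U' \<union> ?A ?L)) \<le> exp (- c * rate_g CARD('d) r n N) +
        (exp (- c * rate_g CARD('d) r n N) + exp (- c * rate_g CARD('d) r n N))"
      using ev by (intro prob_Un_le sets.Un)
    moreover have "prob {\<omega>\<in>space M. \<xi> * N \<le> time_in (\<tau>' \<omega>) (lattice_box n) 0 (axis k (int n))} \<le>
        prob (?A ?U \<union> (?A ?U' \<union> ?A ?L))"
    proof (rule finite_measure_mono)
      show "?A ?U \<union> (?A ?U' \<union> ?A ?L) \<in> events" using ev by auto
      show "{\<omega>\<in>space M. \<xi> * N \<le> time_in (\<tau>' \<omega>) (lattice_box n) 0 (axis k (int n))} \<subseteq> ?A ?U \<union> (?A ?U' \<union> ?A ?L)"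
      proof
        fix \<omega> assume "\<omega> \<in> {\<omega>\<in>space M. \<xi> * N \<le> time_in (\<tau>' \<omega>) (lattice_box n) 0 (axis k (int n))}"
        hence \<omega>: "\<omega> \<in> space M" "3 * x \<le> time_in (\<tau>' \<omega>) (lattice_box n) 0 (axis k (int n))" by (auto simp: x_def)
        have "3 * x \<le> ?U (\<tau>' \<omega>) + ?U' (\<tau>' \<omega>) + ?L (\<tau>' \<omega>)"
          using T'[OF edge_nonneg_\<tau>[OF \<omega>(1)]] \<omega>(2) by linarith
        hence "x \<le> ?U (\<tau>' \<omega>) \<or> x \<le> ?U' (\<tau>' \<omega>) \<or> x \<le> ?L (\<tau>' \<omega>)" by linarith
        thus "\<omega> \<in> ?A ?U \<union> (?A ?U' \<union> ?A ?L)" using \<omega>(1) by blast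
      qed
    qed
    ultimately show ?thesis by linarith
  qed
  moreover have "K \<ge> 1" by (simp add: K_def)
  ultimately show ?thesis using c by blast
qed

text \<open>Corner flows of depth about \<open>\<epsilon> * n\<close> cost little and obey the rate
  of the theorem. In between, about \<open>n ^ (d - 1)\<close> chains of blocks have mean close to
  \<open>mu k\<close> per unit length, and their average deviates with probability exponentially
  small in \<open>n ^ d\<close>.\<close>

lemma upper_tail_near:
  fixes k :: 'd
  assumes \<xi>: "\<xi> > 0"
  shows "\<exists>n0. \<exists>c>0. \<exists>K>0. \<forall>n\<ge>n0. 1 \<le> n \<longrightarrow>
    prob {\<omega>\<in>space M. (mu k + \<xi>) * real n \<le> time_in (\<tau>' \<omega>) (lattice_box n) 0 (axis k (int n))} \<le>
      K * exp (- c * rate_g CARD('d) r n (real n))"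
proof -
  let ?C = mgfC and ?d = "CARD('d)"
  obtain L where L: "L \<ge> 1" "mean_time k L < (mu k + \<xi> / 8) * real L"
    using mu_approx[of "\<xi> / 8" k] \<xi> by auto
  obtain R where R: "R \<ge> L" "expectation (\<lambda>\<omega>. time_in (\<tau>' \<omega>) (lattice_cube R 0) 0 (0 + axis k (int L))) < mean_time k L + \<xi> / 8"
    using lattice_cube_approx[of "\<xi> / 8" L k] \<xi> by auto
  \<comment> \<open>The choice of \<open>L\<close> costs \<open>\<xi> / 8\<close> per unit length,
    and the confinement to the cube costs \<open>\<xi> / 8\<close> in all, which is at most
    \<open>\<xi> / 8 * L\<close>.\<close>
  define a where "a = (mu k + \<xi> / 4) * real L"
  have "\<xi> / 8 * 1 \<le> \<xi> / 8 * real L" using L(1) \<xi> by (intro mult_left_mono) auto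
  hence a: "expectation (\<lambda>\<omega>. time_in (\<tau>' \<omega>) (lattice_cube R 0) 0 (0 + axis k (int L))) \<le> a"
    using L(2) R(2) unfolding a_def by (simp add: algebra_simps)
  \<comment> \<open>With \<open>1 / 8\<close> the two flows occupy at most a quarter of the length
    of the box. With \<open>\<xi> / (80 * ?C)\<close> the flows and the lines, of length at most
    \<open>2 * m + L\<close>, meet the thresholds of their tail bounds at
    \<open>x = \<xi> * n / 10\<close>.\<close>
  define \<epsilon> where "\<epsilon> = min (1 / 8) (\<xi> / (80 * ?C))"
  have \<epsilon>: "\<epsilon> > 0" "\<epsilon> \<le> 1 / 8" "\<epsilon> \<le> \<xi> / (80 * ?C)" unfolding \<epsilon>_def using \<xi> mgfC_pos by auto
  obtain c1 where c1_pos: "c1 > 0" and c1: "\<forall>b s m n x. (\<forall>i. \<bar>s i\<bar> = 1) \<longrightarrow> m \<le> n \<longrightarrow> 1 \<le> n \<longrightarrow> 2 * mgfC * real m \<le> x \<longrightarrow>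
     prob {\<omega>\<in>space M. x \<le> urn_sum (\<tau>' \<omega>) b s m} \<le> exp (- c1 * (x powr r / slowdown ?d r n))"
    using urn_sum_tail by (elim exE conjE) (rule that)
  obtain c2 where c2_pos: "c2 > 0" and c2: "\<forall>k v l L m n x.
     (\<forall>x\<in>urn_level m. \<forall>y\<in>urn_level m. x \<noteq> y \<longrightarrow> (\<exists>i. i \<noteq> k \<and> v x $ i \<noteq> v y $ i)) \<longrightarrow>
     (\<forall>x\<in>urn_level m. l x \<le> L) \<longrightarrow> L \<le> n \<longrightarrow> 1 \<le> n \<longrightarrow> \<epsilon> * real n \<le> real (Suc m) \<longrightarrow>
     2 * mgfC * real L \<le> x \<longrightarrow>
     prob {\<omega>\<in>space M. x \<le> line_sum (\<tau>' \<omega>) k v l m} \<le> exp (- c2 * (x powr r / slowdown ?d r n))"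
    using line_sum_tail[OF \<epsilon>(1)] by (elim exE conjE) (rule that)
  obtain c3 where c3_pos: "c3 > 0" and c3: "\<forall>F n x. F \<subseteq> lattice_edges \<longrightarrow> finite F \<longrightarrow> card F \<le> ?d * R \<longrightarrow> 1 \<le> n \<longrightarrow>
     2 * mgfC * real (?d * R) \<le> x \<longrightarrow>
     prob {\<omega>\<in>space M. x \<le> (\<Sum>e\<in>F. \<tau> e \<omega>)} \<le> exp (- c3 * (x powr r / slowdown ?d r n))"
    using path_sum_tail[of "?d * R"] by (elim exE conjE) (rule that)
  have "0 < L" "\<xi> / 4 > 0" using L \<xi> by auto
  from block_sum_tail[OF this(1) R(1) this(2) a] obtain c4 K where c4_pos: "c4 > 0" and K_pos: "K > 0" and c4: "\<forall>n m J. J * L \<le> n \<longrightarrow> 1 \<le> n \<longrightarrow>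
    prob {\<omega>\<in>space M. (a * real J + \<xi> / 4 * real n) * level_size ?d m \<le> block_sum (\<tau>' \<omega>) k R L J m}
      \<le> K * exp (- c4 * (level_size ?d m * real n))"
    by (elim exE conjE) (rule that)
  define \<kappa> where "\<kappa> = (\<epsilon> / real ?d) ^ (?d - 1)"
  have \<kappa>: "\<kappa> > 0" unfolding \<kappa>_def using \<epsilon> by simp
  define c0 where "c0 = min c1 (min c2 c3)"
  define c where "c = min (c0 * (\<xi> / 10) powr r) (c4 * \<kappa>)"
  have c: "c > 0" unfolding c_def c0_def using c1_pos c2_pos c3_pos c4_pos \<kappa> \<xi> by simp
  \<comment> \<open>Beyond this size the margins \<open>R\<close>, the short paths of at most
    \<open>?d * R\<close> edges and a remainder of length \<open>L\<close> fit into the box, and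
    their thresholds are small compared with \<open>\<xi> * n\<close>.\<close>
  define n0 where "n0 = nat \<lceil>8 * real R + real (?d * R) + 2 * real L + 40 * ?C * real L / \<xi> + 20 * ?C * real (?d * R) / \<xi>\<rceil>"
  have "prob {\<omega>\<in>space M. (mu k + \<xi>) * real n \<le> time_in (\<tau>' \<omega>) (lattice_box n) 0 (axis k (int n))} \<le>
      (5 + K) * exp (- c * rate_g ?d r n (real n))"
    if n: "n \<ge> n0" "1 \<le> n" for n
  proof -
    define m where "m = nat \<lfloor>\<epsilon> * real n\<rfloor>"
    define J where "J = (n - 2 * R - 2 * m) div L"
    \<comment> \<open>Half of \<open>\<xi> * n\<close> is shared equally by the two flows, the lines
      and the two short paths. The blocks get the other half: a quarter of \<open>\<xi> * n\<close>
      for the gap between \<open>a\<close> and \<open>mu k * L\<close>, a quarter for their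
      fluctuation.\<close>
    define x where "x = \<xi> * real n / 10"
    let ?g = "rate_g ?d r n (real n)"
    let ?Z = "level_size ?d m"
    have Z: "?Z > 0" by (simp add: level_size_pos)
    define p1 p2 where "p1 = 40 * ?C * real L / \<xi>" and "p2 = 20 * ?C * real (?d * R) / \<xi>"
    have "real n \<ge> 8 * real R + real (?d * R) + 2 * real L + p1 + p2"
      using n(1) unfolding n0_def p1_def p2_def by linarith
    moreover have "p1 \<ge> 0" "p2 \<ge> 0" "real (?d * R) \<ge> 0" "real R \<ge> 0" "real L \<ge> 0"
      unfolding p1_def p2_def using mgfC_pos \<xi> by auto
    ultimately have "real n \<ge> 8 * real R" "real n \<ge> real (?d * R)" "real n \<ge> 2 * real L"
      "p1 \<le> real n" "p2 \<le> real n"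
      by linarith+
    note big = this[unfolded p1_def p2_def]
    have m: "real m \<le> \<epsilon> * real n" "\<epsilon> * real n \<le> real (Suc m)"
      unfolding m_def using \<epsilon>(1) by (auto simp: of_nat_nat) linarith
    have m8: "real m \<le> real n / 8"
      using m(1) mult_right_mono[OF \<epsilon>(2), of "real n"] by simp
    have "?C * \<epsilon> * 80 \<le> \<xi>" using \<epsilon>(3) mgfC_pos by (simp add: field_simps)
    hence "?C * \<epsilon> * 80 * real n \<le> \<xi> * real n" by (intro mult_right_mono) auto
    moreover have "?C * real m \<le> ?C * (\<epsilon> * real n)" using m mgfC_pos by (intro mult_left_mono) auto
    ultimately have Cm: "80 * (?C * real m) \<le> \<xi> * real n" by linarith
    have CL: "40 * (?C * real L) \<le> \<xi> * real n" "20 * (?C * real (?d * R)) \<le> \<xi> * real n"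
      using big(4,5) \<xi> by (simp_all add: field_simps)
    have mR: "2 * R + 2 * m \<le> n" using m8 big(1) by linarith
    have JL: "J * L \<le> n - 2 * R - 2 * m" "n - 2 * R - 2 * m < J * L + L"
      unfolding J_def using L(1) div_mult_mod_eq[of "n - 2 * R - 2 * m" L] mod_less_divisor[of L "n - 2 * R - 2 * m"]
      by linarith+
    let ?v = "\<lambda>x. block_start k R L (x, J)" and ?l = "rest_length k n R L J"
    let ?U = "\<lambda>u. urn_sum u (base_point R) (\<lambda>_. 1) m" and ?U' = "\<lambda>u. urn_sum u (mirror_point k n R) (flip_sign k) m"
    let ?Ls = "\<lambda>u. line_sum u k ?v ?l m" and ?B = "\<lambda>u. block_sum u k R L J m"
    have chain: "2 * R + 2 * m + J * L \<le> n" "?d * R \<le> n"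
      using JL(1) mR big(2) by linarith+
    obtain F F' where F: "F \<subseteq> lattice_edges" "finite F" "card F \<le> ?d * R"
        "F' \<subseteq> lattice_edges" "finite F'" "card F' \<le> ?d * R"
      and T: "\<And>u. edge_nonneg u \<Longrightarrow> time_in u (lattice_box n) 0 (axis k (int n)) \<le> sum u F + sum u F' + ?U u + ?U' u +
        ?B u / ?Z + ?Ls u"
      using chain_le[OF chain, of k] R(1) by blast
    have g: "?g = real n powr r / slowdown ?d r n" using n(2) by (simp add: rate_g_eq)
    have s1: "slowdown ?d r n \<ge> 1" using slowdown_ge_1[OF n(2)] .
    have g0: "?g \<ge> 0" unfolding g using s1 by simp
    have tail_le: "exp (- c' * (x powr r / slowdown ?d r n)) \<le> exp (- c * ?g)" if "c' \<ge> c0" for c'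
    proof -
      have "x powr r / slowdown ?d r n = (\<xi> / 10) powr r * ?g"
        unfolding g x_def using \<xi> powr_mult[of "\<xi> / 10" "real n" r] by simp
      hence "c' * (x powr r / slowdown ?d r n) = (c' * (\<xi> / 10) powr r) * ?g" by simp
      also have "\<dots> \<ge> c * ?g"
        unfolding c_def using that g0 by (intro mult_right_mono min.coboundedI1) auto
      finally show ?thesis by simp
    qed
    \<comment> \<open>The blocks deviate at speed \<open>?Z * n\<close>, of order at least
      \<open>n ^ d\<close>, and the rate at \<open>N = n\<close> is at most
      \<open>n ^ d\<close>.\<close>
    have block_le: "exp (- c4 * (?Z * real n)) \<le> exp (- c * ?g)"
    proof -
      have "(\<epsilon> * real n / real ?d) ^ (?d - 1) \<le> (real (Suc m) / real ?d) ^ (?d - 1)"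
        using m(2) \<epsilon> by (intro power_mono divide_right_mono) auto
      also have "\<dots> \<le> ?Z" by (rule level_size_ge) simp
      finally have "\<kappa> * real n ^ (?d - 1) \<le> ?Z"
        unfolding \<kappa>_def by (simp add: power_mult_distrib[symmetric])
      hence "\<kappa> * real n ^ (?d - 1) * real n \<le> ?Z * real n" by (intro mult_right_mono) auto
      moreover have "real n ^ (?d - 1) * real n = real n powr real ?d"
        using n(2) by (simp add: powr_realpow power_Suc2[symmetric] del: power_Suc)
      ultimately have Zn: "\<kappa> * real n powr real ?d \<le> ?Z * real n" by (simp add: mult.assoc)
      have "real n powr r = real n powr real ?d * real n powr (r - real ?d)"
        by (simp flip: powr_add)
      also have "\<dots> \<le> real n powr real ?d * slowdown ?d r n"
        by (intro mult_left_mono powr_le_slowdown n(2)) auto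
      finally have "?g \<le> real n powr real ?d" unfolding g using s1 by (simp add: field_simps)
      hence "\<kappa> * ?g \<le> ?Z * real n" using Zn \<kappa> by (meson mult_left_mono order_trans less_imp_le)
      hence "c4 * \<kappa> * ?g \<le> c4 * (?Z * real n)"
        using c4_pos by (simp add: mult.assoc mult_left_mono)
      moreover have "c * ?g \<le> c4 * \<kappa> * ?g" unfolding c_def using g0 by (intro mult_right_mono) auto
      ultimately show ?thesis by simp
    qed
    let ?A = "\<lambda>f. {\<omega>\<in>space M. x \<le> f (\<tau>' \<omega>)}"
    let ?AB = "{\<omega>\<in>space M. (a * real J + \<xi> / 4 * real n) * ?Z \<le> ?B (\<tau>' \<omega>)}"
    let ?F = "\<lambda>u. sum u F" and ?F' = "\<lambda>u. sum u F'"
    let ?e = "exp (- c * ?g)"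
    have Fm: "(\<lambda>\<omega>. ?F (\<tau>' \<omega>)) \<in> borel_measurable M" "(\<lambda>\<omega>. ?F' (\<tau>' \<omega>)) \<in> borel_measurable M"
      using F by (auto intro!: borel_measurable_sum)
    note meas = urn_sum_measurable[OF abs_flip_sign] urn_sum_measurable[of "\<lambda>_. 1", simplified]
      line_sum_measurable block_sum_measurable
    have ev: "?A ?U \<in> events" "?A ?U' \<in> events" "?A ?Ls \<in> events" "?A ?F \<in> events" "?A ?F' \<in> events" "?AB \<in> events"
      using meas Fm by (auto intro!: borel_measurable_le)
    have "0 \<le> ?C * real m" using mgfC_pos by simp
    hence xm: "2 * ?C * real m \<le> x" unfolding x_def using Cm by linarith
    have mn: "m \<le> n" using mR by simp
    have pU: "prob (?A ?U) \<le> ?e"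
      using n xm mn by (intro order_trans[OF c1[rule_format (no_asm)] tail_le]) (auto simp: c0_def)
    have pU': "prob (?A ?U') \<le> ?e"
      using n xm mn by (intro order_trans[OF c1[rule_format (no_asm)] tail_le]) (auto simp: abs_flip_sign c0_def)
    have pL: "prob (?A ?Ls) \<le> ?e"
    proof (rule order_trans[OF c2[rule_format (no_asm)] tail_le])
      show "\<forall>x\<in>urn_level m. \<forall>y\<in>urn_level m. x \<noteq> y \<longrightarrow> (\<exists>i. i \<noteq> k \<and> ?v x $ i \<noteq> ?v y $ i)"
        using block_start_differ by blast
      \<comment> \<open>\<open>L\<close> bounds the remainder of the division that defines
        \<open>J\<close>; the rest appears because \<open>J\<close> is the same for all
        \<open>x\<close>, while the distance to the mirror image varies with
        \<open>x k\<close>.\<close>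
      show "\<forall>x\<in>urn_level m. ?l x \<le> 2 * m + L"
        using JL(2) by (auto simp: rest_length_def)
      show "2 * m + L \<le> n" using m8 big(3) by linarith
      show "2 * ?C * real (2 * m + L) \<le> x" unfolding x_def using Cm CL(1) by (simp add: algebra_simps)
    qed (use n m c0_def in auto)
    have xF: "2 * ?C * real (?d * R) \<le> x" unfolding x_def using CL(2) by simp
    have pF: "prob (?A ?F) \<le> ?e"
      using F n xF by (intro order_trans[OF c3[rule_format (no_asm)] tail_le]) (auto simp: c0_def)
    have pF': "prob (?A ?F') \<le> ?e"
      using F n xF by (intro order_trans[OF c3[rule_format (no_asm)] tail_le]) (auto simp: c0_def)
    have "J * L \<le> n" using JL(1) by linarith
    hence "prob ?AB \<le> K * exp (- c4 * (?Z * real n))" by (rule c4[rule_format (no_asm), OF _ n(2)])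
    also have "\<dots> \<le> K * ?e" using K_pos block_le by (intro mult_left_mono) auto
    finally have pB: "prob ?AB \<le> K * ?e" .
    have "prob (?A ?U \<union> (?A ?U' \<union> (?A ?Ls \<union> (?A ?F \<union> (?A ?F' \<union> ?AB))))) \<le> ?e + (?e + (?e + (?e + (?e + K * ?e))))"
      by (intro prob_Un_le sets.Un ev pU pU' pL pF pF' pB)
    also have "\<dots> = (5 + K) * ?e" by (simp add: algebra_simps)
    finally have un: "prob (?A ?U \<union> (?A ?U' \<union> (?A ?Ls \<union> (?A ?F \<union> (?A ?F' \<union> ?AB))))) \<le> (5 + K) * ?e" .
    have "prob {\<omega>\<in>space M. (mu k + \<xi>) * real n \<le> time_in (\<tau>' \<omega>) (lattice_box n) 0 (axis k (int n))} \<le>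
        prob (?A ?U \<union> (?A ?U' \<union> (?A ?Ls \<union> (?A ?F \<union> (?A ?F' \<union> ?AB)))))"
    proof (rule finite_measure_mono)
      show "?A ?U \<union> (?A ?U' \<union> (?A ?Ls \<union> (?A ?F \<union> (?A ?F' \<union> ?AB)))) \<in> events" using ev by (intro sets.Un)
      show "{\<omega>\<in>space M. (mu k + \<xi>) * real n \<le> time_in (\<tau>' \<omega>) (lattice_box n) 0 (axis k (int n))} \<subseteq>
          ?A ?U \<union> (?A ?U' \<union> (?A ?Ls \<union> (?A ?F \<union> (?A ?F' \<union> ?AB))))"
      proof
        fix \<omega> assume "\<omega> \<in> {\<omega>\<in>space M. (mu k + \<xi>) * real n \<le> time_in (\<tau>' \<omega>) (lattice_box n) 0 (axis k (int n))}"
        hence \<omega>: "\<omega> \<in> space M" "(mu k + \<xi>) * real n \<le> time_in (\<tau>' \<omega>) (lattice_box n) 0 (axis k (int n))" by auto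
        let ?u = "\<tau>' \<omega>"
        have Jn: "a * real J \<le> (mu k + \<xi> / 4) * real n"
        proof -
          have "a * real J = (mu k + \<xi> / 4) * real (J * L)" by (simp add: a_def)
          also have "\<dots> \<le> (mu k + \<xi> / 4) * real n"
            using \<open>J * L \<le> n\<close> mu_nonneg[of k] \<xi> by (intro mult_left_mono) (simp_all only: of_nat_le_iff)
          finally show ?thesis .
        qed
        have "(mu k + \<xi>) * real n \<le> ?F ?u + ?F' ?u + ?U ?u + ?U' ?u + ?B ?u / ?Z + ?Ls ?u"
          using T[OF edge_nonneg_\<tau>[OF \<omega>(1)]] \<omega>(2) by (rule order_trans[rotated])
        moreover have "(mu k + \<xi>) * real n = 5 * x + ((mu k + \<xi> / 4) * real n + \<xi> / 4 * real n)"
          unfolding x_def by (simp add: algebra_simps)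
        ultimately have "x \<le> ?U ?u \<or> x \<le> ?U' ?u \<or> x \<le> ?Ls ?u \<or> x \<le> ?F ?u \<or> x \<le> ?F' ?u \<or>
            a * real J + \<xi> / 4 * real n \<le> ?B ?u / ?Z"
          using Jn by linarith
        moreover have "a * real J + \<xi> / 4 * real n \<le> ?B ?u / ?Z \<Longrightarrow>
            (a * real J + \<xi> / 4 * real n) * ?Z \<le> ?B ?u"
          using Z by (simp add: pos_le_divide_eq)
        ultimately show "\<omega> \<in> ?A ?U \<union> (?A ?U' \<union> (?A ?Ls \<union> (?A ?F \<union> (?A ?F' \<union> ?AB))))"
          using \<omega>(1) by blast
      qed
    qed
    with un show ?thesis by linarith
  qed
  thus ?thesis using c K_pos by (intro exI[of _ n0] exI[of _ c] conjI exI[of _ "5 + K"]) auto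
qed

end

subsection \<open>The time constant\<close>

context fpp
begin

definition axis_time :: "'d \<Rightarrow> 'a \<Rightarrow> nat \<Rightarrow> nat \<Rightarrow> real" where
  "axis_time k \<omega> i j = time_in (\<tau>' \<omega>) UNIV (axis k (int i)) (axis k (int j))"

definition step_time :: "'d \<Rightarrow> 'a \<Rightarrow> nat \<Rightarrow> real" where
  "step_time k \<omega> i = \<tau> {0 + axis k (int i), 0 + axis k (int (Suc i))} \<omega>"

lemma axis_paths: "paths_in UNIV (axis k (int i)) (axis k (int j)) \<noteq> {}"
proof -
  have *: "paths_in UNIV (axis k (int i)) (axis k (int (i + n))) \<noteq> {}" for i n
    using paths_in_line[of n "axis k (int i)" k UNIV] by (simp add: axis_plus)
  show ?thesis
  proof (cases "i \<le> j")
    case True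
    thus ?thesis using *[of i "j - i"] by simp
  next
    case False
    thus ?thesis using paths_in_commute[OF *[of j "i - j"]] by simp
  qed
qed

lemma axis_time_nonneg: "\<omega> \<in> space M \<Longrightarrow> 0 \<le> axis_time k \<omega> i j"
  unfolding axis_time_def by (intro time_in_nonneg edge_nonneg_\<tau> axis_paths)

lemma axis_time_triangle: "\<omega> \<in> space M \<Longrightarrow> axis_time k \<omega> i l \<le> axis_time k \<omega> i j + axis_time k \<omega> j l"
  unfolding axis_time_def by (intro time_in_triangle edge_nonneg_\<tau> axis_paths)

lemma axis_time_refl: "\<omega> \<in> space M \<Longrightarrow> axis_time k \<omega> i i = 0"
  unfolding axis_time_def by (intro time_in_refl edge_nonneg_\<tau>) auto

lemma axis_time_measurable [measurable]: "(\<lambda>\<omega>. axis_time k \<omega> i j) \<in> borel_measurable M"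
  unfolding axis_time_def by (rule time_in_measurable)

lemma step_time_measurable [measurable]: "(\<lambda>\<omega>. step_time k \<omega> i) \<in> borel_measurable M"
  unfolding step_time_def by (intro \<tau>_measurable line_edge)

lemma step_time_nonneg: "\<omega> \<in> space M \<Longrightarrow> 0 \<le> step_time k \<omega> i"
  unfolding step_time_def by (intro nonneg line_edge)

lemma axis_time_Suc: "\<omega> \<in> space M \<Longrightarrow> axis_time k \<omega> i (Suc i) \<le> step_time k \<omega> i"
proof -
  assume "\<omega> \<in> space M"
  hence "time_in (\<tau>' \<omega>) UNIV (0 + axis k (int i)) (0 + axis k (int (Suc i))) \<le>
      \<tau>' \<omega> {0 + axis k (int i), 0 + axis k (int (Suc i))}"
  proof (intro time_in_edge edge_nonneg_\<tau>)
    have "0 + axis k (int i) - (0 + axis k (int (Suc i))) = axis k (-1)"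
      by (simp add: vec_eq_iff axis_def)
    thus "l1_norm (0 + axis k (int i) - (0 + axis k (int (Suc i))) :: int ^ 'd) = 1"
      by (simp only: l1_norm_axis)
  qed auto
  thus ?thesis by (simp add: axis_time_def step_time_def)
qed

lemma axis_time_le_sum_step_time: "\<omega> \<in> space M \<Longrightarrow> i \<le> j \<Longrightarrow> axis_time k \<omega> i j \<le> (\<Sum>l\<in>{i..<j}. step_time k \<omega> l)"
proof (induction j)
  case (Suc j)
  show ?case
  proof (cases "i = Suc j")
    case False
    hence "i \<le> j" using Suc.prems by simp
    thus ?thesis
      using Suc.IH Suc.prems axis_time_triangle[of \<omega> k i "Suc j" j] axis_time_Suc[of \<omega> k j] by simp
  qed (use Suc.prems in \<open>simp add: axis_time_refl\<close>)
qed (simp add: axis_time_refl)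

lemma expectation_axis_time: "expectation (\<lambda>\<omega>. axis_time k \<omega> 0 n) = mean_time k n"
  by (simp add: axis_time_def mean_time_def)

lemma integrable_axis_time: "integrable M (\<lambda>\<omega>. axis_time k \<omega> 0 n)"
  using integrable_time_in_UNIV[of k n] by (simp add: axis_time_def)

text \<open>Twice the bound of \<open>exp_moment\<close> at \<open>s = 1\<close>; both
  \<open>t\<close> and its square are at most \<open>2 * exp t\<close> for
  \<open>t >= 0\<close>.\<close>

definition momC :: real where
  "momC = 2 * exp (mgfC * 2)"

lemma edge_moments:
  assumes e: "e \<in> lattice_edges"
  shows "integrable M (\<tau> e)" "integrable M (\<lambda>\<omega>. (\<tau> e \<omega>)\<^sup>2)"
    and "expectation (\<tau> e) \<le> momC" "expectation (\<lambda>\<omega>. (\<tau> e \<omega>)\<^sup>2) \<le> momC"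
proof -
  have *: "(\<integral>\<^sup>+\<omega>. ennreal (exp (\<tau> e \<omega>)) \<partial>M) \<le> ennreal (momC / 2)"
    using exp_moment[OF e, of 1] by (simp add: momC_def)
  have int: "integrable M (\<lambda>\<omega>. exp (\<tau> e \<omega>))"
    using * e by (intro integrableI_bounded) (auto simp: less_top[symmetric] top_unique)
  have "ennreal (expectation (\<lambda>\<omega>. exp (\<tau> e \<omega>))) = (\<integral>\<^sup>+\<omega>. ennreal (exp (\<tau> e \<omega>)) \<partial>M)"
    by (intro nn_integral_eq_integral[symmetric] int) auto
  with * have "ennreal (expectation (\<lambda>\<omega>. exp (\<tau> e \<omega>))) \<le> ennreal (momC / 2)" by simp
  hence E: "2 * expectation (\<lambda>\<omega>. exp (\<tau> e \<omega>)) \<le> momC"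
    by (subst (asm) ennreal_le_iff) (simp_all add: momC_def)
  have le: "\<tau> e \<omega> \<le> 2 * exp (\<tau> e \<omega>)" "(\<tau> e \<omega>)\<^sup>2 \<le> 2 * exp (\<tau> e \<omega>)" if "\<omega> \<in> space M" for \<omega>
  proof -
    have "0 \<le> \<tau> e \<omega>" by (rule nonneg[OF e that])
    with exp_lower_Taylor_quadratic[OF this] zero_le_power2[of "\<tau> e \<omega>"]
    show "\<tau> e \<omega> \<le> 2 * exp (\<tau> e \<omega>)" "(\<tau> e \<omega>)\<^sup>2 \<le> 2 * exp (\<tau> e \<omega>)"
      by linarith+
  qed
  have int2: "integrable M (\<lambda>\<omega>. 2 * exp (\<tau> e \<omega>))" using int by simp
  show i: "integrable M (\<tau> e)" "integrable M (\<lambda>\<omega>. (\<tau> e \<omega>)\<^sup>2)"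
    using e le nonneg by (auto intro!: Bochner_Integration.integrable_bound[OF int2] AE_I2)
  have "expectation (\<tau> e) \<le> expectation (\<lambda>\<omega>. 2 * exp (\<tau> e \<omega>))"
    "expectation (\<lambda>\<omega>. (\<tau> e \<omega>)\<^sup>2) \<le> expectation (\<lambda>\<omega>. 2 * exp (\<tau> e \<omega>))"
    by (intro integral_mono i int2 le; assumption)+
  thus "expectation (\<tau> e) \<le> momC" "expectation (\<lambda>\<omega>. (\<tau> e \<omega>)\<^sup>2) \<le> momC"
    using E by auto
qed

lemma step_time_moments:
  shows "integrable M (\<lambda>\<omega>. step_time k \<omega> i)" "integrable M (\<lambda>\<omega>. (step_time k \<omega> i)\<^sup>2)"
    and "expectation (\<lambda>\<omega>. step_time k \<omega> i) \<le> momC" "expectation (\<lambda>\<omega>. (step_time k \<omega> i)\<^sup>2) \<le> momC"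
  unfolding step_time_def by (intro edge_moments line_edge)+

text \<open>Restricting paths to the box only increases the time, so \<open>upper_tail_near\<close>
  applies; since the rate is at least \<open>n\<close>, the bound is geometric.\<close>

lemma axis_time_upper_prob:
  assumes \<xi>: "\<xi> > 0"
  shows "\<exists>n0. \<exists>c>0. \<exists>K>0. \<forall>n\<ge>n0. prob {\<omega>\<in>space M. (mu k + \<xi>) * real n \<le> axis_time k \<omega> 0 n} \<le> K * exp (-c) ^ n"
proof -
  obtain n0 c K where c: "c > 0" and K: "K > 0" and *: "\<forall>n\<ge>n0. 1 \<le> n \<longrightarrow>
    prob {\<omega>\<in>space M. (mu k + \<xi>) * real n \<le> time_in (\<tau>' \<omega>) (lattice_box n) 0 (axis k (int n))} \<le>
      K * exp (- c * rate_g CARD('d) r n (real n))"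
    using upper_tail_near[OF \<xi>, of k] by (elim exE conjE) (rule that)
  have "prob {\<omega>\<in>space M. (mu k + \<xi>) * real n \<le> axis_time k \<omega> 0 n} \<le> K * exp (-c) ^ n" if n: "n \<ge> max 1 n0" for n
  proof -
    have "axis_time k \<omega> 0 n \<le> time_in (\<tau>' \<omega>) (lattice_box n) 0 (axis k (int n))" if "\<omega> \<in> space M" for \<omega>
      using time_in_mono[OF edge_nonneg_\<tau>[OF that] paths_in_lattice_box subset_UNIV] by (simp add: axis_time_def)
    hence "prob {\<omega>\<in>space M. (mu k + \<xi>) * real n \<le> axis_time k \<omega> 0 n} \<le>
        prob {\<omega>\<in>space M. (mu k + \<xi>) * real n \<le> time_in (\<tau>' \<omega>) (lattice_box n) 0 (axis k (int n))}"
    proof (intro finite_measure_mono subsetI)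
      show "{\<omega>\<in>space M. (mu k + \<xi>) * real n \<le> time_in (\<tau>' \<omega>) (lattice_box n) 0 (axis k (int n))} \<in> events"
        by measurable
    qed (blast intro: order_trans)
    also have "\<dots> \<le> K * exp (- c * rate_g CARD('d) r n (real n))" using * n by auto
    also have "\<dots> \<le> K * exp (- c * real n)"
      using K c rate_g_ge_n[of n "CARD('d)" r "real n"] n r_gt_1 by (auto simp: Suc_le_eq)
    also have "exp (- c * real n) = exp (-c) ^ n" by (metis exp_of_nat2_mult)
    finally show ?thesis .
  qed
  thus ?thesis using c K by blast
qed

lemma axis_time_upper:
  assumes "mu k < c'"
  shows "AE \<omega> in M. eventually (\<lambda>n. axis_time k \<omega> 0 n \<le> c' * real n) sequentially"
proof -
  define \<xi> where "\<xi> = c' - mu k"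
  have \<xi>: "\<xi> > 0" using assms by (simp add: \<xi>_def)
  let ?A = "\<lambda>n. {\<omega>\<in>space M. (mu k + \<xi>) * real n \<le> axis_time k \<omega> 0 n}"
  obtain n0 c K where c: "c > 0" and K: "K > 0" and *: "\<forall>n\<ge>n0. prob (?A n) \<le> K * exp (-c) ^ n"
    using axis_time_upper_prob[OF \<xi>, of k] by (elim exE conjE) (rule that)
  have "AE \<omega> in M. eventually (\<lambda>n. \<omega> \<in> space M - ?A n) sequentially"
  proof (rule borel_cantelli_AE1)
    show "summable (\<lambda>n. measure M (?A n))"
    proof (rule summable_comparison_test_ev)
      show "eventually (\<lambda>n. norm (measure M (?A n)) \<le> K * exp (-c) ^ n) sequentially"
        using * by (auto simp: eventually_sequentially)
      show "summable (\<lambda>n. K * exp (-c) ^ n)" using c by (intro summable_mult summable_geometric) auto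
    qed
  qed (auto simp: emeasure_eq_measure)
  thus ?thesis
  proof eventually_elim
    case (elim \<omega>)
    thus ?case by eventually_elim (auto simp: \<xi>_def)
  qed
qed

text \<open>Convergence of the positive part in mean, with second moments in the role of uniform
  integrability. Off the rare event \<open>?A n\<close> the excess is small. On it, either the time
  is at most \<open>K * n\<close>, or Cauchy-Schwarz for the straight line bounds it by
  \<open>?Y / K\<close>.\<close>

lemma axis_time_excess:
  assumes \<epsilon>: "\<epsilon> > 0"
  shows "eventually (\<lambda>n. expectation (\<lambda>\<omega>. max 0 (axis_time k \<omega> 0 n - mu k * real n)) \<le> \<epsilon> * real n) sequentially"
proof -
  \<comment> \<open>Makes the mean of \<open>?Y / K\<close>, at most \<open>n * momC / K\<close>, a
    third of the allowed error. The rare event and the deviation below it take the other two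
    thirds.\<close>
  define K where "K = 3 * (momC + 1) / \<epsilon>"
  have mom: "momC > 0" by (simp add: momC_def)
  have K: "K > 0" using \<epsilon> mom unfolding K_def by simp
  let ?A = "\<lambda>n. {\<omega>\<in>space M. (mu k + \<epsilon> / 3) * real n \<le> axis_time k \<omega> 0 n}"
  obtain n0 c C where c: "c > 0" and *: "\<forall>n\<ge>n0. prob (?A n) \<le> C * exp (-c) ^ n"
    using axis_time_upper_prob[of "\<epsilon> / 3" k] \<epsilon> by auto
  have "(\<lambda>n. C * exp (-c) ^ n) \<longlonglongrightarrow> C * 0"
    using c by (intro tendsto_mult tendsto_const LIMSEQ_realpow_zero) auto
  hence "eventually (\<lambda>n. C * exp (-c) ^ n < \<epsilon> / (3 * K)) sequentially"
    using \<epsilon> K by (intro order_tendstoD(2)) auto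
  moreover have "eventually (\<lambda>n. n \<ge> max 1 n0) sequentially" by (rule eventually_ge_at_top)
  ultimately show ?thesis
  proof eventually_elim
    case (elim n)
    have PA: "prob (?A n) \<le> \<epsilon> / (3 * K)" using *[rule_format, of n] elim by linarith
    have n: "real n > 0" using elim by simp
    have int: "integrable M (\<lambda>\<omega>. max 0 (axis_time k \<omega> 0 n - mu k * real n))"
      using integrable_axis_time[of k n] by (intro integrable_max) auto
    let ?Y = "\<lambda>\<omega>. \<Sum>l<n. (step_time k \<omega> l)\<^sup>2"
    have Y: "integrable M ?Y" using step_time_moments by (intro Bochner_Integration.integrable_sum)
    have YK: "integrable M (\<lambda>\<omega>. ?Y \<omega> / K)" using Y by simp
    have ind: "integrable M (\<lambda>\<omega>. K * real n * indicator (?A n) \<omega> :: real)"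
    proof (intro integrable_mult_right integrable_real_indicator)
      show "?A n \<in> events" by measurable
    qed (simp add: emeasure_eq_measure)
    have EY: "expectation ?Y \<le> real n * momC"
    proof -
      have "expectation ?Y = (\<Sum>l<n. expectation (\<lambda>\<omega>. (step_time k \<omega> l)\<^sup>2))"
        using step_time_moments by (intro Bochner_Integration.integral_sum)
      also have "\<dots> \<le> (\<Sum>l<n. momC)" by (intro sum_mono step_time_moments)
      finally show ?thesis by simp
    qed
    have "expectation (\<lambda>\<omega>. max 0 (axis_time k \<omega> 0 n - mu k * real n)) \<le>
        expectation (\<lambda>\<omega>. \<epsilon> / 3 * real n + K * real n * indicator (?A n) \<omega> + ?Y \<omega> / K)"
    proof (intro integral_mono int)
      show "integrable M (\<lambda>\<omega>. \<epsilon> / 3 * real n + K * real n * indicator (?A n) \<omega> + ?Y \<omega> / K)"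
        by (intro Bochner_Integration.integrable_add integrable_const ind YK)
      fix \<omega> assume \<omega>: "\<omega> \<in> space M"
      let ?p = "axis_time k \<omega> 0 n"
      have Y0: "0 \<le> ?Y \<omega> / K" using K by (intro divide_nonneg_nonneg sum_nonneg) auto
      have p0: "0 \<le> ?p" by (rule axis_time_nonneg[OF \<omega>])
      show "max 0 (?p - mu k * real n) \<le> \<epsilon> / 3 * real n + K * real n * indicator (?A n) \<omega> + ?Y \<omega> / K"
      proof (cases "\<omega> \<in> ?A n")
        case False
        hence "?p < (mu k + \<epsilon> / 3) * real n" using \<omega> by simp
        hence "?p - mu k * real n \<le> \<epsilon> / 3 * real n" by (simp add: algebra_simps)
        thus ?thesis using False Y0 \<epsilon> by (simp add: max_def)
      next
        case True
        have "?p \<le> K * real n + ?Y \<omega> / K"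
        proof (cases "?p \<le> K * real n")
          case False
          have "?p\<^sup>2 \<le> (\<Sum>l<n. step_time k \<omega> l)\<^sup>2"
            using axis_time_le_sum_step_time[OF \<omega>, of 0 n] p0 by (intro power_mono) (auto simp: atLeast0LessThan)
          also have "\<dots> \<le> real n * ?Y \<omega>"
            using sum_squared_le_sum_of_squares[of "\<lambda>l. step_time k \<omega> l" "{..<n}"] by (simp add: mult.commute)
          finally have "?p * ?p \<le> real n * ?Y \<omega>" by (simp add: power2_eq_square)
          moreover have "(K * real n) * ?p \<le> ?p * ?p" using False p0 by (intro mult_right_mono) auto
          ultimately have "real n * (K * ?p) \<le> real n * ?Y \<omega>" by (simp add: mult_ac)
          hence "K * ?p \<le> ?Y \<omega>" using n by simp
          hence "?p \<le> ?Y \<omega> / K" using K by (simp add: field_simps)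
          thus ?thesis using K n by (simp add: add_increasing)
        qed (use Y0 in simp)
        moreover have "0 \<le> mu k * real n" "0 \<le> \<epsilon> / 3 * real n"
          using mu_nonneg[of k] \<epsilon> by (auto intro!: mult_nonneg_nonneg)
        moreover have "indicator (?A n) \<omega> = (1 :: real)" using True by simp
        ultimately show ?thesis using p0 Y0 K n by (simp only: max_def) auto
      qed
    qed
    also have "\<dots> = \<epsilon> / 3 * real n + K * real n * prob (?A n) + expectation ?Y / K"
      by (simp only: Bochner_Integration.integral_add[OF Bochner_Integration.integrable_add[OF integrable_const ind] YK]
          Bochner_Integration.integral_add[OF integrable_const ind] integral_mult_right_zero
          Bochner_Integration.integral_indicator integral_divide_zero)
        (simp add: prob_space)
    also have "\<dots> \<le> \<epsilon> / 3 * real n + K * real n * (\<epsilon> / (3 * K)) + real n * momC / K"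
      using PA EY K n \<epsilon> by (intro add_mono mult_left_mono divide_right_mono) auto
    also have "K * real n * (\<epsilon> / (3 * K)) = \<epsilon> / 3 * real n" using K by simp
    also have "real n * momC / K \<le> \<epsilon> / 3 * real n"
    proof -
      have "momC / K = momC / (momC + 1) * (\<epsilon> / 3)" unfolding K_def using \<epsilon> mom by (simp add: field_simps)
      also have "\<dots> \<le> 1 * (\<epsilon> / 3)" using \<epsilon> mom by (intro mult_right_mono) auto
      finally have "real n * (momC / K) \<le> real n * (\<epsilon> / 3)" using n by (intro mult_left_mono) auto
      thus ?thesis by (simp add: mult.commute)
    qed
    finally show ?case by simp
  qed
qed

text \<open>
  The lower bound follows Steele's proof of the subadditive ergodic theorem. A greedy chain of fast
  steps from the origin has to pay for a single edge at the late sites only, and their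
  contribution vanishes as \<open>N\<close> grows.
\<close>

definition late :: "'d \<Rightarrow> real \<Rightarrow> nat \<Rightarrow> nat \<Rightarrow> 'a set" where
  "late k c N i = {\<omega>\<in>space M. (\<exists>n\<ge>1. axis_time k \<omega> i (i + n) < c * real n) \<and>
     \<not> (\<exists>n\<ge>1. n \<le> N \<and> axis_time k \<omega> i (i + n) < c * real n)}"

lemma late_events [measurable]: "late k c N i \<in> events"
  unfolding late_def by measurable

text \<open>Induction on the number \<open>p\<close> of sites still to be crossed. A late site pays
  its own edge and advances by one. From any other site there is a jump of length
  \<open>n <= N\<close> at cost below \<open>c * n\<close>; if it would overshoot \<open>m\<close>,
  fewer than \<open>N\<close> sites remain, and they are crossed edge by edge.\<close>

lemma greedy_bound:
  assumes \<omega>: "\<omega> \<in> space M" and c: "0 \<le> c" and fast: "\<And>i. \<exists>n\<ge>1. axis_time k \<omega> i (i + n) < c * real n"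
    and "N \<le> m" "p \<le> m"
  shows "axis_time k \<omega> (m - p) m \<le> (\<Sum>i\<in>{m - p..<m}. step_time k \<omega> i * indicator (late k c N i) \<omega>) + c * real p +
    (\<Sum>i\<in>{m - N..<m}. step_time k \<omega> i)"
  using \<open>p \<le> m\<close>
proof (induction p rule: less_induct)
  case (less p)
  let ?l = "\<lambda>i. step_time k \<omega> i * indicator (late k c N i) \<omega>"
  have l0: "0 \<le> ?l i" for i using step_time_nonneg[OF \<omega>] by simp
  have rest: "0 \<le> (\<Sum>i\<in>{m - N..<m}. step_time k \<omega> i)" by (intro sum_nonneg step_time_nonneg \<omega>)
  define i where "i = m - p"
  show ?case
  proof (cases "p = 0")
    case True
    thus ?thesis using rest by (simp add: axis_time_refl[OF \<omega>])
  next
    case False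
    hence i: "i < m" "m - (p - 1) = Suc i" using less.prems unfolding i_def by auto
    show ?thesis
    proof (cases "\<omega> \<in> late k c N i")
      case True
      have "axis_time k \<omega> i m \<le> step_time k \<omega> i + axis_time k \<omega> (Suc i) m"
        using axis_time_triangle[OF \<omega>, of k i m "Suc i"] axis_time_Suc[OF \<omega>, of k i] by linarith
      also have "axis_time k \<omega> (Suc i) m \<le> (\<Sum>i\<in>{Suc i..<m}. ?l i) + c * real (p - 1) + (\<Sum>i\<in>{m - N..<m}. step_time k \<omega> i)"
        using less.IH[of "p - 1"] False less.prems i by simp
      also have "c * real (p - 1) \<le> c * real p" using c by (intro mult_left_mono) auto
      also have "step_time k \<omega> i + ((\<Sum>i\<in>{Suc i..<m}. ?l i) + c * real p + (\<Sum>i\<in>{m - N..<m}. step_time k \<omega> i)) =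
          (\<Sum>i\<in>{i..<m}. ?l i) + c * real p + (\<Sum>i\<in>{m - N..<m}. step_time k \<omega> i)"
        using True by (subst sum.atLeast_Suc_lessThan[OF i(1)]) simp
      finally show ?thesis unfolding i_def by simp
    next
      case False
      then obtain n where n: "n \<ge> 1" "n \<le> N" "axis_time k \<omega> i (i + n) < c * real n"
        using fast[of i] \<omega> unfolding late_def by blast
      show ?thesis
      proof (cases "n \<le> p")
        case True
        have i': "m - (p - n) = i + n" using True less.prems unfolding i_def by simp
        have "axis_time k \<omega> i m \<le> axis_time k \<omega> i (i + n) + axis_time k \<omega> (i + n) m" by (rule axis_time_triangle[OF \<omega>])
        also have "axis_time k \<omega> (i + n) m \<le> (\<Sum>i\<in>{i + n..<m}. ?l i) + c * real (p - n) + (\<Sum>i\<in>{m - N..<m}. step_time k \<omega> i)"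
          using less.IH[of "p - n"] \<open>p \<noteq> 0\<close> n less.prems i' by simp
        also have "(\<Sum>i\<in>{i + n..<m}. ?l i) \<le> (\<Sum>i\<in>{i..<m}. ?l i)"
          using l0 by (intro sum_mono2) auto
        finally have "axis_time k \<omega> i m \<le> axis_time k \<omega> i (i + n) + ((\<Sum>i\<in>{i..<m}. ?l i) + c * real (p - n) + (\<Sum>i\<in>{m - N..<m}. step_time k \<omega> i))"
          by simp
        moreover have "c * real (p - n) = c * real p - c * real n"
          using True by (simp add: of_nat_diff right_diff_distrib)
        ultimately show ?thesis using n(3) unfolding i_def by linarith
      next
        case False
        have "axis_time k \<omega> i m \<le> (\<Sum>i\<in>{i..<m}. step_time k \<omega> i)" using i by (intro axis_time_le_sum_step_time \<omega>) auto
        also have "\<dots> \<le> (\<Sum>i\<in>{m - N..<m}. step_time k \<omega> i)"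
          using False n(2) step_time_nonneg[OF \<omega>] by (intro sum_mono2) (auto simp: i_def)
        moreover have "0 \<le> (\<Sum>i\<in>{i..<m}. ?l i)" by (intro sum_nonneg l0)
        moreover have "0 \<le> c * real p" using c by simp
        ultimately show ?thesis unfolding i_def by linarith
      qed
    qed
  qed
qed

text \<open>Lateness at site \<open>i\<close> is lateness at the origin for the shifted
  configuration.\<close>

lemma expectation_late:
  "expectation (\<lambda>\<omega>. step_time k \<omega> i * indicator (late k c N i) \<omega>) =
   expectation (\<lambda>\<omega>. step_time k \<omega> 0 * indicator (late k c N 0) \<omega>)"
proof -
  let ?good = "\<lambda>u n. time_in u UNIV (axis k (int 0)) (axis k (int (0 + n))) < c * real n"
  define P where "P u \<longleftrightarrow> (\<exists>n\<ge>1. ?good u n) \<and> \<not> (\<exists>n\<ge>1. n \<le> N \<and> ?good u n)" for u :: "(int ^ 'd) set \<Rightarrow> real"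
  let ?e = "{0 + axis k (int 0), 0 + axis k (int (Suc 0))}"
  define f where "f u = u ?e * (if P u then 1 else 0)" for u :: "(int ^ 'd) set \<Rightarrow> real"
  have [measurable]: "(\<lambda>u. time_in u V v w) \<in> borel_measurable field_space" for V v w by (rule time_in_measurable_field_space)
  have [measurable]: "(\<lambda>u. u ?e) \<in> borel_measurable field_space"
    by (intro measurable_component_singleton line_edge)
  have [measurable]: "Measurable.pred field_space P" unfolding P_def by measurable
  have f: "f \<in> borel_measurable field_space" unfolding f_def by measurable
  have "?e \<in> lattice_edges" by (rule line_edge)
  hence f_restrict: "f (restrict u lattice_edges) = f u" for u
    unfolding f_def P_def by (simp add: time_in_restrict)
  have shift: "step_time k \<omega> i * indicator (late k c N i) \<omega> = f (\<lambda>e. \<tau> ((+) (axis k (int i)) ` e) \<omega>)"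
    if \<omega>: "\<omega> \<in> space M" for \<omega> i
  proof -
    have "time_in (\<lambda>e. \<tau> ((+) (axis k (int i)) ` e) \<omega>) UNIV (axis k (int 0)) (axis k (int (0 + n))) = axis_time k \<omega> i (i + n)" for n
      unfolding axis_time_def time_in_translate[of "\<tau>' \<omega>", symmetric] by (simp add: axis_plus)
    hence "P (\<lambda>e. \<tau> ((+) (axis k (int i)) ` e) \<omega>) \<longleftrightarrow> \<omega> \<in> late k c N i"
      unfolding P_def late_def using \<omega> by simp
    moreover have "(+) (axis k (int i)) ` ?e = {0 + axis k (int i), 0 + axis k (int (Suc i))}"
      by (simp add: axis_plus add.commute)
    ultimately show ?thesis unfolding f_def step_time_def by simp
  qed
  have "expectation (\<lambda>\<omega>. step_time k \<omega> i * indicator (late k c N i) \<omega>) = expectation (\<lambda>\<omega>. f (\<tau>' \<omega>))" for i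
  proof -
    have "expectation (\<lambda>\<omega>. step_time k \<omega> i * indicator (late k c N i) \<omega>) =
        expectation (\<lambda>\<omega>. f (\<lambda>e. \<tau> ((+) (axis k (int i)) ` e) \<omega>))"
      by (intro Bochner_Integration.integral_cong refl shift)
    also have "\<dots> = integral\<^sup>L (distr M borel (\<lambda>\<omega>. f (\<lambda>e. \<tau> ((+) (axis k (int i)) ` e) \<omega>))) (\<lambda>x. x)"
      by (intro integral_distr[symmetric] translate_law f f_restrict) simp
    also have "distr M borel (\<lambda>\<omega>. f (\<lambda>e. \<tau> ((+) (axis k (int i)) ` e) \<omega>)) = distr M borel (\<lambda>\<omega>. f (\<tau>' \<omega>))"
      by (intro translate_law f f_restrict)
    also have "integral\<^sup>L \<dots> (\<lambda>x. x) = expectation (\<lambda>\<omega>. f (\<tau>' \<omega>))"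
      using translate_law(1)[OF f f_restrict, of 0] by (intro integral_distr) auto
    finally show ?thesis .
  qed
  from this[of i] this[of 0] show ?thesis by simp
qed

lemma integrable_late: "integrable M (\<lambda>\<omega>. step_time k \<omega> i * indicator (late k c N i) \<omega>)"
  by (intro integrable_real_mult_indicator late_events step_time_moments)

text \<open>For a fixed outcome, a site from which some fast jump exists is no longer late once
  \<open>N\<close> reaches the length of that jump.\<close>

lemma late_tendsto_0: "(\<lambda>N. expectation (\<lambda>\<omega>. step_time k \<omega> 0 * indicator (late k c N 0) \<omega>)) \<longlonglongrightarrow> 0"
proof -
  have "(\<lambda>N. expectation (\<lambda>\<omega>. step_time k \<omega> 0 * indicator (late k c N 0) \<omega>)) \<longlonglongrightarrow> expectation (\<lambda>\<omega>. 0)"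
  proof (rule integral_dominated_convergence[where w = "\<lambda>\<omega>. step_time k \<omega> 0"])
    show "AE \<omega> in M. (\<lambda>N. step_time k \<omega> 0 * indicator (late k c N 0) \<omega>) \<longlonglongrightarrow> 0"
    proof (rule AE_I2)
      fix \<omega>
      have "eventually (\<lambda>N. \<omega> \<notin> late k c N 0) sequentially"
      proof (cases "\<exists>n\<ge>1. axis_time k \<omega> 0 (0 + n) < c * real n")
        case True
        then obtain n where "n \<ge> 1" "axis_time k \<omega> 0 (0 + n) < c * real n" by blast
        thus ?thesis unfolding late_def eventually_sequentially by (intro exI[of _ n]) auto
      qed (auto simp: late_def)
      hence "eventually (\<lambda>N. step_time k \<omega> 0 * indicator (late k c N 0) \<omega> = 0) sequentially"
        by eventually_elim auto
      thus "(\<lambda>N. step_time k \<omega> 0 * indicator (late k c N 0) \<omega>) \<longlonglongrightarrow> 0" by (rule tendsto_eventually)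
    qed
    show "AE \<omega> in M. norm (step_time k \<omega> 0 * indicator (late k c N 0) \<omega>) \<le> step_time k \<omega> 0" for N
      using step_time_nonneg by (intro AE_I2) (auto simp: indicator_def)
  qed (use step_time_moments in auto)
  thus ?thesis by simp
qed

text \<open>Let \<open>A\<close> be the event that the time falls below \<open>c' * n\<close>
  infinitely often. The greedy chain makes the mean of the time on \<open>A\<close> at most about
  \<open>c * m * prob A\<close>, whereas \<open>mu_le\<close> and the small mean excess make it at
  least about \<open>mu k * m * prob A\<close>. As \<open>c < mu k\<close>, \<open>A\<close> is a
  null set.\<close>

lemma axis_time_lower:
  assumes c': "c' < mu k"
  shows "AE \<omega> in M. eventually (\<lambda>n. c' * real n \<le> axis_time k \<omega> 0 n) sequentially"
proof (cases "c' < 0")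
  case True
  show ?thesis
  proof (rule AE_I2, rule always_eventually, rule allI)
    fix \<omega> n assume "\<omega> \<in> space M"
    moreover have "c' * real n \<le> 0" using True by (simp add: mult_nonpos_nonneg)
    ultimately show "c' * real n \<le> axis_time k \<omega> 0 n" using axis_time_nonneg[of \<omega> k 0 n] by linarith
  qed
next
  case False
  define c where "c = (c' + mu k) / 2"
  have c: "0 \<le> c" "c' < c" "c < mu k" using False c' unfolding c_def by auto
  define A where "A = {\<omega>\<in>space M. \<forall>m. \<exists>n\<ge>m. axis_time k \<omega> 0 n < c' * real n}"
  have A [measurable]: "A \<in> events" unfolding A_def by measurable
  \<comment> \<open>The slack \<open>(c - c') * n\<close> eventually pays for the way from
    \<open>i\<close> to the origin and for the shift of the index by \<open>i\<close>; so on
    \<open>A\<close> every site, and not just the origin, has a fast jump, without any appeal to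
    ergodicity.\<close>
  have fast: "\<exists>n\<ge>1. axis_time k \<omega> i (i + n) < c * real n" if "\<omega> \<in> A" for \<omega> i
  proof -
    have \<omega>: "\<omega> \<in> space M" using that by (simp add: A_def)
    define m where "m = i + 1 + nat \<lceil>(axis_time k \<omega> i 0 + c * real i) / (c - c')\<rceil>"
    obtain n where n: "n \<ge> m" "axis_time k \<omega> 0 n < c' * real n" using \<open>\<omega> \<in> A\<close> by (auto simp: A_def)
    have "(axis_time k \<omega> i 0 + c * real i) / (c - c') \<le> real n" using n(1) unfolding m_def by linarith
    hence "axis_time k \<omega> i 0 + c * real i \<le> (c - c') * real n" using c by (simp add: field_simps)
    moreover have "axis_time k \<omega> i n \<le> axis_time k \<omega> i 0 + axis_time k \<omega> 0 n" by (rule axis_time_triangle[OF \<omega>])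
    ultimately have "axis_time k \<omega> i n < c * (real n - real i)" using n(2) by (simp add: algebra_simps)
    moreover have "n = i + (n - i)" "n - i \<ge> 1" using n(1) unfolding m_def by auto
    ultimately show ?thesis by (intro exI[of _ "n - i"]) (auto simp: of_nat_diff)
  qed
  define b where "b N = expectation (\<lambda>\<omega>. step_time k \<omega> 0 * indicator (late k c N 0) \<omega>)" for N
  have upper: "expectation (\<lambda>\<omega>. axis_time k \<omega> 0 m * indicator A \<omega>) \<le> real m * b N + c * real m * prob A + real N * momC"
    if N: "N \<le> m" for m N
  proof -
    define f1 where "f1 \<omega> = (\<Sum>i\<in>{0..<m}. step_time k \<omega> i * indicator (late k c N i) \<omega>)" for \<omega>
    define f2 where "f2 \<omega> = c * real m * indicator A \<omega>" for \<omega>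
    define f3 where "f3 \<omega> = (\<Sum>i\<in>{m - N..<m}. step_time k \<omega> i)" for \<omega>
    have int: "integrable M f1" "integrable M f2" "integrable M f3"
    proof -
      show "integrable M f1"
        unfolding f1_def by (intro Bochner_Integration.integrable_sum integrable_late)
      show "integrable M f2"
        unfolding f2_def by (intro integrable_mult_right integrable_real_indicator A) (simp add: emeasure_eq_measure)
      show "integrable M f3"
        unfolding f3_def by (intro Bochner_Integration.integrable_sum step_time_moments)
    qed
    have "expectation f1 = (\<Sum>i\<in>{0..<m}. expectation (\<lambda>\<omega>. step_time k \<omega> i * indicator (late k c N i) \<omega>))"
      unfolding f1_def by (rule Bochner_Integration.integral_sum) (rule integrable_late)
    also have "\<dots> = (\<Sum>i\<in>{0..<m}. b N)"
      unfolding b_def by (intro sum.cong refl expectation_late)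
    finally have f1: "expectation f1 = real m * b N" by simp
    have f2: "expectation f2 = c * real m * prob A"
      unfolding f2_def integral_mult_right_zero Bochner_Integration.integral_indicator using A by simp
    have "expectation f3 = (\<Sum>i\<in>{m - N..<m}. expectation (\<lambda>\<omega>. step_time k \<omega> i))"
      unfolding f3_def by (rule Bochner_Integration.integral_sum) (rule step_time_moments)
    also have "\<dots> \<le> (\<Sum>i\<in>{m - N..<m}. momC)" by (intro sum_mono step_time_moments)
    also have "\<dots> = real N * momC" using N by simp
    finally have f3: "expectation f3 \<le> real N * momC" .
    have "expectation (\<lambda>\<omega>. axis_time k \<omega> 0 m * indicator A \<omega>) \<le> expectation (\<lambda>\<omega>. f1 \<omega> + f2 \<omega> + f3 \<omega>)"
    proof (rule integral_mono)
      show "integrable M (\<lambda>\<omega>. axis_time k \<omega> 0 m * indicator A \<omega>)"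
        by (rule integrable_real_mult_indicator[OF A integrable_axis_time])
      show "integrable M (\<lambda>\<omega>. f1 \<omega> + f2 \<omega> + f3 \<omega>)"
        by (intro Bochner_Integration.integrable_add int)
      fix \<omega> assume \<omega>: "\<omega> \<in> space M"
      show "axis_time k \<omega> 0 m * indicator A \<omega> \<le> f1 \<omega> + f2 \<omega> + f3 \<omega>"
      proof (cases "\<omega> \<in> A")
        case True
        from greedy_bound[OF \<omega> c(1) fast[OF True] N, of m]
        have "axis_time k \<omega> 0 m \<le> f1 \<omega> + c * real m + f3 \<omega>" by (simp add: f1_def f3_def)
        thus ?thesis using True by (simp add: f2_def)
      next
        case False
        have "0 \<le> f1 \<omega>" unfolding f1_def by (intro sum_nonneg mult_nonneg_nonneg step_time_nonneg \<omega>) simp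
        moreover have "0 \<le> f3 \<omega>" unfolding f3_def by (intro sum_nonneg step_time_nonneg \<omega>)
        ultimately show ?thesis using False by (simp add: f2_def)
      qed
    qed
    also have "\<dots> = expectation f1 + expectation f2 + expectation f3" using int by simp
    finally show ?thesis using f1 f2 f3 by linarith
  qed
  \<comment> \<open>The whole mean is at least \<open>mu k * m\<close>; off \<open>A\<close> the
    time is at most \<open>mu k * m\<close> plus its excess, and the remainder must come from
    \<open>A\<close>.\<close>
  have lower: "mu k * real m * prob A - expectation (\<lambda>\<omega>. max 0 (axis_time k \<omega> 0 m - mu k * real m)) \<le>
      expectation (\<lambda>\<omega>. axis_time k \<omega> 0 m * indicator A \<omega>)" for m
  proof -
    define x where "x = mu k * real m"
    define f1 where "f1 \<omega> = axis_time k \<omega> 0 m * indicator A \<omega>" for \<omega>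
    define f2 where "f2 \<omega> = x * indicator (space M - A) \<omega>" for \<omega>
    define f3 where "f3 \<omega> = max 0 (axis_time k \<omega> 0 m - x)" for \<omega>
    have int: "integrable M f1" "integrable M f2" "integrable M f3"
    proof -
      show "integrable M f1"
        unfolding f1_def by (rule integrable_real_mult_indicator[OF A integrable_axis_time])
      show "integrable M f2"
        unfolding f2_def by (intro integrable_mult_right integrable_real_indicator) (simp_all add: emeasure_eq_measure)
      show "integrable M f3"
        unfolding f3_def by (intro integrable_max Bochner_Integration.integrable_diff integrable_const integrable_axis_time)
    qed
    have f2: "expectation f2 = x * (1 - prob A)"
      unfolding f2_def integral_mult_right_zero Bochner_Integration.integral_indicator
      using prob_compl[OF A] by (simp add: Int_absorb2)
    have "x \<le> expectation (\<lambda>\<omega>. axis_time k \<omega> 0 m)" using mu_le[of k m] by (simp add: expectation_axis_time x_def)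
    also have "\<dots> \<le> expectation (\<lambda>\<omega>. f1 \<omega> + f2 \<omega> + f3 \<omega>)"
    proof (rule integral_mono[OF integrable_axis_time])
      show "integrable M (\<lambda>\<omega>. f1 \<omega> + f2 \<omega> + f3 \<omega>)"
        by (intro Bochner_Integration.integrable_add int)
      show "axis_time k \<omega> 0 m \<le> f1 \<omega> + f2 \<omega> + f3 \<omega>" if "\<omega> \<in> space M" for \<omega>
        using that by (cases "\<omega> \<in> A") (simp_all add: f1_def f2_def f3_def)
    qed
    also have "\<dots> = expectation f1 + expectation f2 + expectation f3" using int by simp
    finally have "x \<le> expectation f1 + x * (1 - prob A) + expectation f3" unfolding f2 .
    hence "x * prob A - expectation f3 \<le> expectation f1" by (simp add: algebra_simps)
    thus ?thesis by (simp add: x_def f1_def[abs_def] f3_def[abs_def])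
  qed
  \<comment> \<open>Both bounds are divided by \<open>m\<close>, which tends to infinity while
    \<open>N\<close> is fixed; only afterwards is \<open>N\<close> chosen large to make
    \<open>b N\<close> small.\<close>
  have main: "(mu k - c) * prob A \<le> b N + \<epsilon>" if \<epsilon>: "\<epsilon> > 0" for N \<epsilon>
  proof -
    have "eventually (\<lambda>m. N \<le> m \<and> 1 \<le> m \<and> real N * momC / (\<epsilon> / 2) \<le> real m) sequentially"
      using filterlim_real_sequentially
      by (intro eventually_conj eventually_ge_at_top) (simp add: filterlim_at_top)
    moreover have "eventually (\<lambda>n. expectation (\<lambda>\<omega>. max 0 (axis_time k \<omega> 0 n - mu k * real n)) \<le> \<epsilon> / 2 * real n) sequentially"
      using \<epsilon> by (intro axis_time_excess) simp
    ultimately have "eventually (\<lambda>m. (mu k - c) * prob A \<le> b N + \<epsilon>) sequentially"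
    proof eventually_elim
      case (elim m)
      have "mu k * real m * prob A - \<epsilon> / 2 * real m \<le> real m * b N + c * real m * prob A + real N * momC"
        using lower[of m] upper[of N m] elim by linarith
      moreover have "real N * momC \<le> \<epsilon> / 2 * real m" using elim \<epsilon> by (simp add: field_simps)
      ultimately have "real m * ((mu k - c) * prob A) \<le> real m * (b N + \<epsilon>)"
        by (simp add: algebra_simps)
      thus ?case using elim by simp
    qed
    thus ?thesis by simp
  qed
  have "(mu k - c) * prob A \<le> 0"
  proof (rule field_le_epsilon)
    fix \<epsilon> :: real assume \<epsilon>: "\<epsilon> > 0"
    have "b \<longlonglongrightarrow> 0" unfolding b_def by (rule late_tendsto_0)
    from order_tendstoD(2)[OF this, of "\<epsilon> / 2"] \<epsilon> obtain N where "b N < \<epsilon> / 2"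
      by (auto simp: eventually_sequentially)
    thus "(mu k - c) * prob A \<le> 0 + \<epsilon>" using main[of "\<epsilon> / 2" N] \<epsilon> by linarith
  qed
  hence "prob A = 0" using c(3) measure_nonneg[of M A] by (simp add: mult_le_0_iff)
  hence "AE \<omega> in M. \<omega> \<notin> A" using A by (simp add: prob_eq_0)
  thus ?thesis
  proof (rule AE_mp, intro AE_I2 impI)
    fix \<omega> assume "\<omega> \<in> space M" "\<omega> \<notin> A"
    thus "eventually (\<lambda>n. c' * real n \<le> axis_time k \<omega> 0 n) sequentially"
      unfolding A_def eventually_sequentially by (auto simp: not_less)
  qed
qed

lemma axis_time_tendsto: "AE \<omega> in M. (\<lambda>n. axis_time k \<omega> 0 n / real n) \<longlonglongrightarrow> mu k"
proof -
  have "AE \<omega> in M. \<forall>j. eventually (\<lambda>n. axis_time k \<omega> 0 n \<le> (mu k + 1 / real (Suc j)) * real n) sequentially"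
    by (subst AE_all_countable) (auto intro!: axis_time_upper)
  moreover have "AE \<omega> in M. \<forall>j. eventually (\<lambda>n. (mu k - 1 / real (Suc j)) * real n \<le> axis_time k \<omega> 0 n) sequentially"
    by (subst AE_all_countable) (auto intro!: axis_time_lower)
  ultimately show ?thesis
  proof eventually_elim
    case (elim \<omega>)
    show ?case
    proof (rule tendstoI)
      fix e :: real assume "e > 0"
      then obtain j where j: "1 / real (Suc j) < e" using nat_approx_posE by metis
      have "eventually (\<lambda>n. n \<ge> 1) sequentially" by (rule eventually_ge_at_top)
      with elim(1)[rule_format, of j] elim(2)[rule_format, of j]
      show "eventually (\<lambda>n. dist (axis_time k \<omega> 0 n / real n) (mu k) < e) sequentially"
      proof eventually_elim
        case (elim n)
        hence "axis_time k \<omega> 0 n / real n \<le> mu k + 1 / real (Suc j)" "mu k - 1 / real (Suc j) \<le> axis_time k \<omega> 0 n / real n"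
          by (simp_all add: pos_divide_le_eq pos_le_divide_eq)
        thus ?case using j by (simp add: dist_real_def)
      qed
    qed
  qed
qed

section \<open>Real times and the identification of the time constant\<close>

lemma fp_time_eq_axis_time:
  assumes \<omega>: "\<omega> \<in> space M" and t: "0 \<le> t"
  shows "fp_time (\<tau>' \<omega>) 0 (t *\<^sub>R axis k 1) = ereal (axis_time k \<omega> 0 (nat \<lfloor>t\<rfloor>))"
proof -
  have fl: "floor_vec (0 :: real ^ 'd) = axis k (int 0)" "floor_vec (t *\<^sub>R axis k 1) = axis k (int (nat \<lfloor>t\<rfloor>))"
    using t by (auto simp: floor_vec_def vec_eq_iff axis_def)
  let ?P = "lattice_paths (axis k (int 0)) (axis k (int (nat \<lfloor>t\<rfloor>))) :: (int ^ 'd) list set"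
  have P: "paths_in UNIV (axis k (int 0)) (axis k (int (nat \<lfloor>t\<rfloor>))) = ?P" by (simp add: paths_in_def)
  have "?P \<noteq> {}" using axis_paths[of k 0 "nat \<lfloor>t\<rfloor>"] unfolding P .
  moreover have "bdd_below (passage_time (\<tau>' \<omega>) ` ?P)"
    using bdd_below_passage_times[OF edge_nonneg_\<tau>[OF \<omega>], of UNIV "axis k (int 0)" "axis k (int (nat \<lfloor>t\<rfloor>))"]
    unfolding P .
  ultimately have "ereal (Inf (passage_time (\<tau>' \<omega>) ` ?P)) = (INF a\<in>passage_time (\<tau>' \<omega>) ` ?P. ereal a)"
    by (intro ereal_Inf') auto
  thus ?thesis unfolding fp_time_def fl axis_time_def time_in_def P by (simp add: image_image)
qed

lemma fp_time_tendsto: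
  "AE \<omega> in M. ((\<lambda>t. fp_time (\<tau>' \<omega>) 0 (t *\<^sub>R axis k 1) / ereal t) \<longlongrightarrow> ereal (mu k)) at_top"
  using axis_time_tendsto[of k] AE_space
proof eventually_elim
  case (elim \<omega>)
  have fl: "filterlim (\<lambda>t :: real. nat \<lfloor>t\<rfloor>) sequentially at_top"
    by (rule filterlim_compose[OF filterlim_nat_sequentially filterlim_floor_sequentially])
  have "((\<lambda>t :: real. axis_time k \<omega> 0 (nat \<lfloor>t\<rfloor>) / real (nat \<lfloor>t\<rfloor>)) \<longlongrightarrow> mu k) at_top"
    using filterlim_compose[OF elim(1) fl] by simp
  moreover have "((\<lambda>t :: real. real (nat \<lfloor>t\<rfloor>) / t) \<longlongrightarrow> 1) at_top" by real_asymp
  ultimately have "((\<lambda>t. axis_time k \<omega> 0 (nat \<lfloor>t\<rfloor>) / real (nat \<lfloor>t\<rfloor>) * (real (nat \<lfloor>t\<rfloor>) / t)) \<longlongrightarrow> mu k * 1) at_top"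
    by (rule tendsto_mult)
  moreover have "eventually (\<lambda>t. axis_time k \<omega> 0 (nat \<lfloor>t\<rfloor>) / real (nat \<lfloor>t\<rfloor>) * (real (nat \<lfloor>t\<rfloor>) / t) = axis_time k \<omega> 0 (nat \<lfloor>t\<rfloor>) / t) at_top"
    using eventually_ge_at_top[of "1 :: real"]
  proof eventually_elim
    case (elim t)
    have cancel: "b \<noteq> 0 \<Longrightarrow> a / b * (b / t) = a / t" for a b :: real by simp
    have "real (nat \<lfloor>t\<rfloor>) \<noteq> 0" using elim by linarith
    thus ?case by (rule cancel)
  qed
  ultimately have "((\<lambda>t. axis_time k \<omega> 0 (nat \<lfloor>t\<rfloor>) / t) \<longlongrightarrow> mu k * 1) at_top"
    by (rule Lim_transform_eventually)
  hence "((\<lambda>t. ereal (axis_time k \<omega> 0 (nat \<lfloor>t\<rfloor>) / t)) \<longlongrightarrow> ereal (mu k)) at_top" by simp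
  moreover have "eventually (\<lambda>t. ereal (axis_time k \<omega> 0 (nat \<lfloor>t\<rfloor>) / t) = fp_time (\<tau>' \<omega>) 0 (t *\<^sub>R axis k 1) / ereal t) at_top"
    using eventually_ge_at_top[of "1 :: real"]
    by eventually_elim (simp add: fp_time_eq_axis_time[OF elim(2)])
  ultimately show ?case by (rule Lim_transform_eventually)
qed

text \<open>The definite description also needs uniqueness: two almost sure limits agree on an event
  of probability one, hence as numbers.\<close>

lemma time_constant_eq: "time_constant M \<tau> (axis k 1) = mu k"
  unfolding time_constant_def
proof (rule the_equality)
  show "AE \<omega> in M. ((\<lambda>t. fp_time (\<lambda>e. \<tau> e \<omega>) 0 (t *\<^sub>R axis k 1) / ereal t) \<longlongrightarrow> ereal (mu k)) at_top"
    by (rule fp_time_tendsto)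
  fix m assume "AE \<omega> in M. ((\<lambda>t. fp_time (\<lambda>e. \<tau> e \<omega>) 0 (t *\<^sub>R axis k 1) / ereal t) \<longlongrightarrow> ereal m) at_top"
  with fp_time_tendsto[of k] have "AE \<omega> in M. m = mu k"
  proof eventually_elim
    case (elim \<omega>)
    from tendsto_unique[OF _ elim(2) elim(1)] show ?case by simp
  qed
  thus "m = mu k" by simp
qed

end

subsection \<open>The upper tail bound\<close>

context fpp
begin

text \<open>Otherwise almost surely every edge would cost more than \<open>mu k + \<xi>\<close>. A
  path to distance \<open>n\<close> has at least \<open>n\<close> distinct edges, so all normalised
  means would be at least \<open>mu k + \<xi>\<close>, against \<open>mu_approx\<close>.\<close>

lemma prob_\<tau>_le_pos:
  assumes \<xi>: "\<xi> > 0" and e: "e \<in> lattice_edges"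
  shows "0 < prob {\<omega>\<in>space M. \<tau> e \<omega> \<le> mu k + \<xi>}"
proof (rule ccontr)
  assume "\<not> ?thesis"
  hence 0: "prob {\<omega>\<in>space M. \<tau> e \<omega> \<le> mu k + \<xi>} = 0"
    using measure_nonneg[of M "{\<omega>\<in>space M. \<tau> e \<omega> \<le> mu k + \<xi>}"] by linarith
  have "AE \<omega> in M. mu k + \<xi> < \<tau> e' \<omega>" if e': "e' \<in> lattice_edges" for e'
  proof -
    have eq: "prob {\<omega>\<in>space M. \<tau> e \<omega> \<le> mu k + \<xi>} = measure (distr M borel (\<tau> e)) {..mu k + \<xi>}"
      if "e \<in> lattice_edges" for e
      using that by (subst measure_distr) (auto intro!: arg_cong[of _ _ "measure M"])
    have "prob {\<omega>\<in>space M. \<tau> e' \<omega> \<le> mu k + \<xi>} = 0"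
      using 0 unfolding eq[OF e] eq[OF e'] ident[OF e' e] .
    hence "AE \<omega> in M. \<omega> \<notin> {\<omega>\<in>space M. \<tau> e' \<omega> \<le> mu k + \<xi>}"
      using e' by (subst (asm) prob_eq_0) measurable
    thus ?thesis by (rule AE_mp) (intro AE_I2, auto)
  qed
  hence "AE \<omega> in M. \<forall>e\<in>lattice_edges. mu k + \<xi> < \<tau> e \<omega>"
    by (subst AE_ball_countable) auto
  hence *: "AE \<omega> in M. (mu k + \<xi>) * real n \<le> axis_time k \<omega> 0 n" for n
  proof (rule AE_mp, intro AE_I2 impI)
    fix \<omega> assume \<omega>: "\<omega> \<in> space M" and big: "\<forall>e\<in>lattice_edges. mu k + \<xi> < \<tau> e \<omega>"
    show "(mu k + \<xi>) * real n \<le> axis_time k \<omega> 0 n"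
      unfolding axis_time_def time_in_def
    proof (rule cINF_greatest[OF axis_paths])
      fix xs :: "(int ^ 'd) list" assume "xs \<in> paths_in UNIV (axis k (int 0)) (axis k (int n))"
      hence xs: "xs \<in> lattice_paths (axis k (int 0)) (axis k (int n))" by (simp add: paths_in_def)
      have "n \<le> card (path_edges xs)"
        using card_path_edges_ge[OF xs, of k] by (simp add: axis_def)
      hence "(mu k + \<xi>) * real n \<le> (mu k + \<xi>) * real (card (path_edges xs))"
        using mu_nonneg[of k] \<xi> by (intro mult_left_mono) auto
      also have "\<dots> = (\<Sum>e\<in>path_edges xs. mu k + \<xi>)" by simp
      also have "\<dots> \<le> passage_time (\<tau>' \<omega>) xs"
        unfolding passage_time_def using big path_edges_lattice[OF xs]
        by (intro sum_mono) (auto intro: less_imp_le)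
      finally show "(mu k + \<xi>) * real n \<le> passage_time (\<tau>' \<omega>) xs" .
    qed
  qed
  obtain L where L: "L \<ge> 1" "mean_time k L < (mu k + \<xi>) * real L" using mu_approx[OF \<xi>] by blast
  have "expectation (\<lambda>\<omega>. (mu k + \<xi>) * real L) \<le> expectation (\<lambda>\<omega>. axis_time k \<omega> 0 L)"
    by (intro integral_mono_AE integrable_axis_time *) simp
  thus False using L by (simp add: expectation_axis_time prob_space)
qed

text \<open>With probability \<open>p ^ n\<close> all edges of the straight segment cost at most
  \<open>mu k + \<xi> / 2\<close>. Halving \<open>\<xi>\<close> makes the segment strictly faster
  than the threshold.\<close>

lemma upper_tail_less_1:
  assumes \<xi>: "\<xi> > 0"
  shows "\<exists>p. 0 < p \<and> p \<le> 1 \<and> (\<forall>n\<ge>1. \<forall>N\<ge>real n.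
    prob {\<omega>\<in>space M. (mu k + \<xi>) * N \<le> time_in (\<tau>' \<omega>) (lattice_box n) 0 (axis k (int n))} \<le> 1 - p ^ n)"
proof -
  let ?e = "\<lambda>j. {0 + axis k (int j), 0 + axis k (int (Suc j))} :: (int ^ 'd) set"
  define p where "p = measure (distr M borel (\<tau> (?e 0))) {..mu k + \<xi> / 2}"
  have p_eq: "prob (\<tau> (?e j) -` {..mu k + \<xi> / 2} \<inter> space M) = p" for j
  proof -
    have "p = measure (distr M borel (\<tau> (?e j))) {..mu k + \<xi> / 2}"
      unfolding p_def
      by (rule arg_cong[OF ident[OF line_edge line_edge], of "\<lambda>D. measure D {..mu k + \<xi> / 2}"])
    also have "\<dots> = prob (\<tau> (?e j) -` {..mu k + \<xi> / 2} \<inter> space M)"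
      by (intro measure_distr \<tau>_measurable line_edge) simp
    finally show ?thesis by simp
  qed
  have "\<tau> (?e 0) -` {..mu k + \<xi> / 2} \<inter> space M = {\<omega>\<in>space M. \<tau> (?e 0) \<omega> \<le> mu k + \<xi> / 2}" by auto
  hence "p > 0" using prob_\<tau>_le_pos[of "\<xi> / 2" "?e 0" k] \<xi> line_edge[of 0 k 0] p_eq[of 0] by simp
  moreover have "p \<le> 1" unfolding p_eq[of 0, symmetric] by (rule prob_le_1)
  moreover have "prob {\<omega>\<in>space M. (mu k + \<xi>) * N \<le> time_in (\<tau>' \<omega>) (lattice_box n) 0 (axis k (int n))} \<le> 1 - p ^ n"
    if n: "n \<ge> 1" and N: "N \<ge> real n" for n N
  proof -
    note ind = indep_line[of 0 k n]
    let ?G = "\<Inter>j\<in>{..<n}. \<tau> (?e j) -` {..mu k + \<xi> / 2} \<inter> space M"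
    have "prob ?G = (\<Prod>j\<in>{..<n}. prob (\<tau> (?e j) -` {..mu k + \<xi> / 2} \<inter> space M))"
      using n by (intro indep_varsD_finite[OF ind]) (auto simp: lessThan_empty_iff)
    also have "\<dots> = p ^ n" by (simp only: p_eq prod_constant card_lessThan)
    finally have G: "prob ?G = p ^ n" .
    have G_ev: "?G \<in> events"
    proof (intro sets.finite_INT)
      show "\<tau> (?e j) -` {..mu k + \<xi> / 2} \<inter> space M \<in> events" for j
        by (intro measurable_sets[OF \<tau>_measurable[OF line_edge]]) simp
    qed (use n in \<open>auto simp: lessThan_empty_iff\<close>)
    have "prob {\<omega>\<in>space M. (mu k + \<xi>) * N \<le> time_in (\<tau>' \<omega>) (lattice_box n) 0 (axis k (int n))} \<le> prob (space M - ?G)"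
    proof (intro finite_measure_mono subsetI)
      fix \<omega> assume "\<omega> \<in> {\<omega>\<in>space M. (mu k + \<xi>) * N \<le> time_in (\<tau>' \<omega>) (lattice_box n) 0 (axis k (int n))}"
      hence \<omega>: "\<omega> \<in> space M" "(mu k + \<xi>) * N \<le> time_in (\<tau>' \<omega>) (lattice_box n) 0 (axis k (int n))" by auto
      have "\<omega> \<notin> ?G"
      proof
        assume "\<omega> \<in> ?G"
        have le: "\<tau> (?e j) \<omega> \<le> mu k + \<xi> / 2" if "j < n" for j
        proof -
          have "\<omega> \<in> \<tau> (?e j) -` {..mu k + \<xi> / 2} \<inter> space M" using \<open>\<omega> \<in> ?G\<close> that by blast
          thus ?thesis by simp
        qed
        have "time_in (\<tau>' \<omega>) (lattice_box n) 0 (0 + axis k (int n)) \<le> line_time \<omega> 0 k n"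
          by (rule time_in_le_line_time[OF \<omega>(1)]) (auto simp: lattice_box_def axis_def)
        also have "\<dots> \<le> (\<Sum>j<n. mu k + \<xi> / 2)"
          unfolding line_time_def by (intro sum_mono le) simp
        also have "\<dots> = (mu k + \<xi> / 2) * real n" by simp
        also have "\<dots> < (mu k + \<xi>) * real n" using n \<xi> by simp
        also have "\<dots> \<le> (mu k + \<xi>) * N" using N mu_nonneg[of k] \<xi> by (intro mult_left_mono) auto
        finally show False using \<omega>(2) by simp
      qed
      thus "\<omega> \<in> space M - ?G" using \<omega> by blast
    qed (use G_ev in auto)
    also have "\<dots> = 1 - p ^ n" using prob_compl[OF G_ev] G by simp
    finally show ?thesis .
  qed
  ultimately show ?thesis by blast
qed

text \<open>For \<open>N\<close> up to \<open>K * n\<close> the rate at \<open>N\<close> is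
  comparable to the rate at \<open>n\<close>, so the estimate at \<open>N = n\<close> covers this
  whole range.\<close>

lemma rate_g_le_near:
  assumes n: "n \<ge> 1" and K: "K \<ge> 1" and N: "0 < N" "N \<le> K * real n"
  shows "rate_g CARD('d) r n N \<le> K powr r * rate_g CARD('d) r n (real n)"
    and "rate_g CARD('d) r n N \<le> (K * real n) powr r"
proof -
  have s: "slowdown CARD('d) r n \<ge> 1" by (rule slowdown_ge_1[OF n])
  have Np: "N powr r \<le> (K * real n) powr r" using N r_gt_1 by (intro powr_mono2) auto
  hence "N powr r / slowdown CARD('d) r n \<le> K powr r * real n powr r / slowdown CARD('d) r n"
    using s K by (intro divide_right_mono) (auto simp: powr_mult)
  thus "rate_g CARD('d) r n N \<le> K powr r * rate_g CARD('d) r n (real n)"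
    using N n by (simp add: rate_g_eq)
  have "N powr r / slowdown CARD('d) r n \<le> N powr r / 1"
    using s by (intro divide_left_mono) auto
  thus "rate_g CARD('d) r n N \<le> (K * real n) powr r" using Np N by (simp add: rate_g_eq)
qed

text \<open>A large rate absorbs the factors left by the far and near estimates. A bounded rate
  bounds \<open>n\<close>, and then \<open>1 - p ^ n\<close> lies uniformly below 1.\<close>

lemma upper_tail:
  assumes \<xi>: "\<xi> > 0"
  shows "\<exists>c>0. \<forall>n\<ge>1. \<forall>N\<ge>real n.
    prob {\<omega>\<in>space M. (mu k + \<xi>) * N \<le> time_in (\<tau>' \<omega>) (lattice_box n) 0 (axis k (int n))} \<le> exp (- c * rate_g CARD('d) r n N)"
proof -
  let ?P = "\<lambda>n N. prob {\<omega>\<in>space M. (mu k + \<xi>) * N \<le> time_in (\<tau>' \<omega>) (lattice_box n) 0 (axis k (int n))}"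
  let ?g = "rate_g CARD('d) r"
  obtain K1 c1 where K1: "K1 \<ge> 1" and c1: "c1 > 0" and far: "\<forall>n\<ge>1. \<forall>N\<ge>K1 * real n.
    prob {\<omega>\<in>space M. \<xi> * N \<le> time_in (\<tau>' \<omega>) (lattice_box n) 0 (axis k (int n))} \<le> 3 * exp (- c1 * ?g n N)"
    using upper_tail_far[OF \<xi>, of k] by (elim exE conjE) (rule that)
  obtain n0 c2 K2 where c2: "c2 > 0" and K2: "K2 > 0" and near: "\<forall>n\<ge>n0. 1 \<le> n \<longrightarrow>
      ?P n (real n) \<le> K2 * exp (- c2 * ?g n (real n))"
    using upper_tail_near[OF \<xi>, of k] by (elim exE conjE) (rule that)
  obtain p where p: "0 < p" "p \<le> 1" and less: "\<forall>n\<ge>1. \<forall>N\<ge>real n. ?P n N \<le> 1 - p ^ n"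
    using upper_tail_less_1[OF \<xi>, of k] by (elim exE conjE) (rule that)
  define K where "K = max 3 K2"
  define c where "c = min c1 (c2 / K1 powr r)"
  have c: "c > 0" unfolding c_def using c1 c2 K1 by simp
  have K: "K \<ge> 3" "K \<ge> K2" unfolding K_def by auto
  have lnK: "ln K > 0" using K by simp
  \<comment> \<open>Above the first entry, half of the exponent absorbs the factor \<open>K\<close>.
    The second entry ensures \<open>n >= n0\<close> whenever \<open>N <= K1 * n\<close> and the rate
    exceeds \<open>G\<close>.\<close>
  define G where "G = max (2 * ln K / c) ((K1 * real n0) powr r)"
  have G: "G > 0" unfolding G_def using c lnK by (simp add: less_max_iff_disj)
  define m where "m = n0 + nat \<lceil>G\<rceil>"
  \<comment> \<open>The first entry is for rates above \<open>G\<close>, the second for rates up to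
    \<open>G\<close>, where \<open>1 - p ^ m\<close> is at most
    \<open>exp (- (p ^ m))\<close>.\<close>
  define c' where "c' = min (c / 2) (p ^ m / G)"
  have c': "c' > 0" unfolding c'_def using c p G by simp
  have "?P n N \<le> exp (- c' * ?g n N)" if n: "n \<ge> 1" and N: "N \<ge> real n" for n N
  proof -
    have Npos: "N > 0" using n N by linarith
    have gn: "real n \<le> ?g n N" using n N r_gt_1 by (intro rate_g_ge_n) (auto simp: Suc_le_eq)
    have g0: "?g n N \<ge> 0" using gn by linarith
    show ?thesis
    proof (cases "?g n N \<le> G \<and> n \<le> m")
      case True
      have "?P n N \<le> 1 - p ^ n" using less n N by blast
      also have "\<dots> \<le> 1 - p ^ m" using True p by (simp add: power_decreasing)
      also have "\<dots> \<le> exp (- (p ^ m))" using exp_ge_add_one_self[of "- (p ^ m)"] by simp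
      also have "p ^ m \<ge> c' * ?g n N"
      proof -
        have "c' * ?g n N \<le> (p ^ m / G) * G"
          unfolding c'_def using True g0 p G by (intro mult_mono) auto
        thus ?thesis using G by simp
      qed
      hence "exp (- (p ^ m)) \<le> exp (- c' * ?g n N)" by simp
      finally show ?thesis .
    next
      case False
      have big: "?g n N > G"
      proof (rule ccontr)
        assume "\<not> ?thesis"
        hence "?g n N \<le> G" by simp
        moreover have "n \<le> m" using gn calculation unfolding m_def by linarith
        ultimately show False using False by blast
      qed
      have "?P n N \<le> K * exp (- c * ?g n N)"
      proof (cases "N \<ge> K1 * real n")
        case True
        have "?P n N \<le> prob {\<omega>\<in>space M. \<xi> * N \<le> time_in (\<tau>' \<omega>) (lattice_box n) 0 (axis k (int n))}"
        proof (intro finite_measure_mono subsetI)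
          have "\<xi> * N \<le> (mu k + \<xi>) * N" using mu_nonneg[of k] Npos by (intro mult_right_mono) auto
          thus "\<omega> \<in> {\<omega>\<in>space M. \<xi> * N \<le> time_in (\<tau>' \<omega>) (lattice_box n) 0 (axis k (int n))}"
            if "\<omega> \<in> {\<omega>\<in>space M. (mu k + \<xi>) * N \<le> time_in (\<tau>' \<omega>) (lattice_box n) 0 (axis k (int n))}" for \<omega>
            using that by auto
        qed measurable
        also have "\<dots> \<le> 3 * exp (- c1 * ?g n N)" using far n True by blast
        also have "\<dots> \<le> K * exp (- c * ?g n N)"
          using K g0 c1 by (intro mult_mono exp_rate_mono) (auto simp: c_def)
        finally show ?thesis .
      next
        case False
        hence NK: "N \<le> K1 * real n" by simp
        have "n \<ge> n0"
        proof (rule ccontr)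
          assume "\<not> n \<ge> n0"
          hence "(K1 * real n) powr r \<le> (K1 * real n0) powr r"
            using K1 r_gt_1 by (intro powr_mono2 mult_left_mono) auto
          also have "\<dots> \<le> G" by (simp add: G_def)
          finally show False using rate_g_le_near(2)[OF n K1 Npos NK] big by linarith
        qed
        have "?P n N \<le> ?P n (real n)"
        proof (intro finite_measure_mono subsetI)
          have "(mu k + \<xi>) * real n \<le> (mu k + \<xi>) * N" using mu_nonneg[of k] \<xi> N by (intro mult_left_mono) auto
          thus "\<omega> \<in> {\<omega>\<in>space M. (mu k + \<xi>) * real n \<le> time_in (\<tau>' \<omega>) (lattice_box n) 0 (axis k (int n))}"
            if "\<omega> \<in> {\<omega>\<in>space M. (mu k + \<xi>) * N \<le> time_in (\<tau>' \<omega>) (lattice_box n) 0 (axis k (int n))}" for \<omega>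
            using that by auto
        qed measurable
        also have "\<dots> \<le> K2 * exp (- c2 * ?g n (real n))" using near n \<open>n \<ge> n0\<close> by blast
        also have "\<dots> \<le> K * exp (- c * ?g n N)"
        proof (intro mult_mono)
          have "c * ?g n N \<le> (c2 / K1 powr r) * (K1 powr r * ?g n (real n))"
            using rate_g_le_near(1)[OF n K1 Npos NK] g0 c2 by (intro mult_mono) (auto simp: c_def)
          also have "\<dots> = c2 * ?g n (real n)" using K1 by simp
          finally show "exp (- c2 * ?g n (real n)) \<le> exp (- c * ?g n N)" by simp
        qed (use K K2 in auto)
        finally show ?thesis .
      qed
      also have "K * exp (- c * ?g n N) = exp (ln K - c * ?g n N)"
        using K by (simp add: exp_diff exp_minus field_simps)
      also have "\<dots> \<le> exp (- c' * ?g n N)"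
      proof -
        have "2 * ln K / c \<le> ?g n N" using big unfolding G_def by linarith
        hence "ln K \<le> c / 2 * ?g n N" using c by (simp add: field_simps)
        moreover have "c' * ?g n N \<le> c / 2 * ?g n N" unfolding c'_def by (rule mult_right_mono[OF min.cobounded1 g0])
        ultimately show ?thesis by simp
      qed
      finally show ?thesis .
    qed
  qed
  thus ?thesis using c' by blast
qed

end

theorem theorem1p11:
  fixes M :: "'a measure"
    and \<tau> :: "(int ^ 'd) set \<Rightarrow> 'a \<Rightarrow> real"
    and k :: "'d::finite"
    and r \<alpha> \<beta> :: real
  assumes "prob_space M"
    and "prob_space.indep_vars M (\<lambda>_. borel) \<tau> lattice_edges"
    and "\<And>e e'. e \<in> lattice_edges \<Longrightarrow> e' \<in> lattice_edges \<Longrightarrow>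
           distr M borel (\<tau> e) = distr M borel (\<tau> e')"
    and "\<And>e \<omega>. e \<in> lattice_edges \<Longrightarrow> \<omega> \<in> space M \<Longrightarrow> 0 \<le> \<tau> e \<omega>"
    and "r > 1" and "\<alpha> > 0" and "\<beta> > 0"
    and "\<And>e t. e \<in> lattice_edges \<Longrightarrow> 0 \<le> t \<Longrightarrow>
           measure M {\<omega> \<in> space M. \<tau> e \<omega> \<ge> t} \<le> \<beta> * exp (- \<alpha> * t powr r)"
  shows "\<forall>\<xi>>0. \<exists>c>0. \<forall>n\<ge>1. \<forall>N\<ge>real n.
    measure M {\<omega> \<in> space M.
        restricted_fp_time {y. \<forall>i. 0 \<le> y $ i \<and> y $ i \<le> real n} (\<lambda>e. \<tau> e \<omega>) 0 (axis k (int n))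
          > ereal ((time_constant M \<tau> (axis k 1) + \<xi>) * N)}
      \<le> exp (- c * rate_g CARD('d) r n N)"
proof (intro allI impI)
  interpret prob_space M by (rule assms(1))
  interpret fpp M \<tau> r \<alpha> \<beta> by (intro fpp.intro fpp_axioms.intro assms)
  fix \<xi> :: real assume \<xi>: "\<xi> > 0"
  let ?T = "\<lambda>n \<omega>. restricted_fp_time {y. \<forall>i. 0 \<le> y $ i \<and> y $ i \<le> real n} (\<lambda>e. \<tau> e \<omega>) 0 (axis k (int n))"
  let ?a = "\<lambda>N. (time_constant M \<tau> (axis k 1) + \<xi>) * N"
  obtain c where c: "c > 0" and *: "\<forall>n\<ge>1. \<forall>N\<ge>real n.
      prob {\<omega>\<in>space M. (mu k + \<xi>) * N \<le> time_in (\<lambda>e. \<tau> e \<omega>) (lattice_box n) 0 (axis k (int n))} \<le> exp (- c * rate_g CARD('d) r n N)"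
    using upper_tail[OF \<xi>, of k] by (elim exE conjE) (rule that)
  have "prob {\<omega> \<in> space M. ?T n \<omega> > ereal (?a N)} \<le> exp (- c * rate_g CARD('d) r n N)"
    if n: "n \<ge> 1" and N: "N \<ge> real n" for n N
  proof -
    have "prob {\<omega> \<in> space M. ?T n \<omega> > ereal (?a N)} \<le>
        prob {\<omega>\<in>space M. (mu k + \<xi>) * N \<le> time_in (\<lambda>e. \<tau> e \<omega>) (lattice_box n) 0 (axis k (int n))}"
    \<comment> \<open>Monotonicity of the measure calls for measurability of the larger event, the
      one that involves \<open>time_in\<close>.\<close>
    proof (intro finite_measure_mono subsetI)
      fix \<omega> assume "\<omega> \<in> {\<omega> \<in> space M. ?T n \<omega> > ereal (?a N)}"
      hence \<omega>: "\<omega> \<in> space M" "?T n \<omega> > ereal (?a N)" by auto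
      have "?a N \<le> time_in (\<lambda>e. \<tau> e \<omega>) (lattice_box n) 0 (axis k (int n))"
        by (rule restricted_fp_time_le[OF \<omega>(2) edge_nonneg_\<tau>[OF \<omega>(1)] paths_in_lattice_box])
      thus "\<omega> \<in> {\<omega>\<in>space M. (mu k + \<xi>) * N \<le> time_in (\<lambda>e. \<tau> e \<omega>) (lattice_box n) 0 (axis k (int n))}"
        using \<omega>(1) by (simp add: time_constant_eq)
    qed measurable
    also have "\<dots> \<le> exp (- c * rate_g CARD('d) r n N)" using * n N by blast
    finally show ?thesis .
  qed
  thus "\<exists>c>0. \<forall>n\<ge>1. \<forall>N\<ge>real n.
      prob {\<omega> \<in> space M. ?T n \<omega> > ereal (?a N)} \<le> exp (- c * rate_g CARD('d) r n N)"
    using c by blast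
qed

end
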